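(* For every $n\ge2$, the set $\mathcal A^s_n$ of signed arc permutations, endowed with the map $w\mapsto\mathrm{sDes}(w)$, is a fine set for the $B_n$-character induced from the $B_{n-1}$-representation on the exterior algebra $\bigwedge V_{n-1}$. Equivalently, $$\sum_{w\in\mathcal A^s_n}F_{\mathrm{sDes}(w)}(x,y)=\mathrm{ch}\Big(\sum_{k=0}^{n-1}\chi^{(k),(1^{n-k-1})}\big\uparrow^{B_n}_{B_{n-1}}\Big).$$
   Context: $B_n$: signed permutations $w=(w(1),\dots,w(n))$; $|a|$ denotes the absolute value (bar removed). $w\in B_n$ is a signed arc permutation if for each $i\in\{2,\dots,n-1\}$: the set $\{|w(1)|,\dots,|w(i-1)|\}$ is an interval in $\mathbb Z_n$ (cyclically consecutive residues, $n$ identified with $0$), and $w(i)$ is unbarred if $|w(i)|-1\in\{|w(1)|,\dots,|w(i-1)|\}$ and barred if $|w(i)|+1\in\{|w(1)|,\dots,|w(i-1)|\}$ (arithmetic in $\mathbb Z_n$). $V_{n-1}$ is an $(n-1)$-dimensional complex vector space on which $B_{n-1}$ acts by permuting coordinates and switching their signs; $B_{n-1}\le B_n$ is the subgroup fixing $n$; $\uparrow^{B_n}_{B_{n-1}}$ is induction. $\chi^{\lambda,\mu}$ is the irreducible $B_{n-1}$-character with Frobenius characteristic $s_\lambda(x)s_\mu(y)$; $\mathrm{ch}(\chi)=\frac{1}{2^nn!}\sum_w\chi(w)p^+_\alpha p^-_\beta$ with $(\alpha,\beta)$ the signed cycle type of $w$ (lengths of positive cycles — pairs of disjoint cycles $c,\bar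 c$ on $\{1,\dots,n,\bar1,\dots,\bar n\}$ — and negative cycles $c=\bar c$, counted with half length), $p^\pm_j=\sum_i(x_i^j\pm y_i^j)$. $\mathrm{sDes}(w)=(S,\varepsilon)$: with $\bar1<_r\cdots<_r\bar n<_r1<_r\cdots<_rn$, $S$ consists of $n$ and all $s\in[n-1]$ with $w(s)>_rw(s+1)$ or with $w(s)$ barred and $w(s+1)$ unbarred; $\varepsilon(s)=-$ iff $w(s)$ barred. For $\sigma=(S,\varepsilon)$ with $S=\{s_1<\dots<s_m=n\}$, $s_0=0$: sign vector $\tilde\varepsilon(j)=\varepsilon(s_i)$ for $s_{i-1}<j\le s_i$; ${\rm wDes}(\sigma)$ the set of $s_i$, $i<m$, with $\varepsilon(s_i)=\varepsilon(s_{i+1})$ or ($\varepsilon(s_i)=+$, $\varepsilon(s_{i+1})=-$); $F_\sigma(x,y)=\sum z_{i_1}\cdots z_{i_n}$ over $i_1\le\dots\le i_n$ with $i_j<i_{j+1}$ for $j\in{\rm wDes}(\sigma)$, $z_{i_j}=x_{i_j}$ if $\tilde\varepsilon(j)=+$, else $y_{i_j}$. Fine sets: for a signed composition $\gamma=(\gamma_1,\dots,\gamma_m)$ of $n$ (some parts barred), partial sums $r_i$, $r_0=0$, $S(\gamma)=\{r_1,\dots,r_m\}$, blocks $I_i=\{r_{i-1}+1,\dots,r_i\}$: $\mathrm{wt}_\gamma(\sigma)=0$ if for some $i$, $S\cap\{r_{i-1}+1,\dots,r_i-1\}$ is not an initial segment of $\{r_{i-1}+1,\dots,r_i-1\}$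 or $\tilde\varepsilon$ is not constant on $I_i$; else $(-1)^{|S\setminus S(\gamma)|+n_\gamma(\sigma)}$, $n_\gamma(\sigma)$ the number of $i$ with $\tilde\varepsilon=-$ on $I_i$ and $\gamma_i$ barred. A finite set $\mathcal B$ with map $\mathrm{sDes}$ is fine for a class function $\chi$ of $B_n$ if $\chi(\gamma)=\sum_{b\in\mathcal B}\mathrm{wt}_\gamma(\mathrm{sDes}(b))$ for all $\gamma$, $\chi(\gamma)$ being the value at elements of signed cycle type (sorted unbarred parts; sorted barred parts of $\gamma$). *)

theory Defs
  imports
    "HOL-Library.Multiset"
    "HOL-Library.FuncSet"
    "HOL-Number_Theory.Cong"
    "HOL-Combinatorics.Permutations"
    "HOL-Combinatorics.Orbits"
    "Jordan_Normal_Form.Matrix"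
begin

section \<open>Formal power series in an arbitrary set of variables\<close>

text \<open>A monomial is the finite multiset of its variables; a series is its coefficient function.\<close>

typedef 'v mseries = "UNIV :: ('v multiset \<Rightarrow> complex) set"
  morphisms mcoeff Abs_mseries
  by simp

setup_lifting type_definition_mseries

lemma mseries_eqI: "(\<And>M. mcoeff f M = mcoeff g M) \<Longrightarrow> f = g"
  by transfer auto

instantiation mseries :: (type) comm_ring_1
begin

lift_definition zero_mseries :: "'a mseries" is "\<lambda>_. 0" .
lift_definition one_mseries :: "'a mseries" is "\<lambda>M. if M = {#} then 1 else 0" .
lift_definition plus_mseries :: "'a mseries \<Rightarrow> 'a mseries \<Rightarrow> 'a mseries"
  is "\<lambda>f g M. f M + g M" .
lift_definition uminus_mseries :: "'a mseries \<Rightarrow> 'a mseries" is "\<lambda>f M. - f M" .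
lift_definition minus_mseries :: "'a mseries \<Rightarrow> 'a mseries \<Rightarrow> 'a mseries"
  is "\<lambda>f g M. f M - g M" .
lift_definition times_mseries :: "'a mseries \<Rightarrow> 'a mseries \<Rightarrow> 'a mseries"
  is "\<lambda>f g M. \<Sum>A | A \<subseteq># M. f A * g (M - A)" .

instance
proof
  have fin: "finite {A. A \<subseteq># M}" for M :: "'a multiset"
  proof -
    have "{A. A \<subseteq># M} \<subseteq> mset ` {xs. set xs \<subseteq> set_mset M \<and> length xs \<le> size M}"
    proof
      fix A assume "A \<in> {A. A \<subseteq># M}"
      then have A: "A \<subseteq># M" by simp
      obtain xs where xs: "mset xs = A" using ex_mset by blast
      have "set xs \<subseteq> set_mset M" using A xs by (metis set_mset_mono set_mset_mset)
      moreover have "length xs \<le> size M" using A xs by (metis size_mset size_mset_mono)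
      ultimately show "A \<in> mset ` {xs. set xs \<subseteq> set_mset M \<and> length xs \<le> size M}"
        using xs by blast
    qed
    moreover have "finite (mset ` {xs. set xs \<subseteq> set_mset M \<and> length xs \<le> size M})"
      by (intro finite_imageI finite_lists_length_le finite_set_mset)
    ultimately show ?thesis by (rule finite_subset)
  qed
  fix a b c :: "'a mseries"
  show "a * b * c = a * (b * c)"
  proof (transfer, rule ext)
    fix f g h :: "'a multiset \<Rightarrow> complex" and M
    have "(\<Sum>A | A \<subseteq># M. (\<Sum>B | B \<subseteq># A. f B * g (A - B)) * h (M - A))
      = (\<Sum>(A, B) \<in> (SIGMA A:{A. A \<subseteq># M}. {B. B \<subseteq># A}). f B * g (A - B) * h (M - A))"
      by (subst sum.Sigma[symmetric]) (auto simp: fin sum_distrib_right)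
    also have "\<dots> = (\<Sum>(B, C) \<in> (SIGMA B:{B. B \<subseteq># M}. {C. C \<subseteq># M - B}).
        f B * g C * h (M - B - C))"
    proof (rule sum.reindex_bij_witness[of _ "\<lambda>(B, C). (B + C, B)" "\<lambda>(A, B). (B, A - B)"], goal_cases)
      case (1 p)
      then show ?case by (cases p) (simp add: subset_mset.add_diff_inverse)
    next
      case (2 p)
      then obtain A B where p: "p = (A, B)" "A \<subseteq># M" "B \<subseteq># A" by (cases p) simp
      then have "B \<subseteq># M" by (meson subset_mset.order_trans)
      moreover have "A - B \<subseteq># M - B"
        using p(2) by (simp add: subseteq_mset_def diff_le_mono)
      ultimately show ?case using p(1) by simp
    next
      case (3 p)
      then show ?case by (cases p) simp
    next
      case (4 p)
      then obtain B C where p: "p = (B, C)" "B \<subseteq># M" "C \<subseteq># M - B" by (cases p) simp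
      have "B + C \<subseteq># M"
      proof (rule mset_subset_eqI)
        fix a
        have "count B a \<le> count M a" "count C a \<le> count M a - count B a"
          using p(2,3) by (simp_all add: subseteq_mset_def)
        then show "count (B + C) a \<le> count M a" by simp
      qed
      then show ?case using p(1) by simp
    next
      case (5 p)
      then obtain A B where p: "p = (A, B)" "A \<subseteq># M" "B \<subseteq># A" by (cases p) simp
      have "M - B - (A - B) = M - A"
        using p(3) by (simp add: subset_mset.add_diff_inverse)
      then show ?case using p(1) by simp
    qed
    also have "\<dots> = (\<Sum>A | A \<subseteq># M. f A * (\<Sum>B | B \<subseteq># M - A. g B * h (M - A - B)))"
      by (subst sum.Sigma[symmetric]) (auto simp: fin sum_distrib_left mult.assoc)
    finally show "(\<Sum>A | A \<subseteq># M. (\<Sum>B | B \<subseteq># A. f B * g (A - B)) * h (M - A))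
      = (\<Sum>A | A \<subseteq># M. f A * (\<Sum>B | B \<subseteq># M - A. g B * h (M - A - B)))" .
  qed
  show "a * b = b * a"
  proof (transfer, rule ext)
    fix f g :: "'a multiset \<Rightarrow> complex" and M
    show "(\<Sum>A | A \<subseteq># M. f A * g (M - A)) = (\<Sum>A | A \<subseteq># M. g A * f (M - A))"
    proof (rule sum.reindex_bij_witness[of _ "\<lambda>A. M - A" "\<lambda>A. M - A"], goal_cases)
      case (3 A)
      then have "M - (M - A) = A" by (simp add: multiset_eq_iff subseteq_mset_def)
      then show ?case by simp
    next
      case (5 A)
      then have "M - (M - A) = A" by (simp add: multiset_eq_iff subseteq_mset_def)
      then show ?case by (simp add: mult.commute)
    qed (simp_all add: multiset_eq_iff subseteq_mset_def)
  qed
  show "1 * a = a"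
  proof (transfer, rule ext)
    fix f :: "'a multiset \<Rightarrow> complex" and M
    have "(\<Sum>A | A \<subseteq># M. (if A = {#} then 1 else 0) * f (M - A))
      = (\<Sum>A \<in> {{#}}. (if A = {#} then 1 else 0) * f (M - A))"
      by (rule sum.mono_neutral_right) (auto simp: fin)
    then show "(\<Sum>A | A \<subseteq># M. (if A = {#} then 1 else 0) * f (M - A)) = f M" by simp
  qed
  show "a + b + c = a + (b + c)" by transfer (simp add: add.assoc)
  show "a + b = b + a" by transfer (simp add: add.commute)
  show "0 + a = a" by transfer simp
  show "- a + a = 0" by transfer simp
  show "a - b = a + - b" by transfer simp
  show "(a + b) * c = a * c + b * c"
    by transfer (simp add: distrib_right sum.distrib)
  show "(0 :: 'a mseries) \<noteq> 1" by transfer (metis zero_neq_one)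
qed

end

lift_definition mconst :: "complex \<Rightarrow> 'v mseries" is "\<lambda>c M. if M = {#} then c else 0" .

datatype var = X nat | Y nat

lift_definition power_sum :: "(nat \<Rightarrow> var) \<Rightarrow> nat \<Rightarrow> var mseries"
  is "\<lambda>z j M. if \<exists>i. M = replicate_mset j (z i) then 1 else 0" .

definition p_plus :: "nat \<Rightarrow> var mseries" where
  "p_plus j = power_sum X j + power_sum Y j"

definition p_minus :: "nat \<Rightarrow> var mseries" where
  "p_minus j = power_sum X j - power_sum Y j"

text \<open>Rows and columns are numbered from 0; a partition may have trailing zeros, so that
  \<open>[0]\<close> is the empty partition.\<close>

definition young_diagram :: "nat list \<Rightarrow> (nat \<times> nat) set" where
  "young_diagram lam = {(i, j). i < length lam \<and> j < lam ! i}"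

definition ssyt :: "nat list \<Rightarrow> (nat \<times> nat \<Rightarrow> nat) set" where
  "ssyt lam = {T \<in> young_diagram lam \<rightarrow>\<^sub>E UNIV.
     (\<forall>i j. (i, Suc j) \<in> young_diagram lam \<longrightarrow> T (i, j) \<le> T (i, Suc j)) \<and>
     (\<forall>i j. (Suc i, j) \<in> young_diagram lam \<longrightarrow> T (i, j) < T (Suc i, j))}"

lift_definition schur :: "(nat \<Rightarrow> var) \<Rightarrow> nat list \<Rightarrow> var mseries"
  is "\<lambda>z lam M. of_nat (card {T \<in> ssyt lam.
        image_mset (\<lambda>c. z (T c)) (mset_set (young_diagram lam)) = M})" .


section \<open>Signed permutations\<close>

text \<open>The barred letter \<open>i\<close> is \<open>- i\<close>. Elements of all the groups are functions on the integers,
  so the subgroup of \<open>signed_perms n\<close> fixing \<open>n\<close> is literally \<open>signed_perms (n - 1)\<close>.\<close>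

definition signed_perms :: "nat \<Rightarrow> (int \<Rightarrow> int) set" where
  "signed_perms n = {w. w permutes ({- int n..int n} - {0}) \<and> (\<forall>i. w (- i) = - w i)}"

definition cycles :: "nat \<Rightarrow> (int \<Rightarrow> int) \<Rightarrow> int set set" where
  "cycles n w = orbit w ` ({- int n..int n} - {0})"

text \<open>A positive pair of cycles is represented by the union of the two cycles, so that half of the
  cardinality is the length for both kinds.\<close>

definition pos_cycles :: "nat \<Rightarrow> (int \<Rightarrow> int) \<Rightarrow> int set set" where
  "pos_cycles n w = {c \<union> uminus ` c | c. c \<in> cycles n w \<and> uminus ` c \<noteq> c}"

definition neg_cycles :: "nat \<Rightarrow> (int \<Rightarrow> int) \<Rightarrow> int set set" where
  "neg_cycles n w = {c \<in> cycles n w. uminus ` c = c}"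

definition signed_cycle_type :: "nat \<Rightarrow> (int \<Rightarrow> int) \<Rightarrow> nat multiset \<times> nat multiset" where
  "signed_cycle_type n w =
     (image_mset (\<lambda>c. card c div 2) (mset_set (pos_cycles n w)),
      image_mset (\<lambda>c. card c div 2) (mset_set (neg_cycles n w)))"

definition cyclic_interval :: "nat \<Rightarrow> int set \<Rightarrow> bool" where
  "cyclic_interval n A \<longleftrightarrow>
     (\<exists>a::int. \<exists>k::nat. (\<lambda>x. x mod int n) ` A = (\<lambda>j. (a + int j) mod int n) ` {..<k})"

definition signed_arc_perms :: "nat \<Rightarrow> (int \<Rightarrow> int) set" where
  "signed_arc_perms n = {w \<in> signed_perms n. \<forall>i \<in> {2..int n - 1}.
     (let A = (\<lambda>j. \<bar>w j\<bar>) ` {1..i - 1} in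
        cyclic_interval n A \<and>
        ((\<exists>a\<in>A. [\<bar>w i\<bar> - 1 = a] (mod int n)) \<longrightarrow> w i > 0) \<and>
        ((\<exists>a\<in>A. [\<bar>w i\<bar> + 1 = a] (mod int n)) \<longrightarrow> w i < 0))}"


section \<open>Signed descent sets, quasisymmetric functions and fine sets\<close>

definition less_r :: "int \<Rightarrow> int \<Rightarrow> bool" where
  "less_r a b \<longleftrightarrow> (a < 0 \<and> b < 0 \<and> \<bar>a\<bar> < \<bar>b\<bar>) \<or> (a < 0 \<and> 0 < b) \<or> (0 < a \<and> 0 < b \<and> a < b)"

text \<open>A signed set is a pair of a set and a sign function with values \<open>1\<close> and \<open>-1\<close>;
  only the values on the set are ever used.\<close>

type_synonym signed_set = "nat set \<times> (nat \<Rightarrow> int)"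

definition sDes :: "nat \<Rightarrow> (int \<Rightarrow> int) \<Rightarrow> signed_set" where
  "sDes n w =
     ({n} \<union> {s \<in> {1..n - 1}. less_r (w (int s + 1)) (w (int s)) \<or>
                              (w (int s) < 0 \<and> w (int s + 1) > 0)},
      \<lambda>s. if w (int s) < 0 then - 1 else 1)"

definition sign_vector :: "signed_set \<Rightarrow> nat \<Rightarrow> int" where
  "sign_vector \<sigma> j = snd \<sigma> (LEAST s. s \<in> fst \<sigma> \<and> j \<le> s)"

definition wDes :: "signed_set \<Rightarrow> nat set" where
  "wDes \<sigma> = {s \<in> fst \<sigma>. (\<exists>t \<in> fst \<sigma>. s < t) \<and>
     (let t = (LEAST t. t \<in> fst \<sigma> \<and> s < t) in
        snd \<sigma> s = snd \<sigma> t \<or> (snd \<sigma> s = 1 \<and> snd \<sigma> t = - 1))}"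

text \<open>The set of sequences counted here is finite, since the monomial bounds the indices.\<close>

lift_definition F_fun :: "nat \<Rightarrow> signed_set \<Rightarrow> var mseries"
  is "\<lambda>n \<sigma> M. of_nat (card {i \<in> {1..n} \<rightarrow>\<^sub>E (UNIV :: nat set).
        (\<forall>j \<in> {1..<n}. i j \<le> i (j + 1)) \<and>
        (\<forall>j \<in> wDes \<sigma>. i j < i (j + 1)) \<and>
        image_mset (\<lambda>j. if sign_vector \<sigma> j = 1 then X (i j) else Y (i j)) (mset_set {1..n}) = M})" .

text \<open>Barred parts are negative.\<close>

definition signed_compositions :: "nat \<Rightarrow> int list set" where
  "signed_compositions n = {\<gamma>. 0 \<notin> set \<gamma> \<and> (\<Sum>c\<leftarrow>\<gamma>. \<bar>c\<bar>) = int n}"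

definition composition_type :: "int list \<Rightarrow> nat multiset \<times> nat multiset" where
  "composition_type \<gamma> =
     (mset (map nat (filter (\<lambda>c. c > 0) \<gamma>)), mset (map (\<lambda>c. nat \<bar>c\<bar>) (filter (\<lambda>c. c < 0) \<gamma>)))"

text \<open>In the following, blocks are numbered from 0: the block \<open>i\<close> is
  \<open>{partial_sum \<gamma> i + 1..partial_sum \<gamma> (i + 1)}\<close>.\<close>

definition partial_sum :: "int list \<Rightarrow> nat \<Rightarrow> nat" where
  "partial_sum \<gamma> i = (\<Sum>c\<leftarrow>take i \<gamma>. nat \<bar>c\<bar>)"

definition block :: "int list \<Rightarrow> nat \<Rightarrow> nat set" where
  "block \<gamma> i = {partial_sum \<gamma> i + 1..partial_sum \<gamma> (i + 1)}"

definition initial_segment :: "nat set \<Rightarrow> nat set \<Rightarrow> bool" where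
  "initial_segment A B \<longleftrightarrow> A \<subseteq> B \<and> (\<forall>a \<in> A. \<forall>b \<in> B. b < a \<longrightarrow> b \<in> A)"

definition wt :: "int list \<Rightarrow> signed_set \<Rightarrow> int" where
  "wt \<gamma> \<sigma> =
     (if \<exists>i < length \<gamma>.
           (let J = {partial_sum \<gamma> i + 1..<partial_sum \<gamma> (i + 1)} in
             \<not> initial_segment (fst \<sigma> \<inter> J) J) \<or>
           \<not> (\<exists>e. \<forall>j \<in> block \<gamma> i. sign_vector \<sigma> j = e)
      then 0
      else (- 1) ^ (card (fst \<sigma> - partial_sum \<gamma> ` {1..length \<gamma>}) +
             card {i. i < length \<gamma> \<and> (\<forall>j \<in> block \<gamma> i. sign_vector \<sigma> j = - 1) \<and> \<gamma> ! i < 0}))"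

definition fine_set :: "nat \<Rightarrow> 'b set \<Rightarrow> ('b \<Rightarrow> signed_set) \<Rightarrow> ((int \<Rightarrow> int) \<Rightarrow> complex) \<Rightarrow> bool" where
  "fine_set n \<B> D \<chi> \<longleftrightarrow> finite \<B> \<and>
     (\<forall>\<gamma> \<in> signed_compositions n. \<forall>w \<in> signed_perms n.
        signed_cycle_type n w = composition_type \<gamma> \<longrightarrow>
        \<chi> w = of_int (\<Sum>b\<in>\<B>. wt \<gamma> (D b)))"


section \<open>Characters\<close>

text \<open>Characters of a group \<open>G\<close> of permutations are functions that vanish outside \<open>G\<close>.\<close>

definition representation ::
    "('a \<Rightarrow> 'a) set \<Rightarrow> nat \<Rightarrow> (('a \<Rightarrow> 'a) \<Rightarrow> complex mat) \<Rightarrow> bool" where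
  "representation G d \<rho> \<longleftrightarrow>
     (\<forall>u \<in> G. \<rho> u \<in> carrier_mat d d) \<and> \<rho> id = 1\<^sub>m d \<and>
     (\<forall>u \<in> G. \<forall>v \<in> G. \<rho> (u \<circ> v) = \<rho> u * \<rho> v)"

definition invariant_subspace ::
    "('a \<Rightarrow> 'a) set \<Rightarrow> nat \<Rightarrow> (('a \<Rightarrow> 'a) \<Rightarrow> complex mat) \<Rightarrow> complex vec set \<Rightarrow> bool" where
  "invariant_subspace G d \<rho> W \<longleftrightarrow>
     W \<subseteq> carrier_vec d \<and> 0\<^sub>v d \<in> W \<and>
     (\<forall>v \<in> W. \<forall>v' \<in> W. v + v' \<in> W) \<and> (\<forall>c. \<forall>v \<in> W. c \<cdot>\<^sub>v v \<in> W) \<and>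
     (\<forall>u \<in> G. \<forall>v \<in> W. \<rho> u *\<^sub>v v \<in> W)"

definition irreducible_representation ::
    "('a \<Rightarrow> 'a) set \<Rightarrow> nat \<Rightarrow> (('a \<Rightarrow> 'a) \<Rightarrow> complex mat) \<Rightarrow> bool" where
  "irreducible_representation G d \<rho> \<longleftrightarrow> representation G d \<rho> \<and> d > 0 \<and>
     (\<forall>W. invariant_subspace G d \<rho> W \<longrightarrow> W = {0\<^sub>v d} \<or> W = carrier_vec d)"

definition irreducible_character :: "('a \<Rightarrow> 'a) set \<Rightarrow> (('a \<Rightarrow> 'a) \<Rightarrow> complex) \<Rightarrow> bool" where
  "irreducible_character G \<chi> \<longleftrightarrow> (\<exists>d \<rho>. irreducible_representation G d \<rho> \<and>
     \<chi> = (\<lambda>u. if u \<in> G then \<Sum>i<d. \<rho> u $$ (i, i) else 0))"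

text \<open>The induced class function, by the Frobenius formula.\<close>

definition induced ::
    "('a \<Rightarrow> 'a) set \<Rightarrow> ('a \<Rightarrow> 'a) set \<Rightarrow> (('a \<Rightarrow> 'a) \<Rightarrow> complex) \<Rightarrow> ('a \<Rightarrow> 'a) \<Rightarrow> complex" where
  "induced H G \<chi> g =
     (if g \<in> G
      then (\<Sum>u | u \<in> G \<and> inv_into UNIV u \<circ> g \<circ> u \<in> H. \<chi> (inv_into UNIV u \<circ> g \<circ> u)) / of_nat (card H)
      else 0)"

definition ch :: "nat \<Rightarrow> ((int \<Rightarrow> int) \<Rightarrow> complex) \<Rightarrow> var mseries" where
  "ch n \<chi> = mconst (1 / (2 ^ n * fact n)) *
     (\<Sum>w \<in> signed_perms n. case signed_cycle_type n w of (\<alpha>, \<beta>) \<Rightarrow>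
        mconst (\<chi> w) * prod_mset (image_mset p_plus \<alpha>) * prod_mset (image_mset p_minus \<beta>))"

definition irr_char :: "nat \<Rightarrow> nat list \<Rightarrow> nat list \<Rightarrow> (int \<Rightarrow> int) \<Rightarrow> complex" where
  "irr_char n lam mu =
     (THE \<chi>. irreducible_character (signed_perms n) \<chi> \<and> ch n \<chi> = schur X lam * schur Y mu)"


section \<open>The exterior algebra\<close>

text \<open>An element of the exterior algebra of the space with basis \<open>e 1, \<dots>, e m\<close> is given by its
  coordinates with respect to the basis elements \<open>e I = e i\<^sub>1 \<and> \<dots> \<and> e i\<^sub>k\<close>, where
  \<open>I = {i\<^sub>1 < \<dots> < i\<^sub>k}\<close> is a subset of \<open>{1..m}\<close>; the sign in the product counts the
  inversions between the two factors.\<close>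

type_synonym ext = "int set \<Rightarrow> complex"

definition ext_basis :: "int set \<Rightarrow> ext" where
  "ext_basis I = (\<lambda>J. if J = I then 1 else 0)"

definition wedge :: "ext \<Rightarrow> ext \<Rightarrow> ext" where
  "wedge f g = (\<lambda>K. \<Sum>I \<in> Pow K.
     (- 1) ^ card {(i, j). i \<in> I \<and> j \<in> K - I \<and> j < i} * f I * g (K - I))"

text \<open>The image of the basis vector \<open>e i\<close> under a signed permutation.\<close>

definition vec_act :: "(int \<Rightarrow> int) \<Rightarrow> int \<Rightarrow> ext" where
  "vec_act w i = (\<lambda>J. of_int (sgn (w i)) * ext_basis {\<bar>w i\<bar>} J)"

definition ext_act :: "nat \<Rightarrow> (int \<Rightarrow> int) \<Rightarrow> ext \<Rightarrow> ext" where
  "ext_act m w f = (\<lambda>J. \<Sum>I \<in> Pow {1..int m}.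
     f I * foldr wedge (map (vec_act w) (sorted_list_of_set I)) (ext_basis {}) J)"

definition ext_char :: "nat \<Rightarrow> (int \<Rightarrow> int) \<Rightarrow> complex" where
  "ext_char m w =
     (if w \<in> signed_perms m then \<Sum>I \<in> Pow {1..int m}. ext_act m w (ext_basis I) I else 0)"

end

theory Submission
  imports Defs "HOL-Combinatorics.Cycles"
begin

text \<open>
  A signed arc permutation is determined by its sign vector \<open>\<epsilon>\<close> and a residue modulo \<open>n\<close>: the
  unbarred letters increase cyclically, the barred ones decrease cyclically. Hence for every \<open>\<epsilon>\<close> the
  \<open>n\<close> signed descent sets are obtained from one basic signed set (descents exactly at the sign changes and
  at the pairs of adjacent barred letters) by toggling, for \<open>s = 1, \<dots>, n\<close>, the position \<open>s\<close> if
  \<open>\<epsilon>(s) = \<epsilon>(s + 1)\<close>, and doing nothing otherwise. Both generating functions are evaluated from this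
  description. The weights sum up to the number of unbarred parts \<open>1\<close> of \<open>\<gamma>\<close> times the product over
  all parts of \<open>1 \<plusminus> (-1)\<^bsup>r-1\<^esup>\<close> (\<open>r\<close> the length of the part, with the minus sign for barred parts), which is the
  induced character, because the character of the exterior algebra is \<open>det (1 + w)\<close>. The quasisymmetric
  functions sum up to the sum of all variables times \<open>\<Sum>\<^sub>k h\<^sub>k(x) e\<^sub>n\<^sub>-\<^sub>1\<^sub>-\<^sub>k(y)\<close>.

  On the other side, the power sum product of \<open>w\<close> is a signed count of the colourings of
  \<open>{1, \<dots>, n}\<close> by variables that are constant on the cycles of \<open>w\<close>. This gives the characteristic
  \<open>h\<^sub>k(x) e\<^sub>j(y)\<close> of the \<open>j\<close>-th exterior power of \<open>V\<^sub>k\<^sub>+\<^sub>j\<close>, which is irreducible because the sign changes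
  separate the basis vectors and the permutations act transitively on them, and it shows that class functions are
  determined by their characteristics.
\<close>

unbundle no m_inv_syntax

section \<open>Finite permutation groups and their characters\<close>

definition class_function :: "('a \<Rightarrow> 'a) set \<Rightarrow> (('a \<Rightarrow> 'a) \<Rightarrow> 'b) \<Rightarrow> bool" where
  "class_function G f \<longleftrightarrow> (\<forall>u\<in>G. \<forall>h\<in>G. f (u \<circ> h \<circ> inv u) = f h)"

lemma class_functionD: "class_function G f \<Longrightarrow> u \<in> G \<Longrightarrow> h \<in> G \<Longrightarrow> f (u \<circ> h \<circ> inv u) = f h"
  by (simp add: class_function_def)

locale finite_permutation_group =
  fixes G :: "('a \<Rightarrow> 'a) set"
  assumes finite_carrier: "finite G"
    and bij_mem: "u \<in> G \<Longrightarrow> bij u"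
    and id_mem: "id \<in> G"
    and comp_mem: "u \<in> G \<Longrightarrow> v \<in> G \<Longrightarrow> u \<circ> v \<in> G"
    and inv_mem: "u \<in> G \<Longrightarrow> inv u \<in> G"
begin

lemma inv_comp: "u \<in> G \<Longrightarrow> inv u \<circ> u = id"
  using bij_mem by (simp add: bij_is_inj)

lemma comp_inv: "u \<in> G \<Longrightarrow> u \<circ> inv u = id"
  using bij_mem by (metis bij_is_surj surj_iff)

lemma inv_comp_cancel: "u \<in> G \<Longrightarrow> inv u \<circ> (u \<circ> h) = h"
  by (simp add: comp_assoc[symmetric] inv_comp)

lemma comp_inv_cancel: "u \<in> G \<Longrightarrow> u \<circ> (inv u \<circ> h) = h"
  by (simp add: comp_assoc[symmetric] comp_inv)

lemma funpow_mem: "u \<in> G \<Longrightarrow> u ^^ k \<in> G"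
  by (induction k) (simp_all add: id_mem comp_mem)

lemma bij_betw_comp_left:
  assumes "u \<in> G" shows "bij_betw ((\<circ>) u) G G"
  by (rule bij_betw_byWitness[where f' = "(\<circ>) (inv u)"])
    (use assms in \<open>auto simp: inv_comp_cancel comp_inv_cancel comp_mem inv_mem\<close>)

lemma bij_betw_conjugation:
  assumes "u \<in> G" shows "bij_betw (\<lambda>h. u \<circ> h \<circ> inv u) G G"
  by (rule bij_betw_byWitness[where f' = "\<lambda>h. inv u \<circ> h \<circ> u"])
    (use assms in \<open>auto simp: comp_assoc inv_comp comp_inv inv_comp_cancel comp_inv_cancel comp_mem inv_mem\<close>)

lemma card_translate:
  assumes "u \<in> G" shows "card {w \<in> G. P (u \<circ> w)} = card {w \<in> G. P w}"
proof -
  have "(\<Sum>w\<in>G. if P (u \<circ> w) then 1 else 0) = (\<Sum>w\<in>G. if P w then 1 else 0 :: nat)"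
    by (rule sum.reindex_bij_betw[OF bij_betw_comp_left[OF assms]])
  then show ?thesis using finite_carrier by (simp add: sum.If_cases Int_def)
qed

lemma card_transporter:
  assumes "u \<in> G" shows "card {w \<in> G. w x = u x} = card {w \<in> G. w x = x}"
proof -
  have "u (w x) = u x \<longleftrightarrow> w x = x" for w using bij_mem[OF assms] by (simp add: bij_is_inj inj_eq)
  then show ?thesis using card_translate[OF assms, of "\<lambda>w. w x = u x"] by simp
qed

lemma card_maps_into:
  assumes "A \<subseteq> (\<lambda>u. u x) ` G"
  shows "card {u \<in> G. u x \<in> A} = card A * card {u \<in> G. u x = x}"
proof -
  have "finite A" using assms finite_carrier by (blast intro: finite_subset)
  have "{u \<in> G. u x \<in> A} = (\<Union>a\<in>A. {u \<in> G. u x = a})" by blast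
  then have "card {u \<in> G. u x \<in> A} = (\<Sum>a\<in>A. card {u \<in> G. u x = a})"
    using \<open>finite A\<close> finite_carrier by (subst card_UN_disjoint[symmetric]) auto
  also have "\<dots> = (\<Sum>a\<in>A. card {u \<in> G. u x = x})"
    using assms by (intro sum.cong) (auto simp: card_transporter)
  finally show ?thesis by simp
qed

lemma card_orbit_stabilizer: "card G = card ((\<lambda>u. u x) ` G) * card {u \<in> G. u x = x}"
proof -
  have "{u \<in> G. u x \<in> (\<lambda>u. u x) ` G} = G" by blast
  then show ?thesis using card_maps_into[OF order_refl, of x] by simp
qed

lemma induced_eq_sum:
  assumes "g \<in> G"
  shows "induced H G f g
    = (\<Sum>u\<in>G. if inv u \<circ> g \<circ> u \<in> H then f (inv u \<circ> g \<circ> u) else 0) / of_nat (card H)"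
  using assms finite_carrier by (simp add: induced_def sum.inter_filter)

lemma Frobenius_reciprocity:
  assumes "H \<subseteq> G" and class_q: "class_function G q"
  shows "(\<Sum>g\<in>G. induced H G f g * q g) = of_nat (card G) / of_nat (card H) * (\<Sum>h\<in>H. f h * q h)"
proof -
  define f\<^sub>H where "f\<^sub>H h = (if h \<in> H then f h else 0)" for h
  have conj: "(\<Sum>g\<in>G. f\<^sub>H (inv u \<circ> g \<circ> u) * q g) = (\<Sum>h\<in>G. f\<^sub>H h * q h)" if u: "u \<in> G" for u
  proof -
    have "(\<Sum>g\<in>G. f\<^sub>H (inv u \<circ> g \<circ> u) * q g)
        = (\<Sum>h\<in>G. f\<^sub>H (inv u \<circ> (u \<circ> h \<circ> inv u) \<circ> u) * q (u \<circ> h \<circ> inv u))"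
      by (rule sum.reindex_bij_betw[OF bij_betw_conjugation[OF u], symmetric])
    also have "\<dots> = (\<Sum>h\<in>G. f\<^sub>H h * q h)"
      using u class_q by (intro sum.cong) (simp_all add: comp_assoc inv_comp_cancel inv_comp class_functionD[unfolded comp_assoc])
    finally show ?thesis .
  qed
  have "(\<Sum>g\<in>G. induced H G f g * q g) = (\<Sum>g\<in>G. \<Sum>u\<in>G. f\<^sub>H (inv u \<circ> g \<circ> u) * q g) / of_nat (card H)"
    by (simp add: induced_eq_sum f\<^sub>H_def sum_distrib_right sum_divide_distrib)
  also have "(\<Sum>g\<in>G. \<Sum>u\<in>G. f\<^sub>H (inv u \<circ> g \<circ> u) * q g) = (\<Sum>u\<in>G. \<Sum>g\<in>G. f\<^sub>H (inv u \<circ> g \<circ> u) * q g)"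
    by (rule sum.swap)
  also have "\<dots> = of_nat (card G) * (\<Sum>h\<in>G. f\<^sub>H h * q h)"
    by (simp add: conj)
  also have "(\<Sum>h\<in>G. f\<^sub>H h * q h) = (\<Sum>h\<in>H. f h * q h)"
    using assms(1) finite_carrier by (intro sum.mono_neutral_cong_right) (auto simp: f\<^sub>H_def)
  finally show ?thesis by simp
qed

lemma induced_from_stabilizer:
  assumes "g \<in> G" and H_eq: "H = {u \<in> G. u x = x}"
    and const: "\<And>u. u \<in> G \<Longrightarrow> inv u \<circ> g \<circ> u \<in> H \<Longrightarrow> f (inv u \<circ> g \<circ> u) = k"
  shows "induced H G f g = of_nat (card {a \<in> (\<lambda>u. u x) ` G. g a = a}) * k"
proof -
  let ?F = "{a \<in> (\<lambda>u. u x) ` G. g a = a}" and ?U = "{u \<in> G. inv u \<circ> g \<circ> u \<in> H}"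
  have "inv u \<circ> g \<circ> u \<in> H \<longleftrightarrow> g (u x) = u x" if "u \<in> G" for u
    using that assms(1) bij_inv_eq_iff[OF bij_mem[OF that], of x "g (u x)"]
    by (auto simp: H_eq comp_mem inv_mem eq_commute)
  then have "?U = {u \<in> G. u x \<in> ?F}" by auto
  then have card: "card ?U = card ?F * card H" using card_maps_into[of ?F x] by (auto simp: H_eq)
  have nonempty: "card H \<noteq> 0" using finite_carrier id_mem by (auto simp: H_eq)
  have "induced H G f g = (\<Sum>u\<in>?U. f (inv u \<circ> g \<circ> u)) / of_nat (card H)"
    using assms(1) by (simp add: induced_def)
  also have "(\<Sum>u\<in>?U. f (inv u \<circ> g \<circ> u)) = of_nat (card ?U) * k"
    using const by simp
  finally show ?thesis using nonempty card by simp
qed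

lemma irreducible_character_class_function:
  assumes "irreducible_character G \<chi>"
  shows "class_function G \<chi>"
proof -
  obtain d \<rho> where rep: "representation G d \<rho>" and \<chi>: "\<chi> = (\<lambda>u. if u \<in> G then \<Sum>i<d. \<rho> u $$ (i, i) else 0)"
    using assms unfolding irreducible_character_def irreducible_representation_def by blast
  have trace: "\<chi> (v \<circ> w) = (\<Sum>i<d. \<Sum>k<d. \<rho> v $$ (i, k) * \<rho> w $$ (k, i))" if "v \<in> G" "w \<in> G" for v w
  proof -
    have "\<rho> v \<in> carrier_mat d d" "\<rho> w \<in> carrier_mat d d" "\<rho> (v \<circ> w) = \<rho> v * \<rho> w"
      using rep that by (auto simp: representation_def)
    then show ?thesis
      using that by (simp add: \<chi> comp_mem scalar_prod_def lessThan_atLeast0)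
  qed
  have commute: "\<chi> (v \<circ> w) = \<chi> (w \<circ> v)" if "v \<in> G" "w \<in> G" for v w
    unfolding trace[OF that] trace[OF that(2,1)] by (subst sum.swap) (simp add: mult.commute)
  have "\<chi> (u \<circ> h \<circ> inv u) = \<chi> h" if "u \<in> G" "h \<in> G" for u h
    using that by (simp add: commute[of "u \<circ> h"] comp_mem inv_mem inv_comp_cancel)
  then show ?thesis by (simp add: class_function_def)
qed

end

lemma mat_diag_mult_vec_index:
  assumes "x \<in> carrier_vec d" "r < d" shows "(mat_diag d c *\<^sub>v x) $ r = c r * x $ r"
proof -
  have "(mat_diag d c *\<^sub>v x) $ r = (\<Sum>s = 0..<d. (if r = s then c s else 0) * x $ s)"
    using assms by (simp add: mat_diag_def scalar_prod_def)
  also have "\<dots> = (\<Sum>s = 0..<d. if s = r then c r * x $ r else 0)"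
    by (intro sum.cong) auto
  finally show ?thesis using assms(2) by simp
qed

lemma mult_mat_vec_unit_vec:
  fixes A :: "'a :: semiring_1 mat"
  shows "A \<in> carrier_mat r d \<Longrightarrow> q < d \<Longrightarrow> A *\<^sub>v unit_vec d q = col A q"
  by (intro eq_vecI) (auto simp: scalar_prod_right_unit)

lemma carrier_vec_subset_of_unit_vecs:
  fixes W :: "complex vec set"
  assumes "0\<^sub>v d \<in> W" "\<And>x y. x \<in> W \<Longrightarrow> y \<in> W \<Longrightarrow> x + y \<in> W" "\<And>a x. x \<in> W \<Longrightarrow> a \<cdot>\<^sub>v x \<in> W"
    and "\<And>q. q < d \<Longrightarrow> unit_vec d q \<in> W"
  shows "carrier_vec d \<subseteq> W"
proof
  fix x :: "complex vec" assume x: "x \<in> carrier_vec d"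
  have "vec d (\<lambda>q. if q < k then x $ q else 0) \<in> W" if "k \<le> d" for k
    using that
  proof (induction k)
    case 0
    have "vec d (\<lambda>q. if q < 0 then x $ q else 0) = 0\<^sub>v d" by (intro eq_vecI) auto
    then show ?case using assms(1) by simp
  next
    case (Suc k)
    have "vec d (\<lambda>q. if q < Suc k then x $ q else 0)
        = vec d (\<lambda>q. if q < k then x $ q else 0) + x $ k \<cdot>\<^sub>v unit_vec d k"
      using Suc.prems by (intro eq_vecI) (auto simp: less_Suc_eq)
    then show ?case using Suc assms(2-4) by simp
  qed
  from this[OF order_refl] have "vec d (\<lambda>q. if q < d then x $ q else 0) \<in> W" .
  also have "vec d (\<lambda>q. if q < d then x $ q else 0) = x" using x by (intro eq_vecI) auto
  finally show "x \<in> W" .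
qed

lemma invariant_subspace_isolate_coordinate:
  assumes W: "invariant_subspace G d \<rho> W" and x: "x \<in> W" "x $ p \<noteq> 0" and "p < d"
    and separating: "\<And>q. q < d \<Longrightarrow> p \<noteq> q \<Longrightarrow> \<exists>u\<in>G. \<exists>c. \<rho> u = mat_diag d c \<and> c p \<noteq> c q"
  shows "unit_vec d p \<in> W"
proof -
  have carrier: "y \<in> carrier_vec d" if "y \<in> W" for y
    using W that by (auto simp: invariant_subspace_def)
  have "\<exists>y\<in>W. y $ p \<noteq> 0 \<and> (\<forall>q\<in>Q. y $ q = 0)" if "finite Q" "Q \<subseteq> {..<d} - {p}" for Q
    using that
  proof (induction Q rule: finite_induct)
    case empty
    then show ?case using x by auto
  next
    case (insert q Q)
    then obtain y where y: "y \<in> W" "y $ p \<noteq> 0" "\<forall>q\<in>Q. y $ q = 0" by auto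
    obtain u c where u: "u \<in> G" "\<rho> u = mat_diag d c" "c p \<noteq> c q"
      using separating[of q] insert.prems by auto
    define z where "z = \<rho> u *\<^sub>v y + (- c q) \<cdot>\<^sub>v y"
    have "z $ r = (c r - c q) * y $ r" if "r < d" for r
      using carrier[OF y(1)] that by (simp add: z_def u(2) mat_diag_mult_vec_index algebra_simps)
    then have "z $ p \<noteq> 0" "\<forall>r\<in>insert q Q. z $ r = 0"
      using y u(3) insert.prems \<open>p < d\<close> by (auto simp: subset_iff)
    moreover have "z \<in> W" using W y(1) u(1) by (simp add: z_def invariant_subspace_def)
    ultimately show ?case by blast
  qed
  then obtain y where y: "y \<in> W" "y $ p \<noteq> 0" "\<forall>q\<in>{..<d} - {p}. y $ q = 0" by blast
  have "(1 / y $ p) \<cdot>\<^sub>v y = unit_vec d p"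
    using y carrier[OF y(1)] \<open>p < d\<close> by (intro eq_vecI) auto
  moreover have "(1 / y $ p) \<cdot>\<^sub>v y \<in> W" using W y(1) by (simp add: invariant_subspace_def)
  ultimately show ?thesis by simp
qed

lemma irreducible_representation_monomial:
  assumes "representation G d \<rho>" "d > 0"
    and separating: "\<And>p q. p < d \<Longrightarrow> q < d \<Longrightarrow> p \<noteq> q \<Longrightarrow> \<exists>u\<in>G. \<exists>c. \<rho> u = mat_diag d c \<and> c p \<noteq> c q"
    and transitive: "\<And>p q. p < d \<Longrightarrow> q < d \<Longrightarrow>
      \<exists>u\<in>G. \<exists>a. a \<noteq> 0 \<and> \<rho> u *\<^sub>v unit_vec d p = a \<cdot>\<^sub>v unit_vec d q"
  shows "irreducible_representation G d \<rho>"
proof -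
  have "W = carrier_vec d" if W: "invariant_subspace G d \<rho> W" and "W \<noteq> {0\<^sub>v d}" for W
  proof
    note closed = W[unfolded invariant_subspace_def]
    show "W \<subseteq> carrier_vec d" using closed by blast
    obtain x where x: "x \<in> W" "x \<noteq> 0\<^sub>v d" using closed \<open>W \<noteq> {0\<^sub>v d}\<close> by blast
    then have "dim_vec x = d" using closed by auto
    then obtain p where p: "p < d" "x $ p \<noteq> 0"
      using x(2) by (metis eq_vecI index_zero_vec)
    show "carrier_vec d \<subseteq> W"
    proof (rule carrier_vec_subset_of_unit_vecs)
      fix q assume q_less: "q < d"
      have unit_p: "unit_vec d p \<in> W"
        by (rule invariant_subspace_isolate_coordinate[OF W x(1) p(2,1)]) (use separating p in blast)
      obtain u a where u: "u \<in> G" "a \<noteq> 0" "\<rho> u *\<^sub>v unit_vec d p = a \<cdot>\<^sub>v unit_vec d q"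
        using transitive[OF p(1) q_less] by blast
      then have "(1 / a) \<cdot>\<^sub>v (\<rho> u *\<^sub>v unit_vec d p) = unit_vec d q"
        by (intro eq_vecI) auto
      moreover have "(1 / a) \<cdot>\<^sub>v (\<rho> u *\<^sub>v unit_vec d p) \<in> W" using closed unit_p u(1) by blast
      ultimately show "unit_vec d q \<in> W" by simp
    qed (use closed in blast)+
  qed
  then show ?thesis using assms(1,2) by (auto simp: irreducible_representation_def)
qed

section \<open>The hyperoctahedral group\<close>

abbreviation signed_letters :: "nat \<Rightarrow> int set" where
  "signed_letters n \<equiv> {- int n..int n} - {0}"

definition odd_extension :: "nat \<Rightarrow> (int \<Rightarrow> int) \<Rightarrow> int \<Rightarrow> int" where
  "odd_extension n f i = (if \<bar>i\<bar> \<in> {1..int n} then sgn i * f \<bar>i\<bar> else i)"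

definition unsigned :: "(int \<Rightarrow> int) \<Rightarrow> int \<Rightarrow> int" where
  "unsigned w i = sgn i * \<bar>w i\<bar>"

lemma mem_signed_letters_iff: "i \<in> signed_letters n \<longleftrightarrow> \<bar>i\<bar> \<in> {1..int n}"
  by auto

lemma signed_letters_eq: "signed_letters n = {1..int n} \<union> uminus ` {1..int n}"
  by auto

lemma card_signed_letters: "card (signed_letters n) = 2 * n"
  by (simp add: card_Diff_singleton)

lemma signed_perms_permutes: "w \<in> signed_perms n \<Longrightarrow> w permutes signed_letters n"
  by (simp add: signed_perms_def)

lemma signed_perms_uminus: "w \<in> signed_perms n \<Longrightarrow> w (- i) = - w i"
  by (simp add: signed_perms_def)

lemma signed_perms_inj: "w \<in> signed_perms n \<Longrightarrow> inj w"
  using signed_perms_permutes permutes_inj by blast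

lemma signed_perms_0: "w \<in> signed_perms n \<Longrightarrow> w 0 = 0"
  using signed_perms_permutes permutes_not_in by fastforce

lemma signed_perms_eq_0_iff: "w \<in> signed_perms n \<Longrightarrow> w i = 0 \<longleftrightarrow> i = 0"
  using inj_eq[OF signed_perms_inj, of w n i 0] signed_perms_0 by auto

lemma signed_perms_abs_mem_iff:
  assumes "w \<in> signed_perms n" shows "\<bar>w i\<bar> \<in> {1..int n} \<longleftrightarrow> \<bar>i\<bar> \<in> {1..int n}"
  using permutes_in_image[OF signed_perms_permutes[OF assms]] by (simp only: mem_signed_letters_iff)

lemma signed_perms_outside:
  assumes "w \<in> signed_perms n" "\<bar>i\<bar> \<notin> {1..int n}" shows "w i = i"
  using permutes_not_in[OF signed_perms_permutes[OF assms(1)]] assms(2) by (simp only: mem_signed_letters_iff)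

lemma signed_perms_abs: "w \<in> signed_perms n \<Longrightarrow> \<bar>w \<bar>i\<bar>\<bar> = \<bar>w i\<bar>"
  by (simp add: abs_if signed_perms_uminus)

lemma signed_perms_sgn_mult: "w \<in> signed_perms n \<Longrightarrow> w (sgn x * i) = sgn x * w i"
  using signed_perms_uminus signed_perms_0 by (cases x "0::int" rule: linorder_cases) auto

lemma signed_perms_sgn_abs: "w \<in> signed_perms n \<Longrightarrow> w i = sgn i * w \<bar>i\<bar>"
  using signed_perms_sgn_mult[of w n i "\<bar>i\<bar>"] by (simp add: mult_sgn_abs)

lemma signed_perms_eqI:
  assumes "u \<in> signed_perms n" "v \<in> signed_perms n" "\<And>i. i \<in> {1..int n} \<Longrightarrow> u i = v i"
  shows "u = v"
proof
  fix i show "u i = v i"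
  proof (cases "\<bar>i\<bar> \<in> {1..int n}")
    case True
    then have "u \<bar>i\<bar> = v \<bar>i\<bar>" by (rule assms(3))
    then show ?thesis by (metis assms(1,2) signed_perms_sgn_abs)
  next
    case False
    then show ?thesis using signed_perms_outside assms(1,2) by metis
  qed
qed

interpretation signed_perms: finite_permutation_group "signed_perms n" for n
proof
  show "finite (signed_perms n)"
    by (rule finite_subset[of _ "{w. w permutes signed_letters n}"])
      (auto simp: signed_perms_permutes finite_permutations)
  show "bij u" if "u \<in> signed_perms n" for u
    using signed_perms_permutes[OF that] by (rule permutes_bij)
  show "id \<in> signed_perms n" by (simp add: signed_perms_def permutes_id)
  show "u \<circ> v \<in> signed_perms n" if "u \<in> signed_perms n" "v \<in> signed_perms n" for u v
    using that by (auto simp: signed_perms_def intro: permutes_compose)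
  show "inv u \<in> signed_perms n" if u: "u \<in> signed_perms n" for u
  proof -
    note perm = signed_perms_permutes[OF u]
    have "inv u (- i) = - inv u i" for i
      using permutes_inverses(1)[OF perm] by (simp add: permutes_inv_eq[OF perm] signed_perms_uminus[OF u])
    then show ?thesis using permutes_inv[OF perm] by (simp add: signed_perms_def)
  qed
qed

lemma inj_on_abs_signed_perm:
  assumes "w \<in> signed_perms n" shows "inj_on (\<lambda>i. \<bar>w i\<bar>) {1..int n}"
proof (rule inj_onI)
  fix x y assume "x \<in> {1..int n}" "y \<in> {1..int n}" "\<bar>w x\<bar> = \<bar>w y\<bar>"
  then have "w x = w y \<or> w x = w (- y)" using signed_perms_uminus[OF assms] by (auto simp: abs_eq_iff)
  then have "x = y \<or> x = - y" using signed_perms_inj[OF assms] by (auto dest: injD)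
  then show "x = y" using \<open>x \<in> {1..int n}\<close> \<open>y \<in> {1..int n}\<close> by auto
qed

lemma abs_signed_perm_image:
  assumes "w \<in> signed_perms n" shows "(\<lambda>i. \<bar>w i\<bar>) ` {1..int n} = {1..int n}"
  using inj_on_abs_signed_perm[OF assms] signed_perms_abs_mem_iff[OF assms]
  by (intro endo_inj_surj) auto

lemma signed_permsI:
  assumes "\<And>x. x \<in> signed_letters n \<Longrightarrow> f x \<in> signed_letters n" "inj_on f (signed_letters n)"
    and fixed: "\<And>x. x \<notin> signed_letters n \<Longrightarrow> f x = x"
    and odd: "\<And>x. x \<in> signed_letters n \<Longrightarrow> f (- x) = - f x"
  shows "f \<in> signed_perms n"
proof -
  have "f ` signed_letters n = signed_letters n" using assms(1,2) by (intro endo_inj_surj) auto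
  then have "f permutes signed_letters n"
    using assms(2) fixed by (intro bij_imp_permutes) (simp_all add: bij_betw_def)
  moreover have "f (- x) = - f x" for x
    using odd fixed[of x] fixed[of "- x"] by (cases "x \<in> signed_letters n") auto
  ultimately show ?thesis by (simp add: signed_perms_def)
qed

lemma odd_extension_eq: "i \<in> {1..int n} \<Longrightarrow> odd_extension n f i = f i"
  by (simp add: odd_extension_def)

lemma odd_extension_signed_perm:
  assumes mem: "\<And>i. i \<in> {1..int n} \<Longrightarrow> \<bar>f i\<bar> \<in> {1..int n}" and inj: "inj_on (\<lambda>i. \<bar>f i\<bar>) {1..int n}"
  shows "odd_extension n f \<in> signed_perms n"
proof (rule signed_permsI)
  let ?g = "odd_extension n f"
  have abs: "\<bar>?g x\<bar> = \<bar>f \<bar>x\<bar>\<bar>" and sgn: "sgn (?g x) = sgn x * sgn (f \<bar>x\<bar>)" and nonzero: "f \<bar>x\<bar> \<noteq> 0"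
    if "x \<in> signed_letters n" for x
  proof -
    have x_abs: "\<bar>x\<bar> \<in> {1..int n}" using that by auto
    then have "\<bar>sgn x\<bar> = 1" by (auto simp: sgn_if)
    then show "\<bar>?g x\<bar> = \<bar>f \<bar>x\<bar>\<bar>" "sgn (?g x) = sgn x * sgn (f \<bar>x\<bar>)" "f \<bar>x\<bar> \<noteq> 0"
      using x_abs mem[OF x_abs] by (auto simp: odd_extension_def abs_mult sgn_mult)
  qed
  show "?g x \<in> signed_letters n" if "x \<in> signed_letters n" for x
  proof -
    have "\<bar>?g x\<bar> \<in> {1..int n}" unfolding abs[OF that] using that by (intro mem) auto
    then show ?thesis by (simp only: mem_signed_letters_iff)
  qed
  show "inj_on ?g (signed_letters n)"
  proof (rule inj_onI)
    fix x y assume xy: "x \<in> signed_letters n" "y \<in> signed_letters n" "?g x = ?g y"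
    then have "\<bar>f \<bar>x\<bar>\<bar> = \<bar>f \<bar>y\<bar>\<bar>" using abs by metis
    then have "\<bar>x\<bar> = \<bar>y\<bar>" using inj_onD[OF inj] xy(1,2) by (simp only: mem_signed_letters_iff)
    moreover have "sgn x = sgn y" using calculation sgn[OF xy(1)] sgn[OF xy(2)] nonzero[OF xy(1)] xy(3) by (simp add: sgn_eq_0_iff)
    ultimately show "x = y" by (metis mult_sgn_abs)
  qed
qed (auto simp: odd_extension_def)

lemma odd_extension_permutes:
  assumes "p permutes {1..int n}" shows "odd_extension n p \<in> signed_perms n"
proof -
  have mem: "p i \<in> {1..int n}" if "i \<in> {1..int n}" for i using permutes_in_image[OF assms] that by blast
  show ?thesis
  proof (rule odd_extension_signed_perm)
    show "inj_on (\<lambda>i. \<bar>p i\<bar>) {1..int n}"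
    proof (rule inj_onI)
      fix i j assume "i \<in> {1..int n}" "j \<in> {1..int n}" "\<bar>p i\<bar> = \<bar>p j\<bar>"
      then have "p i = p j" using mem[of i] mem[of j] by simp
      then show "i = j" by (rule injD[OF permutes_inj[OF assms]])
    qed
  qed (use mem in force)
qed

lemma unsigned_eq_abs: "0 < i \<Longrightarrow> unsigned w i = \<bar>w i\<bar>"
  by (simp add: unsigned_def)

lemma abs_unsigned: "w \<in> signed_perms n \<Longrightarrow> \<bar>unsigned w i\<bar> = \<bar>w i\<bar>"
  using signed_perms_0 by (auto simp: unsigned_def abs_mult sgn_if)

lemma signed_perms_sgn_unsigned: "0 < i \<Longrightarrow> w i = sgn (w i) * unsigned w i"
  by (simp add: unsigned_eq_abs sgn_mult_abs)

lemma unsigned_signed_perm: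
  assumes "w \<in> signed_perms n" shows "unsigned w \<in> signed_perms n"
proof -
  have "unsigned w = odd_extension n (\<lambda>i. \<bar>w i\<bar>)"
    using signed_perms_outside[OF assms] signed_perms_abs[OF assms]
    by (auto simp: unsigned_def odd_extension_def fun_eq_iff mult_sgn_abs)
  then show ?thesis
    using odd_extension_signed_perm[of n "\<lambda>i. \<bar>w i\<bar>"] inj_on_abs_signed_perm[OF assms]
      signed_perms_abs_mem_iff[OF assms] by auto
qed

lemma inj_unsigned: "w \<in> signed_perms n \<Longrightarrow> inj (unsigned w)"
  using unsigned_signed_perm signed_perms_inj by blast

lemma unsigned_comp:
  assumes "u \<in> signed_perms n" "v \<in> signed_perms n"
  shows "unsigned (u \<circ> v) = unsigned u \<circ> unsigned v"
proof
  fix i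
  have "sgn (unsigned v i) = sgn i"
    using signed_perms_eq_0_iff[OF assms(2), of i] by (auto simp: unsigned_def sgn_mult sgn_if)
  moreover have "\<bar>u (unsigned v i)\<bar> = \<bar>u (v i)\<bar>"
    by (metis signed_perms_abs[OF assms(1)] abs_unsigned[OF assms(2)])
  ultimately show "unsigned (u \<circ> v) i = (unsigned u \<circ> unsigned v) i"
    by (simp add: unsigned_def)
qed

lemma unsigned_id: "unsigned id = id"
  by (auto simp: unsigned_def mult_sgn_abs)

lemma unsigned_image: "w \<in> signed_perms n \<Longrightarrow> unsigned w ` {1..int n} = {1..int n}"
  using abs_signed_perm_image by (simp add: unsigned_eq_abs)

lemma bij_betw_unsigned: "w \<in> signed_perms n \<Longrightarrow> bij_betw (unsigned w) {1..int n} {1..int n}"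
  using unsigned_image inj_on_subset[OF inj_unsigned] by (auto simp: bij_betw_def)

lemma unsigned_mem: "w \<in> signed_perms n \<Longrightarrow> i \<in> {1..int n} \<Longrightarrow> unsigned w i \<in> {1..int n}"
  using unsigned_image by blast

lemma signed_perms_stabilizer:
  assumes "n \<ge> 1"
  shows "signed_perms (n - 1) = {u \<in> signed_perms n. u (int n) = int n}"
proof -
  have subset: "signed_letters (n - 1) \<subseteq> signed_letters n" by auto
  have "u permutes signed_letters (n - 1) \<longleftrightarrow> u permutes signed_letters n \<and> u (int n) = int n"
    if odd: "\<forall>i. u (- i) = - u i" for u
  proof
    assume "u permutes signed_letters (n - 1)"
    then show "u permutes signed_letters n \<and> u (int n) = int n"
      using permutes_subset[OF _ subset] assms by (auto intro: permutes_not_in simp: of_nat_diff)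
  next
    assume u: "u permutes signed_letters n \<and> u (int n) = int n"
    have "u x = x" if "x \<in> signed_letters n - signed_letters (n - 1)" for x
    proof -
      have "x = int n \<or> x = - int n" using that assms by auto
      then show ?thesis using u odd by auto
    qed
    then show "u permutes signed_letters (n - 1)" using u permutes_superset by blast
  qed
  then show ?thesis by (auto simp: signed_perms_def)
qed

lemma signed_perms_orbit:
  assumes "i \<in> {1..int n}" shows "(\<lambda>u. u i) ` signed_perms n = signed_letters n"
proof (intro equalityI subsetI)
  fix a assume a: "a \<in> signed_letters n"
  let ?f = "\<lambda>j. if j = i then a else transpose i \<bar>a\<bar> j"
  have abs: "\<bar>?f j\<bar> = transpose i \<bar>a\<bar> j" if "j \<in> {1..int n}" for j
    using a assms that by (auto simp: transpose_def)
  have perm: "transpose i \<bar>a\<bar> permutes {1..int n}"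
    using a assms by (intro permutes_swap_id) auto
  have "odd_extension n ?f \<in> signed_perms n"
  proof (rule odd_extension_signed_perm)
    show "\<bar>?f j\<bar> \<in> {1..int n}" if "j \<in> {1..int n}" for j
      unfolding abs[OF that] using permutes_in_image[OF perm] that by blast
    show "inj_on (\<lambda>j. \<bar>?f j\<bar>) {1..int n}"
      by (subst inj_on_cong[OF abs]) (auto intro: permutes_inj_on[OF perm])
  qed
  moreover have "odd_extension n ?f i = a" using assms by (simp add: odd_extension_eq)
  ultimately show "a \<in> (\<lambda>u. u i) ` signed_perms n" by (intro image_eqI[of a "\<lambda>u. u i" "odd_extension n ?f"]) simp_all
next
  fix a assume "a \<in> (\<lambda>u. u i) ` signed_perms n"
  then show "a \<in> signed_letters n"
    using assms signed_perms_abs_mem_iff[of _ n i] by (auto simp del: Diff_iff simp: mem_signed_letters_iff)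
qed

lemma card_signed_perms: "card (signed_perms n) = 2 ^ n * fact n"
proof (induction n)
  case 0
  have "signed_perms 0 = {id}"
    using signed_perms.id_mem signed_perms_eqI[of _ 0] by auto
  then show ?case by simp
next
  case (Suc n)
  have "card (signed_perms (Suc n)) = card (signed_letters (Suc n)) * card (signed_perms n)"
    using signed_perms.card_orbit_stabilizer[of "Suc n" "int (Suc n)"] signed_perms_orbit[of "int (Suc n)" "Suc n"]
      signed_perms_stabilizer[of "Suc n"] by simp
  then show ?case unfolding card_signed_letters Suc by (simp add: algebra_simps)
qed

section \<open>Inversion signs and the exterior algebra\<close>

definition inv_sign :: "(int \<Rightarrow> int) \<Rightarrow> int set \<Rightarrow> int" where
  "inv_sign a I = (\<Prod>i\<in>I. \<Prod>j\<in>I. if i < j then sgn (a j - a i) else 1)"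

definition ext_sign :: "(int \<Rightarrow> int) \<Rightarrow> int set \<Rightarrow> int" where
  "ext_sign w I = (\<Prod>i\<in>I. sgn (w i)) * inv_sign (unsigned w) I"

lemma sgn_mult_self: "sgn x * sgn x = 1" if "x \<noteq> 0" for x :: int
  using that by (auto simp: sgn_if)

lemma inv_sign_cong: "(\<And>i. i \<in> I \<Longrightarrow> a i = b i) \<Longrightarrow> inv_sign a I = inv_sign b I"
  unfolding inv_sign_def by (intro prod.cong refl) simp

lemma inv_sign_empty [simp]: "inv_sign a {} = 1"
  by (simp add: inv_sign_def)

lemma inv_sign_insert:
  assumes "finite I" "x \<notin> I"
  shows "inv_sign a (insert x I) = inv_sign a I * (\<Prod>i\<in>I. sgn ((a i - a x) * (i - x)))"
proof -
  have "sgn ((a i - a x) * (i - x))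
      = (if i < x then sgn (a x - a i) else 1) * (if x < i then sgn (a i - a x) else 1)"
    if "i \<in> I" for i
  proof -
    have "sgn (a x - a i) = - sgn (a i - a x)" by (simp add: sgn_if)
    then show ?thesis using that assms(2) by (cases i x rule: linorder_cases) (auto simp: sgn_mult)
  qed
  then have "(\<Prod>i\<in>I. sgn ((a i - a x) * (i - x)))
      = (\<Prod>i\<in>I. if i < x then sgn (a x - a i) else 1) * (\<Prod>i\<in>I. if x < i then sgn (a i - a x) else 1)"
    by (simp add: prod.distrib)
  then show ?thesis
    using assms by (simp add: inv_sign_def prod.distrib)
qed

lemma inv_sign_id: "finite I \<Longrightarrow> (\<And>i. i \<in> I \<Longrightarrow> a i = i) \<Longrightarrow> inv_sign a I = 1"
  unfolding inv_sign_def by (intro prod.neutral ballI) auto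

lemma inv_sign_comp:
  assumes "finite I" "inj_on c I"
  shows "inv_sign (a \<circ> c) I = inv_sign a (c ` I) * inv_sign c I"
  using assms
proof (induction I rule: finite_induct)
  case (insert x I)
  have new: "c x \<notin> c ` I" and inj: "inj_on c I" using insert by auto
  have "sgn (((a \<circ> c) i - (a \<circ> c) x) * (i - x))
      = sgn ((a (c i) - a (c x)) * (c i - c x)) * sgn ((c i - c x) * (i - x))" if "i \<in> I" for i
  proof -
    have "c i - c x \<noteq> 0" using new imageI[OF that, of c] by auto
    then have "sgn (c i - c x) * (sgn (c i - c x) * y) = y" for y
      by (simp add: sgn_mult_self mult.assoc[symmetric])
    then show ?thesis by (simp add: sgn_mult mult_ac)
  qed
  then have "(\<Prod>i\<in>I. sgn (((a \<circ> c) i - (a \<circ> c) x) * (i - x)))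
      = (\<Prod>i\<in>I. sgn ((a (c i) - a (c x)) * (c i - c x)) * sgn ((c i - c x) * (i - x)))"
    by simp
  also have "\<dots> = (\<Prod>i\<in>c ` I. sgn ((a i - a (c x)) * (i - c x))) * (\<Prod>i\<in>I. sgn ((c i - c x) * (i - x)))"
    by (simp add: prod.distrib prod.reindex[OF inj])
  finally have quotients: "(\<Prod>i\<in>I. sgn (((a \<circ> c) i - (a \<circ> c) x) * (i - x))) = \<dots>" .
  show ?case
    unfolding image_insert inv_sign_insert[OF insert(1,2)] quotients
      inv_sign_insert[OF finite_imageI[OF insert(1)] new] insert.IH[OF inj]
    by (simp only: ac_simps)
qed simp

lemma inv_sign_Un:
  assumes "finite A" "finite B" "A \<inter> B = {}"
  shows "inv_sign a (A \<union> B)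
    = inv_sign a A * inv_sign a B * (\<Prod>x\<in>A. \<Prod>y\<in>B. sgn ((a y - a x) * (y - x)))"
  using assms
proof (induction A rule: finite_induct)
  case (insert x A)
  have "inv_sign a (insert x A \<union> B) = inv_sign a (A \<union> B) * (\<Prod>i\<in>A \<union> B. sgn ((a i - a x) * (i - x)))"
    using insert by (simp add: inv_sign_insert)
  also have "(\<Prod>i\<in>A \<union> B. sgn ((a i - a x) * (i - x)))
      = (\<Prod>i\<in>A. sgn ((a i - a x) * (i - x))) * (\<Prod>i\<in>B. sgn ((a i - a x) * (i - x)))"
    using insert by (intro prod.union_disjoint) auto
  finally show ?case using insert by (simp add: inv_sign_insert ac_simps)
qed simp

lemma inv_sign_Un_invariant:
  assumes "finite A" "finite B" "A \<inter> B = {}" "a ` A = A" "a ` B = B"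
  shows "inv_sign a (A \<union> B) = inv_sign a A * inv_sign a B"
proof -
  have inj: "inj_on a A" "inj_on a B" using assms by (auto intro: eq_card_imp_inj_on)
  have "(\<Prod>x\<in>A. \<Prod>y\<in>B. sgn (a y - a x)) = (\<Prod>x\<in>a ` A. \<Prod>y\<in>a ` B. sgn (y - x))"
    by (simp add: prod.reindex[OF inj(1)] prod.reindex[OF inj(2)])
  then have "(\<Prod>x\<in>A. \<Prod>y\<in>B. sgn ((a y - a x) * (y - x)))
      = (\<Prod>x\<in>A. \<Prod>y\<in>B. sgn (y - x) * sgn (y - x))"
    using assms by (simp only: sgn_mult prod.distrib)
  also have "\<dots> = 1"
    using assms(3) by (intro prod.neutral ballI sgn_mult_self) auto
  finally show ?thesis using inv_sign_Un[OF assms(1-3)] by simp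
qed

lemma inv_sign_transpose:
  assumes "finite I" "p \<in> I" "q \<in> I" "p \<noteq> q"
  shows "inv_sign (transpose p q) I = - 1"
proof -
  let ?t = "transpose p q" and ?J = "I - {p, q}"
  have fixed: "?t i = i" if "i \<in> ?J" for i using that by (intro transpose_apply_other) auto
  have "inv_sign ?t ({p, q} \<union> ?J) = inv_sign ?t {p, q} * inv_sign ?t ?J"
  proof (rule inv_sign_Un_invariant)
    show "?t ` ?J = ?J" using fixed by force
  qed (use assms in auto)
  also have "inv_sign ?t {p, q} = - 1"
    using assms(4) by (cases p q rule: linorder_cases) (auto simp: inv_sign_def)
  also have "inv_sign ?t ?J = 1" using assms(1) fixed by (intro inv_sign_id) auto
  also have "{p, q} \<union> ?J = I" using assms by blast
  finally show ?thesis by simp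
qed

lemma inv_sign_cycle_of_list:
  "distinct cs \<Longrightarrow> inv_sign (cycle_of_list cs) (set cs) = (- 1) ^ (length cs - 1)"
proof (induction cs rule: cycle_of_list.induct)
  case (1 i j cs)
  let ?c = "cycle_of_list (j # cs)" and ?I = "set (j # cs)"
  have perm: "?c permutes ?I" by (rule cycle_permutes)
  have fixed: "?c i = i" using perm 1(2) by (intro permutes_not_in) auto
  have "inv_sign ?c ({i} \<union> ?I) = inv_sign ?c {i} * inv_sign ?c ?I"
    using 1(2) fixed permutes_image[OF perm] by (intro inv_sign_Un_invariant) auto
  also have "inv_sign ?c {i} = 1" using fixed by (intro inv_sign_id) auto
  finally have tail: "inv_sign ?c (set (i # j # cs)) = (- 1) ^ (length (j # cs) - 1)"
    using 1 by (simp add: insert_commute)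
  have image: "?c ` set (i # j # cs) = set (i # j # cs)"
    using permutes_image[OF perm] fixed by simp
  have "inv_sign (transpose i j \<circ> ?c) (set (i # j # cs))
      = inv_sign (transpose i j) (?c ` set (i # j # cs)) * inv_sign ?c (set (i # j # cs))"
    using permutes_inj_on[OF perm] finite_set by (intro inv_sign_comp)
  also have "inv_sign (transpose i j) (?c ` set (i # j # cs)) = - 1"
    unfolding image using 1(2) by (intro inv_sign_transpose) auto
  finally show ?case using tail by simp
qed (auto simp: inv_sign_def)

lemma orbit_eq_range: "permutation p \<Longrightarrow> orbit p x = range (\<lambda>k. (p ^^ k) x)"
  by (simp add: orbit_altdef_permutation full_SetCompr_eq)

lemma orbit_eq_set_support:
  assumes "permutation p" shows "orbit p x = set (support p x)"
  using support_set[OF assms, of x] unfolding orbit_eq_range[OF assms] by fastforce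

lemma card_orbit:
  assumes "permutation p" shows "card (orbit p x) = least_power p x"
  using distinct_card[OF cycle_of_permutation[OF assms, of x]]
  unfolding orbit_eq_set_support[OF assms] by simp

lemma inv_sign_orbit:
  assumes "permutation p" shows "inv_sign p (orbit p x) = (- 1) ^ (card (orbit p x) - 1)"
proof -
  have "inv_sign p (set (support p x)) = inv_sign (cycle_of_list (support p x)) (set (support p x))"
    using cycle_restrict[OF assms] by (rule inv_sign_cong)
  also have "\<dots> = (- 1) ^ (length (support p x) - 1)"
    using cycle_of_permutation[OF assms] by (rule inv_sign_cycle_of_list)
  finally show ?thesis
    using card_orbit[OF assms] by (simp add: orbit_eq_set_support[OF assms])
qed

lemma ext_sign_comp:
  assumes "u \<in> signed_perms n" "v \<in> signed_perms n" "I \<subseteq> {1..int n}"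
  shows "ext_sign (u \<circ> v) I = ext_sign u (unsigned v ` I) * ext_sign v I"
proof -
  have fin: "finite I" using assms(3) finite_subset by blast
  have inj: "inj_on (unsigned v) I" using inj_unsigned[OF assms(2)] inj_on_subset by blast
  have "sgn ((u \<circ> v) i) = sgn (u (unsigned v i)) * sgn (v i)" if "i \<in> I" for i
  proof -
    have "i > 0" using assms(3) that by auto
    then have "u (v i) = sgn (v i) * u (unsigned v i)"
      using signed_perms_sgn_unsigned signed_perms_sgn_mult[OF assms(1)] by metis
    then show ?thesis by (simp add: sgn_mult mult.commute)
  qed
  then have "(\<Prod>i\<in>I. sgn ((u \<circ> v) i)) = (\<Prod>i\<in>I. sgn (u (unsigned v i)) * sgn (v i))"
    by (rule prod.cong[OF refl])
  also have "\<dots> = (\<Prod>i\<in>unsigned v ` I. sgn (u i)) * (\<Prod>i\<in>I. sgn (v i))"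
    by (simp add: prod.distrib prod.reindex[OF inj])
  finally show ?thesis
    unfolding ext_sign_def unsigned_comp[OF assms(1,2)] inv_sign_comp[OF fin inj]
    by (simp add: ac_simps)
qed

lemma prod_sgn_diff:
  fixes y :: int
  assumes "finite K" "y \<notin> K"
  shows "(\<Prod>k\<in>K. sgn (k - y)) = (- 1) ^ card {k \<in> K. k < y}"
proof -
  have "(\<Prod>k\<in>K. sgn (k - y)) = (\<Prod>k\<in>K. if k < y then - 1 else 1)"
    using assms(2) by (intro prod.cong) (auto simp: sgn_if)
  also have "\<dots> = (\<Prod>k\<in>{k \<in> K. k < y}. - 1)" by (rule prod.inter_filter[OF assms(1), symmetric])
  finally show ?thesis by simp
qed

lemma wedge_basis:
  assumes "finite K" "y \<notin> K"
  shows "wedge (\<lambda>J. b * ext_basis {y} J) (\<lambda>J. c * ext_basis K J)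
    = (\<lambda>J. b * c * (- 1) ^ card {k \<in> K. k < y} * ext_basis (insert y K) J)"
proof
  fix J :: "int set"
  let ?inv = "\<lambda>I. {(i, j). i \<in> I \<and> j \<in> J - I \<and> j < i}"
  show "wedge (\<lambda>J. b * ext_basis {y} J) (\<lambda>J. c * ext_basis K J) J
    = b * c * (- 1) ^ card {k \<in> K. k < y} * ext_basis (insert y K) J"
  proof (cases "J = insert y K")
    case True
    have "?inv {y} = (\<lambda>k. (y, k)) ` {k \<in> K. k < y}" using True assms by auto
    then have "card (?inv {y}) = card {k \<in> K. k < y}" by (simp add: card_image inj_on_def)
    moreover have "wedge (\<lambda>J. b * ext_basis {y} J) (\<lambda>J. c * ext_basis K J) J
      = (\<Sum>I\<in>{{y}}. (- 1) ^ card (?inv I) * (b * ext_basis {y} I) * (c * ext_basis K (J - I)))"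
      unfolding wedge_def
      by (rule sum.mono_neutral_right) (use True assms in \<open>auto simp: ext_basis_def\<close>)
    ultimately show ?thesis using True assms by (simp add: ext_basis_def)
  next
    case False
    then have "(- 1) ^ card (?inv I) * (b * ext_basis {y} I) * (c * ext_basis K (J - I)) = 0"
      if "I \<in> Pow J" for I
      using that by (auto simp: ext_basis_def)
    then have "wedge (\<lambda>J. b * ext_basis {y} J) (\<lambda>J. c * ext_basis K J) J = 0"
      unfolding wedge_def by (intro sum.neutral) blast
    then show ?thesis using False by (simp add: ext_basis_def)
  qed
qed

lemma ext_sign_insert_less:
  assumes "w \<in> signed_perms n" "finite I" "\<forall>i\<in>I. x < i"
  shows "ext_sign w (insert x I)
    = sgn (w x) * ext_sign w I * (- 1) ^ card {k \<in> unsigned w ` I. k < unsigned w x}"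
proof -
  have inj: "inj (unsigned w)" by (rule inj_unsigned[OF assms(1)])
  have new: "x \<notin> I" "unsigned w x \<notin> unsigned w ` I" using assms(3) inj by (auto dest: injD)
  have "(\<Prod>i\<in>I. sgn ((unsigned w i - unsigned w x) * (i - x))) = (\<Prod>i\<in>I. sgn (unsigned w i - unsigned w x))"
    using assms(3) by (intro prod.cong refl) (auto simp: sgn_mult)
  also have "\<dots> = (\<Prod>k\<in>unsigned w ` I. sgn (k - unsigned w x))"
    by (simp add: prod.reindex[OF inj_on_subset[OF inj]])
  also have "\<dots> = (- 1) ^ card {k \<in> unsigned w ` I. k < unsigned w x}"
    using new assms(2) by (intro prod_sgn_diff) auto
  finally show ?thesis
    using new assms(2) by (simp add: ext_sign_def inv_sign_insert)
qed

lemma foldr_wedge_vec_act: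
  assumes "w \<in> signed_perms n" "sorted_wrt (<) xs" "set xs \<subseteq> {1..int n}"
  shows "foldr wedge (map (vec_act w) xs) (ext_basis {})
    = (\<lambda>J. of_int (ext_sign w (set xs)) * ext_basis (unsigned w ` set xs) J)"
  using assms(2,3)
proof (induction xs)
  case Nil
  then show ?case by (simp add: ext_sign_def)
next
  case (Cons x xs)
  have x_least: "x > 0" "\<forall>i\<in>set xs. x < i" using Cons.prems by auto
  have new: "unsigned w x \<notin> unsigned w ` set xs"
    using x_least(2) inj_unsigned[OF assms(1)] by (auto dest: injD)
  have "foldr wedge (map (vec_act w) (x # xs)) (ext_basis {})
      = wedge (\<lambda>J. of_int (sgn (w x)) * ext_basis {unsigned w x} J)
          (\<lambda>J. of_int (ext_sign w (set xs)) * ext_basis (unsigned w ` set xs) J)"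
    using Cons x_least(1) by (simp add: vec_act_def[of w x] unsigned_eq_abs)
  also have "\<dots> = (\<lambda>J. of_int (ext_sign w (insert x (set xs)))
      * ext_basis (insert (unsigned w x) (unsigned w ` set xs)) J)"
    unfolding wedge_basis[OF finite_imageI[OF finite_set] new]
      ext_sign_insert_less[OF assms(1) finite_set x_least(2)] by simp
  finally show ?case by simp
qed

lemma ext_act_basis:
  assumes "w \<in> signed_perms m" "I \<subseteq> {1..int m}"
  shows "ext_act m w (ext_basis I) J = of_int (ext_sign w I) * ext_basis (unsigned w ` I) J"
proof -
  have fin: "finite I" using assms(2) finite_subset by blast
  have "ext_act m w (ext_basis I) J
      = (\<Sum>K\<in>{I}. ext_basis I K * foldr wedge (map (vec_act w) (sorted_list_of_set K)) (ext_basis {}) J)"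
    unfolding ext_act_def by (rule sum.mono_neutral_right) (use assms(2) in \<open>auto simp: ext_basis_def\<close>)
  then show ?thesis
    using foldr_wedge_vec_act[OF assms(1), of "sorted_list_of_set I"] assms(2) fin by (simp add: ext_basis_def)
qed

lemma ext_char_eq_sum_ext_sign:
  assumes "w \<in> signed_perms m"
  shows "ext_char m w = of_int (\<Sum>I | I \<subseteq> {1..int m} \<and> unsigned w ` I = I. ext_sign w I)"
proof -
  have "ext_char m w = of_int (\<Sum>I\<in>Pow {1..int m}. if unsigned w ` I = I then ext_sign w I else 0)"
    unfolding ext_char_def of_int_sum using assms
    by (simp add: ext_act_basis) (auto intro!: sum.cong simp: ext_basis_def)
  also have "(\<Sum>I\<in>Pow {1..int m}. if unsigned w ` I = I then ext_sign w I else 0)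
      = (\<Sum>I\<in>{I \<in> Pow {1..int m}. unsigned w ` I = I}. ext_sign w I)"
    by (rule sum.inter_filter[symmetric]) simp
  finally show ?thesis by simp
qed

section \<open>Signed cycle types\<close>

definition abs_cycles :: "nat \<Rightarrow> (int \<Rightarrow> int) \<Rightarrow> int set set" where
  "abs_cycles n w = orbit (unsigned w) ` {1..int n}"

definition cycle_sign :: "(int \<Rightarrow> int) \<Rightarrow> int set \<Rightarrow> int" where
  "cycle_sign w b = (\<Prod>i\<in>b. sgn (w i))"

lemma orbit_eq_of_mem: "permutation p \<Longrightarrow> y \<in> orbit p x \<Longrightarrow> orbit p y = orbit p x"
  by (rule orbit_cyclic_eq3[OF cyclic_on_orbit'])

lemma finite_orbit_permutation: "permutation p \<Longrightarrow> finite (orbit p x)"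
  by (intro finite_orbit permutation_self_in_orbit)

lemma orbit_image:
  assumes "permutation p" shows "p ` orbit p x = orbit p x"
proof (rule endo_inj_surj[OF finite_orbit_permutation[OF assms]])
  show "p ` orbit p x \<subseteq> orbit p x" by (auto intro: orbit.step)
  show "inj_on p (orbit p x)"
    using assms by (meson permutation_bijective bij_is_inj inj_on_subset subset_UNIV)
qed

lemma bij_betw_funpow_orbit:
  assumes "permutation p"
  shows "bij_betw (\<lambda>t. (p ^^ t) x) {..<card (orbit p x)} (orbit p x)"
proof -
  have "distinct (support p x)" by (rule cycle_of_permutation[OF assms])
  then show ?thesis
    unfolding bij_betw_def card_orbit[OF assms] unfolding orbit_eq_set_support[OF assms]
    by (simp add: distinct_map atLeast0LessThan)
qed

lemma orbit_conjugation:
  assumes "bij u" shows "orbit (u \<circ> h \<circ> inv u) (u x) = u ` orbit h x"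
proof (intro equalityI subsetI)
  have inv_u: "inv u (u y) = y" for y using assms by (simp add: bij_is_inj)
  fix y assume "y \<in> orbit (u \<circ> h \<circ> inv u) (u x)"
  then show "y \<in> u ` orbit h x"
    by (induction rule: orbit.induct) (auto simp: inv_u intro: orbit.intros)
next
  have inv_u: "inv u (u y) = y" for y using assms by (simp add: bij_is_inj)
  fix y assume "y \<in> u ` orbit h x"
  then obtain z where "z \<in> orbit h x" and y: "y = u z" by blast
  then show "y \<in> orbit (u \<circ> h \<circ> inv u) (u x)"
    unfolding y by (induction rule: orbit.induct)
      (metis comp_apply inv_u orbit.base, metis comp_apply inv_u orbit.step)
qed

lemma signed_perms_permutation: "w \<in> signed_perms n \<Longrightarrow> permutation w"
  unfolding permutation_permutes using signed_perms_permutes finite_Diff finite_atLeastAtMost_int by blast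

lemma unsigned_permutation: "w \<in> signed_perms n \<Longrightarrow> permutation (unsigned w)"
  by (rule signed_perms_permutation[OF unsigned_signed_perm])

lemma unsigned_funpow:
  assumes "w \<in> signed_perms n" shows "unsigned (w ^^ k) = unsigned w ^^ k"
proof (induction k)
  case (Suc k)
  then show ?case
    using unsigned_comp[OF assms signed_perms.funpow_mem[OF assms, of k]] by (simp only: funpow.simps)
qed (simp only: funpow.simps unsigned_id)

lemma unsigned_funpow_mem:
  "w \<in> signed_perms n \<Longrightarrow> x \<in> {1..int n} \<Longrightarrow> (unsigned w ^^ k) x \<in> {1..int n}"
  using unsigned_mem[OF signed_perms.funpow_mem] by (metis unsigned_funpow)

lemma abs_funpow:
  "w \<in> signed_perms n \<Longrightarrow> 0 < x \<Longrightarrow> \<bar>(w ^^ k) x\<bar> = (unsigned w ^^ k) x"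
  by (metis unsigned_eq_abs unsigned_funpow)

lemma funpow_eq_sgn_mult:
  "w \<in> signed_perms n \<Longrightarrow> 0 < x \<Longrightarrow> (w ^^ k) x = sgn ((w ^^ k) x) * (unsigned w ^^ k) x"
  by (simp add: abs_funpow[symmetric] sgn_mult_abs)

lemma sgn_funpow:
  assumes w: "w \<in> signed_perms n" and "0 < x"
  shows "sgn ((w ^^ k) x) = (\<Prod>t<k. sgn (w ((unsigned w ^^ t) x)))"
proof (induction k)
  case (Suc k)
  have "(w ^^ Suc k) x = w (sgn ((w ^^ k) x) * (unsigned w ^^ k) x)"
    using funpow_eq_sgn_mult[OF assms, of k] by simp
  also have "\<dots> = sgn ((w ^^ k) x) * w ((unsigned w ^^ k) x)" by (rule signed_perms_sgn_mult[OF w])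
  finally have "sgn ((w ^^ Suc k) x) = sgn ((w ^^ k) x) * sgn (w ((unsigned w ^^ k) x))" by (simp add: sgn_mult)
  then show ?case using Suc by simp
qed (use assms in simp)

lemma abs_cycle_subset: "w \<in> signed_perms n \<Longrightarrow> b \<in> abs_cycles n w \<Longrightarrow> b \<subseteq> {1..int n}"
  using unsigned_funpow_mem[of w n] by (auto simp: abs_cycles_def orbit_eq_range[OF unsigned_permutation])

lemma finite_abs_cycle: "w \<in> signed_perms n \<Longrightarrow> b \<in> abs_cycles n w \<Longrightarrow> finite b"
  by (rule finite_subset[OF abs_cycle_subset]) auto

lemma unsigned_image_abs_cycle: "w \<in> signed_perms n \<Longrightarrow> b \<in> abs_cycles n w \<Longrightarrow> unsigned w ` b = b"
  unfolding abs_cycles_def by (elim imageE) (simp only: orbit_image[OF unsigned_permutation])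

lemma abs_cycle_nonempty: "b \<in> abs_cycles n w \<Longrightarrow> b \<noteq> {}"
  using orbit_nonempty[of "unsigned w"] by (auto simp: abs_cycles_def)

lemma abs_cycle_eq_orbit:
  "w \<in> signed_perms n \<Longrightarrow> b \<in> abs_cycles n w \<Longrightarrow> x \<in> b \<Longrightarrow> orbit (unsigned w) x = b"
  using orbit_eq_of_mem[OF unsigned_permutation] by (auto simp: abs_cycles_def)

lemma Min_abs_cycle:
  assumes "w \<in> signed_perms n" "b \<in> abs_cycles n w"
  shows "Min b \<in> b" "Min b \<in> {1..int n}"
proof -
  show "Min b \<in> b" using finite_abs_cycle[OF assms] abs_cycle_nonempty[OF assms(2)] by (rule Min_in)
  then show "Min b \<in> {1..int n}" using abs_cycle_subset[OF assms] by blast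
qed

lemma self_in_abs_cycle: "w \<in> signed_perms n \<Longrightarrow> x \<in> orbit (unsigned w) x"
  by (rule permutation_self_in_orbit[OF unsigned_permutation])

lemma orbit_in_abs_cycles: "x \<in> {1..int n} \<Longrightarrow> orbit (unsigned w) x \<in> abs_cycles n w"
  by (simp add: abs_cycles_def)

lemma finite_abs_cycles: "finite (abs_cycles n w)"
  by (simp add: abs_cycles_def)

lemma card_abs_cycles_le: "card (abs_cycles n w) \<le> n"
  using card_image_le[of "{1..int n}" "orbit (unsigned w)"] by (simp add: abs_cycles_def)

lemma abs_cycles_disjoint:
  "w \<in> signed_perms n \<Longrightarrow> b \<in> abs_cycles n w \<Longrightarrow> c \<in> abs_cycles n w \<Longrightarrow> b \<noteq> c \<Longrightarrow> b \<inter> c = {}"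
  using abs_cycle_eq_orbit by blast

lemma Union_abs_cycles:
  assumes "w \<in> signed_perms n" shows "\<Union>(abs_cycles n w) = {1..int n}"
  using abs_cycle_subset[OF assms] self_in_abs_cycle[OF assms] by (auto simp: abs_cycles_def simp del: atLeastAtMost_iff)

lemma abs_cycle_sign:
  assumes "w \<in> signed_perms n" "b \<subseteq> {1..int n}"
  shows "\<bar>cycle_sign w b\<bar> = 1"
proof -
  have "w i \<noteq> 0" if "i \<in> b" for i
    using signed_perms_eq_0_iff[OF assms(1), of i] assms(2) that by auto
  then show ?thesis by (auto simp: cycle_sign_def abs_prod intro!: prod.neutral)
qed

lemma cycle_sign_cases:
  assumes "w \<in> signed_perms n" "b \<in> abs_cycles n w"
  obtains (pos) "cycle_sign w b = 1" | (neg) "cycle_sign w b = - 1"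
  using abs_cycle_sign[OF assms(1) abs_cycle_subset[OF assms]] by linarith

lemma cycle_sign_neq_1_iff:
  assumes "w \<in> signed_perms n" "b \<in> abs_cycles n w"
  shows "cycle_sign w b \<noteq> 1 \<longleftrightarrow> cycle_sign w b = - 1"
  by (rule cycle_sign_cases[OF assms]) simp_all

lemma funpow_mult_card_orbit:
  assumes w: "w \<in> signed_perms n" and x: "x \<in> {1..int n}"
  defines "b \<equiv> orbit (unsigned w) x"
  shows "(w ^^ (q * card b)) x = cycle_sign w b ^ q * x"
proof -
  note perm = unsigned_permutation[OF w]
  have "0 < x" using x by simp
  have "sgn ((w ^^ card b) x) = cycle_sign w b"
    unfolding sgn_funpow[OF w \<open>0 < x\<close>] cycle_sign_def b_def
    by (rule prod.reindex_bij_betw[OF bij_betw_funpow_orbit[OF perm]])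
  moreover have "(unsigned w ^^ card b) x = x"
    unfolding b_def card_orbit[OF perm] by (rule least_power_of_permutation(1)[OF perm])
  ultimately have period: "(w ^^ card b) x = cycle_sign w b * x"
    using funpow_eq_sgn_mult[OF w \<open>0 < x\<close>, of "card b"] by simp
  have "b \<in> abs_cycles n w" unfolding b_def using x by (rule orbit_in_abs_cycles)
  then have linear: "(w ^^ k) (cycle_sign w b * x) = cycle_sign w b * (w ^^ k) x" for k
    using signed_perms_uminus[OF signed_perms.funpow_mem[OF w]] by (cases rule: cycle_sign_cases[OF w]) auto
  show ?thesis
  proof (induction q)
    case (Suc q)
    have "(w ^^ (Suc q * card b)) x = (w ^^ (q * card b)) ((w ^^ card b) x)"
      by (simp add: funpow_add add.commute[of "card b"])
    then show ?case using Suc period linear by simp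
  qed simp
qed

lemma funpow_eq_sign_mult_iff:
  assumes w: "w \<in> signed_perms n" and x: "x \<in> {1..int n}" and s: "\<bar>s\<bar> = 1"
  defines "b \<equiv> orbit (unsigned w) x"
  shows "(w ^^ k) x = s * x \<longleftrightarrow> card b dvd k \<and> s = cycle_sign w b ^ (k div card b)"
proof
  assume eq: "(w ^^ k) x = s * x"
  then have "(unsigned w ^^ k) x = x" using abs_funpow[OF w, of x k] x s by (simp add: abs_mult)
  then have "card b dvd k"
    unfolding b_def card_orbit[OF unsigned_permutation[OF w]] by (rule least_power_minimal)
  then show "card b dvd k \<and> s = cycle_sign w b ^ (k div card b)"
    using eq funpow_mult_card_orbit[OF w x, of "k div card b"] x by (simp add: b_def)
next
  assume "card b dvd k \<and> s = cycle_sign w b ^ (k div card b)"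
  then show "(w ^^ k) x = s * x"
    using funpow_mult_card_orbit[OF w x, of "k div card b"] by (simp add: b_def)
qed

lemma orbit_uminus:
  assumes "w \<in> signed_perms n" shows "orbit w (- x) = uminus ` orbit w x"
  unfolding orbit_eq_range[OF signed_perms_permutation[OF assms]] image_image
  by (simp add: signed_perms_uminus[OF signed_perms.funpow_mem[OF assms]])

lemma uminus_uminus_image: "uminus ` uminus ` A = (A :: int set)"
  by (simp add: image_image)

lemma Un_uminus_image_eq: "A \<union> uminus ` A = {y. \<bar>y\<bar> \<in> abs ` A}" for A :: "int set"
proof (intro equalityI subsetI)
  fix y assume "y \<in> {y. \<bar>y\<bar> \<in> abs ` A}"
  then obtain z where "z \<in> A" "y = z \<or> y = - z" by (auto simp: abs_eq_iff)
  then show "y \<in> A \<union> uminus ` A" by auto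
qed auto

lemma orbit_Un_uminus_of_pos:
  assumes w: "w \<in> signed_perms n" and x: "0 < x"
  shows "orbit w x \<union> uminus ` orbit w x = orbit (unsigned w) x \<union> uminus ` orbit (unsigned w) x"
proof -
  have "orbit (unsigned w) x = abs ` orbit w x"
    unfolding orbit_eq_range[OF signed_perms_permutation[OF w]] orbit_eq_range[OF unsigned_permutation[OF w]]
    by (simp add: image_image abs_funpow[OF w x])
  then have "abs ` orbit (unsigned w) x = abs ` orbit w x" by (simp add: image_image)
  then show ?thesis by (simp only: Un_uminus_image_eq)
qed

lemma orbit_Un_uminus:
  assumes w: "w \<in> signed_perms n" and x: "x \<in> signed_letters n"
  defines "b \<equiv> orbit (unsigned w) \<bar>x\<bar>"
  shows "orbit w x \<union> uminus ` orbit w x = b \<union> uminus ` b"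
proof (cases "0 < x")
  case True
  then show ?thesis using orbit_Un_uminus_of_pos[OF w True] by (simp add: b_def)
next
  case False
  then have "0 < - x" using x by auto
  then show ?thesis
    using orbit_Un_uminus_of_pos[OF w, of "- x"] orbit_uminus[OF w, of x]
    by (simp add: b_def uminus_uminus_image Un_commute)
qed

lemma uminus_orbit_eq_iff:
  assumes w: "w \<in> signed_perms n" and x: "x \<in> signed_letters n"
  shows "uminus ` orbit w x = orbit w x \<longleftrightarrow> cycle_sign w (orbit (unsigned w) \<bar>x\<bar>) = - 1"
proof -
  note perm = signed_perms_permutation[OF w]
  let ?b = "orbit (unsigned w) \<bar>x\<bar>"
  have abs_x: "\<bar>x\<bar> \<in> {1..int n}" using x by auto
  have "uminus ` orbit w x = orbit w x \<longleftrightarrow> uminus ` orbit w \<bar>x\<bar> = orbit w \<bar>x\<bar>"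
    using orbit_uminus[OF w, of x] uminus_uminus_image by (cases "0 \<le> x") (auto simp: abs_if)
  also have "\<dots> \<longleftrightarrow> - \<bar>x\<bar> \<in> orbit w \<bar>x\<bar>"
    using orbit_uminus[OF w, of "\<bar>x\<bar>"] orbit_eq_of_mem[OF perm] permutation_self_in_orbit[OF perm] by metis
  also have "\<dots> \<longleftrightarrow> (\<exists>k. (w ^^ k) \<bar>x\<bar> = - 1 * \<bar>x\<bar>)"
    unfolding orbit_eq_range[OF perm] by (auto simp: image_iff eq_commute)
  also have "\<dots> \<longleftrightarrow> (\<exists>q. - 1 = cycle_sign w ?b ^ q)"
  proof
    assume "\<exists>q. - 1 = cycle_sign w ?b ^ q"
    then obtain q where "(w ^^ (q * card ?b)) \<bar>x\<bar> = - 1 * \<bar>x\<bar>"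
      using funpow_mult_card_orbit[OF w abs_x] by metis
    then show "\<exists>k. (w ^^ k) \<bar>x\<bar> = - 1 * \<bar>x\<bar>" by blast
  qed (use funpow_eq_sign_mult_iff[OF w abs_x, of "- 1"] in auto)
  also have "\<dots> \<longleftrightarrow> cycle_sign w ?b = - 1"
  proof (rule cycle_sign_cases[OF w orbit_in_abs_cycles[OF abs_x]])
    assume "cycle_sign w ?b = - 1"
    then show ?thesis by (metis power_one_right)
  qed simp
  finally show ?thesis .
qed

lemma abs_cycles_eq_signed: "abs_cycles n w = (\<lambda>x. orbit (unsigned w) \<bar>x\<bar>) ` signed_letters n"
proof -
  have "abs ` signed_letters n = {1..int n}" unfolding signed_letters_eq image_Un image_image by auto
  then show ?thesis by (simp add: abs_cycles_def image_image[symmetric])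
qed

lemma pos_cycles_eq_image:
  "pos_cycles n w = (\<lambda>c. c \<union> uminus ` c) ` {c \<in> cycles n w. uminus ` c \<noteq> c}"
  by (auto simp: pos_cycles_def)

lemma pos_cycles_eq:
  assumes w: "w \<in> signed_perms n"
  shows "pos_cycles n w = (\<lambda>b. b \<union> uminus ` b) ` {b \<in> abs_cycles n w. cycle_sign w b = 1}"
proof -
  let ?b = "\<lambda>x. orbit (unsigned w) \<bar>x\<bar>" and ?L = "signed_letters n"
  have sign: "uminus ` orbit w x \<noteq> orbit w x \<longleftrightarrow> cycle_sign w (?b x) = 1" if x: "x \<in> ?L" for x
  proof -
    have "?b x \<in> abs_cycles n w" using x by (intro orbit_in_abs_cycles) auto
    then show ?thesis using uminus_orbit_eq_iff[OF w x] cycle_sign_neq_1_iff[OF w] by blast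
  qed
  have "pos_cycles n w = (\<lambda>x. orbit w x \<union> uminus ` orbit w x) ` {x \<in> ?L. uminus ` orbit w x \<noteq> orbit w x}"
    unfolding pos_cycles_eq_image cycles_def Compr_image_eq image_image ..
  also have "\<dots> = (\<lambda>x. ?b x \<union> uminus ` ?b x) ` {x \<in> ?L. cycle_sign w (?b x) = 1}"
    using sign orbit_Un_uminus[OF w] by (intro image_cong Collect_cong) auto
  finally show ?thesis unfolding abs_cycles_eq_signed Compr_image_eq image_image .
qed

lemma neg_cycles_eq:
  assumes w: "w \<in> signed_perms n"
  shows "neg_cycles n w = (\<lambda>b. b \<union> uminus ` b) ` {b \<in> abs_cycles n w. cycle_sign w b = - 1}"
proof -
  let ?b = "\<lambda>x. orbit (unsigned w) \<bar>x\<bar>" and ?L = "signed_letters n"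
  have "neg_cycles n w = orbit w ` {x \<in> ?L. uminus ` orbit w x = orbit w x}"
    unfolding neg_cycles_def cycles_def Compr_image_eq ..
  also have "\<dots> = (\<lambda>x. orbit w x \<union> uminus ` orbit w x) ` {x \<in> ?L. uminus ` orbit w x = orbit w x}"
    by (intro image_cong) simp_all
  also have "\<dots> = (\<lambda>x. ?b x \<union> uminus ` ?b x) ` {x \<in> ?L. cycle_sign w (?b x) = - 1}"
    using uminus_orbit_eq_iff[OF w] orbit_Un_uminus[OF w] by (intro image_cong Collect_cong) auto
  finally show ?thesis unfolding abs_cycles_eq_signed Compr_image_eq image_image .
qed

lemma image_mset_mset_set_image:
  "inj_on f A \<Longrightarrow> image_mset g (mset_set (f ` A)) = image_mset (\<lambda>a. g (f a)) (mset_set A)"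
  by (simp add: image_mset_mset_set[symmetric] image_mset.compositionality comp_def)

lemma mem_uminus_image_iff: "a \<in> uminus ` A \<longleftrightarrow> - a \<in> A" for a :: int
  by (metis image_iff minus_minus)

lemma signed_cycle_type_eq:
  assumes w: "w \<in> signed_perms n"
  shows "signed_cycle_type n w =
    (image_mset card (mset_set {b \<in> abs_cycles n w. cycle_sign w b = 1}),
     image_mset card (mset_set {b \<in> abs_cycles n w. cycle_sign w b = - 1}))"
proof -
  let ?d = "\<lambda>b :: int set. b \<union> uminus ` b"
  have pos: "0 < x" if "b \<in> abs_cycles n w" "x \<in> b" for b x
    using abs_cycle_subset[OF w that(1)] that(2) by auto
  have not_neg: "- x \<notin> b" if "b \<in> abs_cycles n w" "0 < x" for b x
    using pos[OF that(1), of "- x"] that(2) by auto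
  have card: "card (?d b) = 2 * card b" if "b \<in> abs_cycles n w" for b
  proof -
    have "b \<inter> uminus ` b = {}"
      using not_neg[OF that] by (auto simp: mem_uminus_image_iff dest: pos[OF that])
    moreover have "card (uminus ` b) = card b" by (simp add: card_image)
    ultimately show ?thesis using finite_abs_cycle[OF w that] by (simp add: card_Un_disjoint)
  qed
  have inj: "inj_on ?d (abs_cycles n w)"
  proof (rule inj_on_inverseI)
    show "?d b \<inter> {0<..} = b" if "b \<in> abs_cycles n w" for b
      using not_neg[OF that] by (auto simp: mem_uminus_image_iff dest: pos[OF that])
  qed
  have "image_mset (\<lambda>c. card c div 2) (mset_set (?d ` B)) = image_mset card (mset_set B)"
    if B: "B \<subseteq> abs_cycles n w" for B
  proof -
    have "finite B" using B finite_abs_cycles finite_subset by blast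
    then show ?thesis
      unfolding image_mset_mset_set_image[OF inj_on_subset[OF inj B]]
      using card B by (intro image_mset_cong) auto
  qed
  then show ?thesis
    by (simp add: signed_cycle_type_def pos_cycles_eq[OF w] neg_cycles_eq[OF w])
qed

lemma prod_abs_cycles_eq_prod_type:
  fixes f g :: "nat \<Rightarrow> 'c :: comm_monoid_mult"
  assumes w: "w \<in> signed_perms n"
  shows "(\<Prod>b\<in>abs_cycles n w. if cycle_sign w b = 1 then f (card b) else g (card b))
    = (\<Prod>a\<in>#fst (signed_cycle_type n w). f a) * (\<Prod>a\<in>#snd (signed_cycle_type n w). g a)"
proof -
  have "{b \<in> abs_cycles n w. cycle_sign w b \<noteq> 1} = {b \<in> abs_cycles n w. cycle_sign w b = - 1}"
    using cycle_sign_neq_1_iff[OF w] by blast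
  then show ?thesis
    unfolding signed_cycle_type_eq[OF w] prod.If_cases[OF finite_abs_cycles]
    by (simp add: prod_unfold_prod_mset image_mset.compositionality comp_def Int_def)
qed

definition type_product :: "nat multiset \<times> nat multiset \<Rightarrow> int" where
  "type_product t = (\<Prod>a\<in>#fst t. 1 + (- 1) ^ (a - 1)) * (\<Prod>a\<in>#snd t. 1 - (- 1) ^ (a - 1))"

lemma type_product_signed_cycle_type:
  assumes w: "w \<in> signed_perms n"
  shows "type_product (signed_cycle_type n w)
    = (\<Prod>b\<in>abs_cycles n w. 1 + (- 1) ^ (card b - 1) * cycle_sign w b)"
  unfolding type_product_def prod_abs_cycles_eq_prod_type[OF w, symmetric]
  by (intro prod.cong refl) (auto elim: cycle_sign_cases[OF w])

lemma ext_sign_abs_cycle: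
  assumes "w \<in> signed_perms n" "b \<in> abs_cycles n w"
  shows "ext_sign w b = (- 1) ^ (card b - 1) * cycle_sign w b"
  using assms inv_sign_orbit[OF unsigned_permutation]
  by (auto simp: abs_cycles_def ext_sign_def cycle_sign_def)

lemma ext_sign_Union_abs_cycles:
  assumes w: "w \<in> signed_perms n" and "Q \<subseteq> abs_cycles n w"
  shows "ext_sign w (\<Union>Q) = (\<Prod>b\<in>Q. ext_sign w b)"
proof -
  have "finite Q" using assms(2) finite_abs_cycles finite_subset by blast
  then show ?thesis using assms(2)
  proof (induction Q rule: finite_induct)
    case (insert b Q)
    then have b: "b \<in> abs_cycles n w" and Q: "Q \<subseteq> abs_cycles n w" by auto
    have disj: "b \<inter> \<Union>Q = {}" using abs_cycles_disjoint[OF w b] Q insert(2) by blast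
    have fin: "finite b" "finite (\<Union>Q)" using finite_abs_cycle[OF w] insert(1) b Q by auto
    have inv: "unsigned w ` b = b" "unsigned w ` \<Union>Q = \<Union>Q"
      using unsigned_image_abs_cycle[OF w] b Q by (simp, simp add: image_Union subset_eq)
    have "ext_sign w (b \<union> \<Union>Q) = ext_sign w b * ext_sign w (\<Union>Q)"
      unfolding ext_sign_def inv_sign_Un_invariant[OF fin disj inv]
      by (subst prod.union_disjoint) (use fin disj in auto)
    then show ?case using insert Q by simp
  qed (simp add: ext_sign_def)
qed

lemma bij_betw_Union_abs_cycles:
  assumes w: "w \<in> signed_perms n"
  shows "bij_betw Union (Pow (abs_cycles n w)) {I. I \<subseteq> {1..int n} \<and> unsigned w ` I = I}"
proof (rule bij_betw_byWitness[where f' = "\<lambda>I. {b \<in> abs_cycles n w. b \<subseteq> I}"])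
  show "\<forall>Q\<in>Pow (abs_cycles n w). {b \<in> abs_cycles n w. b \<subseteq> \<Union>Q} = Q"
  proof (intro ballI Set.set_eqI iffI)
    fix Q b assume Q: "Q \<in> Pow (abs_cycles n w)" and b: "b \<in> {b \<in> abs_cycles n w. b \<subseteq> \<Union>Q}"
    then obtain x c where "x \<in> b" "x \<in> c" "c \<in> Q" using abs_cycle_nonempty by blast
    then have "b = c" using abs_cycles_disjoint[OF w, of b c] b Q by blast
    then show "b \<in> Q" using \<open>c \<in> Q\<close> by simp
  qed blast
  show "\<forall>I\<in>{I. I \<subseteq> {1..int n} \<and> unsigned w ` I = I}. \<Union>{b \<in> abs_cycles n w. b \<subseteq> I} = I"
  proof (intro ballI equalityI subsetI)
    fix I x assume I: "I \<in> {I. I \<subseteq> {1..int n} \<and> unsigned w ` I = I}" and x: "x \<in> I"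
    have "y \<in> I" if "y \<in> orbit (unsigned w) x" for y
      using that I x by (induction rule: orbit.induct) auto
    moreover have "orbit (unsigned w) x \<in> abs_cycles n w" using I x by (intro orbit_in_abs_cycles) blast
    ultimately show "x \<in> \<Union>{b \<in> abs_cycles n w. b \<subseteq> I}" using self_in_abs_cycle[OF w] by blast
  qed blast
  show "Union ` Pow (abs_cycles n w) \<subseteq> {I. I \<subseteq> {1..int n} \<and> unsigned w ` I = I}"
  proof (rule image_subsetI)
    fix Q assume Q: "Q \<in> Pow (abs_cycles n w)"
    have "unsigned w ` \<Union>Q = (\<Union>b\<in>Q. unsigned w ` b)" by blast
    also have "\<dots> = (\<Union>b\<in>Q. b)"
      using unsigned_image_abs_cycle[OF w] Q by (intro SUP_cong refl) blast
    finally show "\<Union>Q \<in> {I. I \<subseteq> {1..int n} \<and> unsigned w ` I = I}"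
      using Q Union_abs_cycles[OF w] by blast
  qed
qed auto

lemma sum_ext_sign_eq_type_product:
  assumes w: "w \<in> signed_perms n"
  shows "(\<Sum>I | I \<subseteq> {1..int n} \<and> unsigned w ` I = I. ext_sign w I) = type_product (signed_cycle_type n w)"
proof -
  let ?f = "\<lambda>b. (- 1) ^ (card b - 1) * cycle_sign w b"
  have "(\<Sum>I | I \<subseteq> {1..int n} \<and> unsigned w ` I = I. ext_sign w I)
      = (\<Sum>Q\<in>Pow (abs_cycles n w). ext_sign w (\<Union>Q))"
    by (rule sum.reindex_bij_betw[OF bij_betw_Union_abs_cycles[OF w], symmetric])
  also have "\<dots> = (\<Sum>Q\<in>Pow (abs_cycles n w). \<Prod>b\<in>Q. ?f b)"
    using ext_sign_Union_abs_cycles[OF w] ext_sign_abs_cycle[OF w] by (intro sum.cong) (auto intro!: prod.cong)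
  also have "\<dots> = (\<Prod>b\<in>abs_cycles n w. ?f b + 1)"
    by (simp add: prod_add[OF finite_abs_cycles])
  finally show ?thesis by (simp add: type_product_signed_cycle_type[OF w] add.commute)
qed

text \<open>This is \<open>det (1 + w)\<close>.\<close>

lemma ext_char_eq_type_product:
  "w \<in> signed_perms n \<Longrightarrow> ext_char n w = of_int (type_product (signed_cycle_type n w))"
  by (simp only: ext_char_eq_sum_ext_sign sum_ext_sign_eq_type_product)

lemma class_function_signed_cycle_type: "class_function (signed_perms n) (signed_cycle_type n)"
  unfolding class_function_def
proof (intro ballI)
  fix u h assume u: "u \<in> signed_perms n" and h: "h \<in> signed_perms n"
  let ?g = "u \<circ> h \<circ> inv u" and ?half = "\<lambda>c :: int set. card c div 2"
  define negate :: "int set \<Rightarrow> int set" where "negate = (`) uminus"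
  have negate_image: "negate (u ` c) = u ` negate c" for c
    by (simp add: negate_def image_image signed_perms_uminus[OF u])
  have inj: "u ` c = u ` d \<longleftrightarrow> c = d" for c d by (rule inj_image_eq_iff[OF signed_perms_inj[OF u]])
  have "cycles n ?g = orbit ?g ` u ` signed_letters n"
    by (simp only: cycles_def permutes_image[OF signed_perms_permutes[OF u]])
  then have cycles: "cycles n ?g = (`) u ` cycles n h"
    by (simp only: cycles_def image_image orbit_conjugation[OF signed_perms.bij_mem[OF u]])
  have signed_cycles: "pos_cycles n f = (\<lambda>c. c \<union> negate c) ` {c \<in> cycles n f. negate c \<noteq> c}"
    "neg_cycles n f = {c \<in> cycles n f. negate c = c}" for f
    by (simp_all add: negate_def pos_cycles_eq_image neg_cycles_def)
  have "pos_cycles n ?g = (`) u ` pos_cycles n h" "neg_cycles n ?g = (`) u ` neg_cycles n h"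
    unfolding signed_cycles cycles by (simp_all only: Compr_image_eq negate_image inj image_image image_Un)
  moreover have "image_mset ?half (mset_set ((`) u ` C)) = image_mset ?half (mset_set C)" for C
    using card_image[OF inj_on_subset[OF signed_perms_inj[OF u] subset_UNIV]] inj
    by (subst image_mset_mset_set_image) (auto intro: inj_onI)
  ultimately show "signed_cycle_type n ?g = signed_cycle_type n h"
    by (simp add: signed_cycle_type_def)
qed

lemma signed_cycle_type_fix_last:
  assumes "n \<ge> 1" and h: "h \<in> signed_perms (n - 1)"
  shows "signed_cycle_type n h
    = (add_mset 1 (fst (signed_cycle_type (n - 1) h)), snd (signed_cycle_type (n - 1) h))"
proof -
  have h_n: "h \<in> signed_perms n" "h (int n) = int n"
    using h unfolding signed_perms_stabilizer[OF assms(1)] by auto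
  have sign: "cycle_sign h {int n} = 1" using h_n assms(1) by (simp add: cycle_sign_def)
  have new: "{int n} \<notin> abs_cycles (n - 1) h"
    using abs_cycle_subset[OF h, of "{int n}"] assms(1) by auto
  have "{1..int n} = insert (int n) {1..int (n - 1)}" using assms(1) by auto
  moreover have "orbit (unsigned h) (int n) = {int n}"
    unfolding orbit_eq_singleton_iff using h_n assms(1) by (simp add: unsigned_def)
  ultimately have "abs_cycles n h = insert {int n} (abs_cycles (n - 1) h)"
    by (simp add: abs_cycles_def)
  then have "{b \<in> abs_cycles n h. cycle_sign h b = 1} = insert {int n} {b \<in> abs_cycles (n - 1) h. cycle_sign h b = 1}"
    "{b \<in> abs_cycles n h. cycle_sign h b = - 1} = {b \<in> abs_cycles (n - 1) h. cycle_sign h b = - 1}"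
    using sign by auto
  then show ?thesis
    unfolding signed_cycle_type_eq[OF h_n(1)] signed_cycle_type_eq[OF h]
    using new finite_abs_cycles[of "n - 1" h] by simp
qed

lemma bij_betw_fixed_points_abs_cycles:
  assumes w: "w \<in> signed_perms n"
  shows "bij_betw (\<lambda>a. {a}) {a \<in> {1..int n}. w a = a}
    {b \<in> {b \<in> abs_cycles n w. cycle_sign w b = 1}. card b = 1}"
  unfolding bij_betw_def
proof (intro conjI equalityI subsetI)
  fix b assume "b \<in> (\<lambda>a. {a}) ` {a \<in> {1..int n}. w a = a}"
  then obtain a where a: "a \<in> {1..int n}" "w a = a" "b = {a}" by blast
  then have "orbit (unsigned w) a = {a}" unfolding orbit_eq_singleton_iff by (simp add: unsigned_def)
  then have "b \<in> abs_cycles n w" using orbit_in_abs_cycles[OF a(1), of w] a(3) by simp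
  then show "b \<in> {b \<in> {b \<in> abs_cycles n w. cycle_sign w b = 1}. card b = 1}"
    using a by (simp add: cycle_sign_def)
next
  fix b assume "b \<in> {b \<in> {b \<in> abs_cycles n w. cycle_sign w b = 1}. card b = 1}"
  then obtain a where a: "b = {a}" "{a} \<in> abs_cycles n w" "cycle_sign w {a} = 1"
    by (auto simp: card_1_singleton_iff)
  have a_mem: "a \<in> {1..int n}" using abs_cycle_subset[OF w a(2)] by simp
  moreover have "unsigned w a = a" using unsigned_image_abs_cycle[OF w a(2)] by simp
  ultimately have "w a = a" using signed_perms_sgn_unsigned[of a w] a(3) by (simp add: cycle_sign_def)
  then show "b \<in> (\<lambda>a. {a}) ` {a \<in> {1..int n}. w a = a}" using a(1) a_mem by blast
qed simp

lemma card_fixed_points: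
  assumes w: "w \<in> signed_perms n"
  shows "card {a \<in> signed_letters n. w a = a} = 2 * count (fst (signed_cycle_type n w)) 1"
proof -
  let ?F = "{a \<in> {1..int n}. w a = a}"
  have fin: "finite ?F" by (rule finite_subset[of _ "{1..int n}"]) auto
  have "{a \<in> signed_letters n. w a = a} = ?F \<union> uminus ` ?F"
    using signed_perms_uminus[OF w] by (auto simp: mem_uminus_image_iff)
  moreover have "card (?F \<union> uminus ` ?F) = card ?F + card (uminus ` ?F)"
    using fin by (intro card_Un_disjoint finite_imageI) (auto simp: mem_uminus_image_iff)
  moreover have "card (uminus ` ?F) = card ?F" by (simp add: card_image)
  moreover have "card ?F = count (fst (signed_cycle_type n w)) 1"
    unfolding signed_cycle_type_eq[OF w] bij_betw_same_card[OF bij_betw_fixed_points_abs_cycles[OF w]]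
    using finite_abs_cycles[of n w] by (simp add: count_image_mset_eq_card_vimage)
  ultimately show ?thesis by simp
qed

lemma induced_ext_char:
  assumes "n \<ge> 1" and g: "g \<in> signed_perms n"
  shows "induced (signed_perms (n - 1)) (signed_perms n) (ext_char (n - 1)) g
    = of_nat (count (fst (signed_cycle_type n g)) 1) * of_int (type_product (signed_cycle_type n g))"
proof -
  have half: "ext_char (n - 1) (inv u \<circ> g \<circ> u) = of_int (type_product (signed_cycle_type n g)) / 2"
    if u: "u \<in> signed_perms n" and h: "inv u \<circ> g \<circ> u \<in> signed_perms (n - 1)" for u
  proof -
    have "signed_cycle_type n (inv u \<circ> g \<circ> u) = signed_cycle_type n g"
      using class_functionD[OF class_function_signed_cycle_type signed_perms.inv_mem[OF u] g]
      by (simp add: inv_inv_eq signed_perms.bij_mem[OF u])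
    moreover have "type_product (signed_cycle_type n (inv u \<circ> g \<circ> u))
        = 2 * type_product (signed_cycle_type (n - 1) (inv u \<circ> g \<circ> u))"
      by (simp add: signed_cycle_type_fix_last[OF assms(1) h] type_product_def)
    ultimately show ?thesis unfolding ext_char_eq_type_product[OF h] by simp
  qed
  have "induced (signed_perms (n - 1)) (signed_perms n) (ext_char (n - 1)) g
      = of_nat (card {a \<in> (\<lambda>u. u (int n)) ` signed_perms n. g a = a})
        * (of_int (type_product (signed_cycle_type n g)) / 2)"
    using g signed_perms_stabilizer[OF assms(1)] half by (rule signed_perms.induced_from_stabilizer)
  also have "card {a \<in> (\<lambda>u. u (int n)) ` signed_perms n. g a = a} = 2 * count (fst (signed_cycle_type n g)) 1"
    using signed_perms_orbit[of "int n" n] assms(1) card_fixed_points[OF g] by simp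
  finally show ?thesis by simp
qed

section \<open>Signed arc permutations\<close>

definition residue_rep :: "nat \<Rightarrow> int \<Rightarrow> int" where
  "residue_rep n x = (x - 1) mod int n + 1"

lemma residue_rep_mem: "n \<ge> 1 \<Longrightarrow> residue_rep n x \<in> {1..int n}"
  using pos_mod_bound[of "int n" "x - 1"] by (simp add: residue_rep_def del: pos_mod_bound)

lemma residue_rep_eq_iff: "residue_rep n x = residue_rep n y \<longleftrightarrow> [x = y] (mod int n)"
  by (simp add: residue_rep_def mod_eq_dvd_iff cong_iff_dvd_diff)

lemma residue_rep_id: "x \<in> {1..int n} \<Longrightarrow> residue_rep n x = x"
  by (simp add: residue_rep_def)

lemma residue_rep_cong: "[residue_rep n x = x] (mod int n)"
  using cong_add[of "(x - 1) mod int n" "x - 1" "int n" 1 1] by (simp add: residue_rep_def)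

lemma cong_residue_rep_iff: "[x = residue_rep n y] (mod int n) \<longleftrightarrow> [x = y] (mod int n)"
  using residue_rep_cong cong_trans cong_sym by blast

lemma cong_eq_of_bounds:
  assumes "[x = y] (mod int n)" "\<bar>x - y\<bar> < int n" shows "x = y"
proof (rule ccontr)
  assume "x \<noteq> y"
  then have "\<not> int n dvd \<bar>x - y\<bar>" using assms(2) by (intro zdvd_not_zless) auto
  then show False using assms(1) by (simp add: cong_iff_dvd_diff)
qed

lemma bij_betw_residue_rep:
  assumes "n \<ge> 1" shows "bij_betw (residue_rep n) {a..<a + int n} {1..int n}"
proof -
  have "inj_on (residue_rep n) {a..<a + int n}"
  proof (rule inj_onI)
    fix x y assume "x \<in> {a..<a + int n}" "y \<in> {a..<a + int n}" "residue_rep n x = residue_rep n y"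
    then show "x = y" unfolding residue_rep_eq_iff by (intro cong_eq_of_bounds) auto
  qed
  moreover have "residue_rep n ` {a..<a + int n} \<subseteq> {1..int n}" using residue_rep_mem[OF assms] by blast
  ultimately show ?thesis
    by (simp add: bij_betw_def card_image card_subset_eq)
qed

lemma cyclic_interval_residue_rep: "cyclic_interval n (residue_rep n ` {a..<c})"
proof -
  have "{a..<c} = (\<lambda>j. a + int j) ` {..<nat (c - a)}"
  proof (intro equalityI subsetI)
    fix x assume "x \<in> {a..<c}"
    then show "x \<in> (\<lambda>j. a + int j) ` {..<nat (c - a)}" by (intro image_eqI[of _ _ "nat (x - a)"]) auto
  qed auto
  moreover have "(\<lambda>x. x mod int n) ` residue_rep n ` {a..<c} = (\<lambda>x. x mod int n) ` {a..<c}"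
    unfolding image_image using residue_rep_cong by (intro image_cong refl) (simp add: cong_def)
  ultimately have "(\<lambda>x. x mod int n) ` residue_rep n ` {a..<c} = (\<lambda>j. (a + int j) mod int n) ` {..<nat (c - a)}"
    by (simp add: image_image)
  then show ?thesis unfolding cyclic_interval_def by blast
qed

lemma cyclic_interval_Diff_singleton:
  assumes "z \<in> {1..int n}" shows "cyclic_interval n ({1..int n} - {z})"
proof -
  have bij: "bij_betw (residue_rep n) {z..<z + int n} {1..int n}"
    using assms by (intro bij_betw_residue_rep) simp
  have "{1..int n} - {z} = residue_rep n ` ({z..<z + int n} - {z})"
    using bij assms residue_rep_id[OF assms] by (subst inj_on_image_set_diff[of _ "{z..<z + int n}"]) (auto simp: bij_betw_def)
  also have "{z..<z + int n} - {z} = {z + 1..<z + int n}" by auto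
  finally show ?thesis using cyclic_interval_residue_rep by simp
qed

lemma cyclic_interval_neighbour:
  assumes "cyclic_interval n B" "x \<in> B" "y \<in> B" "\<not> [x = y] (mod int n)"
  shows "\<exists>z\<in>B. [x - 1 = z] (mod int n) \<or> [x + 1 = z] (mod int n)"
proof -
  obtain a k where ak: "(\<lambda>x. x mod int n) ` B = (\<lambda>j. (a + int j) mod int n) ` {..<k}"
    using assms(1) unfolding cyclic_interval_def by blast
  have member: "\<exists>t<k. [z = a + int t] (mod int n)" if "z \<in> B" for z
    using imageI[OF that, of "\<lambda>x. x mod int n"] unfolding ak by (auto simp: cong_def)
  have attained: "\<exists>z\<in>B. [a + int t = z] (mod int n)" if "t < k" for t
  proof -
    have "(a + int t) mod int n \<in> (\<lambda>x. x mod int n) ` B" unfolding ak using that by blast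
    then show ?thesis by (auto simp: cong_def)
  qed
  obtain t where t: "t < k" "[x = a + int t] (mod int n)" using member[OF assms(2)] by blast
  obtain r where r: "r < k" "[y = a + int r] (mod int n)" using member[OF assms(3)] by blast
  have "t \<noteq> r" using t(2) r(2) assms(4) cong_sym cong_trans by blast
  then consider (pred) t' where "t = Suc t'" | (succ) "Suc t < k"
    using r(1) by (cases t) auto
  then show ?thesis
  proof cases
    case pred
    then have "t' < k" using t(1) by simp
    then obtain z where "z \<in> B" "[a + int t' = z] (mod int n)" using attained by blast
    moreover have "[x - 1 = a + int t'] (mod int n)"
      using cong_diff[OF t(2) cong_refl[of 1]] pred by simp
    ultimately show ?thesis using cong_trans by blast
  next
    case succ
    then obtain z where "z \<in> B" "[a + int (Suc t) = z] (mod int n)" using attained by blast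
    moreover have "[x + 1 = a + int (Suc t)] (mod int n)"
      using cong_add[OF t(2) cong_refl[of 1]] by (simp add: algebra_simps)
    ultimately show ?thesis using cong_trans by blast
  qed
qed

lemma pred_cong_interval_iff:
  fixes x :: int
  assumes "\<not> (\<exists>a\<in>{l..<h}. [x = a] (mod m))" "l < h"
  shows "(\<exists>a\<in>{l..<h}. [x - 1 = a] (mod m)) \<longleftrightarrow> [x = h] (mod m)"
proof
  assume "\<exists>a\<in>{l..<h}. [x - 1 = a] (mod m)"
  then obtain a where a: "a \<in> {l..<h}" "[x = a + 1] (mod m)"
    using cong_add[OF _ cong_refl[of 1]] by fastforce
  then have "a + 1 = h" using assms(1) by fastforce
  then show "[x = h] (mod m)" using a(2) by simp
next
  assume "[x = h] (mod m)"
  then have "[x - 1 = h - 1] (mod m)" by (intro cong_diff) simp_all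
  then show "\<exists>a\<in>{l..<h}. [x - 1 = a] (mod m)" using assms(2) by (intro bexI[of _ "h - 1"]) auto
qed

lemma succ_cong_interval_iff:
  fixes x :: int
  assumes "\<not> (\<exists>a\<in>{l..<h}. [x = a] (mod m))" "l < h"
  shows "(\<exists>a\<in>{l..<h}. [x + 1 = a] (mod m)) \<longleftrightarrow> [x = l - 1] (mod m)"
proof
  assume "\<exists>a\<in>{l..<h}. [x + 1 = a] (mod m)"
  then obtain a where a: "a \<in> {l..<h}" "[x = a - 1] (mod m)"
    using cong_diff[OF _ cong_refl[of 1]] by fastforce
  then have "a = l" using assms(1) by fastforce
  then show "[x = l - 1] (mod m)" using a(2) by simp
next
  assume "[x = l - 1] (mod m)"
  then have "[x + 1 = l - 1 + 1] (mod m)" by (intro cong_add) simp_all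
  then show "\<exists>a\<in>{l..<h}. [x + 1 = a] (mod m)" using assms(2) by (intro bexI[of _ l]) auto
qed

text \<open>The unbarred letters are \<open>b, b + 1, \<dots>\<close> and the barred ones \<open>b - 1, b - 2, \<dots>\<close> (modulo \<open>n\<close>),
  in the order of their positions; \<open>e\<close> tells which positions are unbarred.\<close>

definition arc_lower :: "int \<Rightarrow> (nat \<Rightarrow> bool) \<Rightarrow> nat \<Rightarrow> int" where
  "arc_lower b e i = b - int (card {j \<in> {1..<i}. \<not> e j})"

definition arc_upper :: "int \<Rightarrow> (nat \<Rightarrow> bool) \<Rightarrow> nat \<Rightarrow> int" where
  "arc_upper b e i = b + int (card {j \<in> {1..<i}. e j})"

definition arc_pos :: "int \<Rightarrow> (nat \<Rightarrow> bool) \<Rightarrow> nat \<Rightarrow> int" where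
  "arc_pos b e i = (if e i then arc_upper b e i else arc_lower b e i - 1)"

definition arc_perm :: "nat \<Rightarrow> int \<Rightarrow> (nat \<Rightarrow> bool) \<Rightarrow> int \<Rightarrow> int" where
  "arc_perm n b e =
     odd_extension n (\<lambda>i. (if e (nat i) then 1 else - 1) * residue_rep n (arc_pos b e (nat i)))"

lemma arc_lower_1: "arc_lower b e (Suc 0) = b" and arc_upper_1: "arc_upper b e (Suc 0) = b"
  by (simp_all add: arc_lower_def arc_upper_def)

lemma card_filter_Suc:
  assumes "i \<ge> 1"
  shows "card {j \<in> {1..<Suc i}. P j} = card {j \<in> {1..<i}. P j} + (if P i then 1 else 0)"
proof -
  have "{j \<in> {1..<Suc i}. P j} = (if P i then insert i {j \<in> {1..<i}. P j} else {j \<in> {1..<i}. P j})"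
    using assms by (auto simp: less_Suc_eq)
  then show ?thesis by simp
qed

lemma arc_lower_Suc: "i \<ge> 1 \<Longrightarrow> arc_lower b e (Suc i) = (if e i then arc_lower b e i else arc_pos b e i)"
  by (simp only: arc_lower_def arc_pos_def card_filter_Suc) simp

lemma arc_upper_Suc: "i \<ge> 1 \<Longrightarrow> arc_upper b e (Suc i) = (if e i then arc_pos b e i + 1 else arc_upper b e i)"
  by (simp only: arc_upper_def arc_pos_def card_filter_Suc) simp

lemma arc_upper_eq: "i \<ge> 1 \<Longrightarrow> arc_upper b e i = arc_lower b e i + int i - 1"
  by (induction i rule: dec_induct) (auto simp: arc_lower_1 arc_upper_1 arc_lower_Suc arc_upper_Suc arc_pos_def)

lemma arc_pos_translate: "arc_pos b e i = b + arc_pos 0 e i"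
  by (simp add: arc_pos_def arc_lower_def arc_upper_def)

lemma arc_pos_image:
  "i \<ge> 1 \<Longrightarrow> arc_pos b e ` {1..<i} = {arc_lower b e i..<arc_upper b e i}"
proof (induction i rule: dec_induct)
  case base
  show ?case by (simp add: arc_lower_1 arc_upper_1)
next
  case (step i)
  have "{1..<Suc i} = insert i {1..<i}" using step by auto
  then have "arc_pos b e ` {1..<Suc i} = insert (arc_pos b e i) {arc_lower b e i..<arc_upper b e i}"
    using step by simp
  also have "\<dots> = {arc_lower b e (Suc i)..<arc_upper b e (Suc i)}"
    using step arc_upper_eq[of i b e] by (auto simp: arc_lower_Suc arc_upper_Suc arc_pos_def)
  finally show ?case .
qed

lemma bij_betw_arc_pos:
  "bij_betw (arc_pos b e) {1..n} {arc_lower b e (Suc n)..<arc_lower b e (Suc n) + int n}"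
proof -
  have image: "arc_pos b e ` {1..n} = {arc_lower b e (Suc n)..<arc_lower b e (Suc n) + int n}"
    using arc_pos_image[of "Suc n" b e] arc_upper_eq[of "Suc n" b e] by (simp add: atLeastLessThanSuc_atLeastAtMost)
  then have "card (arc_pos b e ` {1..n}) = card {1..n}" by simp
  then show ?thesis using image by (simp add: bij_betw_def eq_card_imp_inj_on)
qed

lemma bij_betw_arc_letter:
  assumes "n \<ge> 1" shows "bij_betw (\<lambda>i. residue_rep n (arc_pos b e i)) {1..n} {1..int n}"
  using bij_betw_trans[OF bij_betw_arc_pos bij_betw_residue_rep[OF assms]] by (simp add: comp_def)

lemma arc_perm_apply:
  "i \<in> {1..n} \<Longrightarrow> arc_perm n b e (int i) = (if e i then 1 else - 1) * residue_rep n (arc_pos b e i)"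
  by (simp add: arc_perm_def odd_extension_def)

lemma abs_arc_perm: "i \<in> {1..n} \<Longrightarrow> \<bar>arc_perm n b e (int i)\<bar> = residue_rep n (arc_pos b e i)"
  using residue_rep_mem[of n "arc_pos b e i"] by (simp add: arc_perm_apply abs_mult)

lemma arc_perm_pos_iff: "i \<in> {1..n} \<Longrightarrow> 0 < arc_perm n b e (int i) \<longleftrightarrow> e i"
  using residue_rep_mem[of n "arc_pos b e i"] by (simp add: arc_perm_apply)

lemma arc_perm_signed_perm:
  assumes "n \<ge> 1" shows "arc_perm n b e \<in> signed_perms n"
  unfolding arc_perm_def
proof (rule odd_extension_signed_perm)
  let ?f = "\<lambda>i. (if e (nat i) then 1 else - 1) * residue_rep n (arc_pos b e (nat i))"
  have abs: "\<bar>?f i\<bar> = residue_rep n (arc_pos b e (nat i))" for i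
    using residue_rep_mem[OF assms, of "arc_pos b e (nat i)"] by (auto simp: abs_mult)
  show "\<bar>?f i\<bar> \<in> {1..int n}" for i unfolding abs by (rule residue_rep_mem[OF assms])
  have "bij_betw nat {1..int n} {1..n}" by (rule bij_betw_byWitness[where f' = int]) auto
  from bij_betw_trans[OF this bij_betw_arc_letter[OF assms, of b e]]
  show "inj_on (\<lambda>i. \<bar>?f i\<bar>) {1..int n}"
    unfolding abs by (simp add: bij_betw_def comp_def)
qed

definition prefix_letters :: "(int \<Rightarrow> int) \<Rightarrow> nat \<Rightarrow> int set" where
  "prefix_letters w i = (\<lambda>j. \<bar>w (int j)\<bar>) ` {1..<i}"

lemma signed_arc_perms_iff:
  "w \<in> signed_arc_perms n \<longleftrightarrow> w \<in> signed_perms n \<and>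
    (\<forall>i\<in>{2..<n}. cyclic_interval n (prefix_letters w i) \<and>
      ((\<exists>a\<in>prefix_letters w i. [\<bar>w (int i)\<bar> - 1 = a] (mod int n)) \<longrightarrow> 0 < w (int i)) \<and>
      ((\<exists>a\<in>prefix_letters w i. [\<bar>w (int i)\<bar> + 1 = a] (mod int n)) \<longrightarrow> w (int i) < 0))"
proof -
  have "{2..int n - 1} = int ` {2..<n}" by (auto simp: image_int_atLeastLessThan)
  moreover have "(\<lambda>j. \<bar>w j\<bar>) ` {1..int i - 1} = prefix_letters w i" for i
  proof -
    have "{1..int i - 1} = int ` {1..<i}" by (auto simp: image_int_atLeastLessThan)
    then show ?thesis by (simp add: prefix_letters_def image_image)
  qed
  ultimately show ?thesis
    by (simp only: signed_arc_perms_def Let_def mem_Collect_eq ball_simps)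
qed

lemma prefix_letters_eq_residues:
  assumes "i \<ge> 1" and letters: "\<And>j. j \<in> {1..<i} \<Longrightarrow> \<bar>w (int j)\<bar> = residue_rep n (arc_pos b e j)"
  shows "prefix_letters w i = residue_rep n ` {arc_lower b e i..<arc_upper b e i}"
  unfolding prefix_letters_def arc_pos_image[OF assms(1), symmetric] image_image
  by (rule image_cong[OF refl letters])

lemma signed_perms_abs_cong_iff:
  assumes "w \<in> signed_perms n" "i \<in> {1..n}" "j \<in> {1..n}"
  shows "[\<bar>w (int i)\<bar> = \<bar>w (int j)\<bar>] (mod int n) \<longleftrightarrow> i = j"
proof
  assume cong: "[\<bar>w (int i)\<bar> = \<bar>w (int j)\<bar>] (mod int n)"
  have "\<bar>w (int i)\<bar> \<in> {1..int n}" "\<bar>w (int j)\<bar> \<in> {1..int n}"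
    using signed_perms_abs_mem_iff[OF assms(1)] assms(2,3) by simp_all
  then have "\<bar>w (int i)\<bar> = \<bar>w (int j)\<bar>" using cong by (intro cong_eq_of_bounds) auto
  then show "i = j" using inj_onD[OF inj_on_abs_signed_perm[OF assms(1)], of "int i" "int j"] assms(2,3) by simp
qed simp

lemma not_cong_prefix_letters:
  assumes "w \<in> signed_perms n" "i \<in> {1..n}"
  shows "\<not> (\<exists>a\<in>prefix_letters w i. [\<bar>w (int i)\<bar> = a] (mod int n))"
  using signed_perms_abs_cong_iff[OF assms] assms(2) by (auto simp: prefix_letters_def)

lemma cyclic_interval_prefix_letters:
  assumes w: "w \<in> signed_arc_perms n" and i: "i \<in> {2..n}"
  shows "cyclic_interval n (prefix_letters w i)"
proof (cases "i < n")
  case True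
  then show ?thesis using w i by (simp add: signed_arc_perms_iff)
next
  case False
  note perm = conjunct1[OF w[unfolded signed_arc_perms_iff]]
  have "prefix_letters w i = (\<lambda>j. \<bar>w j\<bar>) ` ({1..int n} - {int n})"
  proof -
    have "{1..int n} - {int n} = int ` {1..<i}" using False i by (auto simp: image_int_atLeastLessThan)
    then show ?thesis by (simp add: prefix_letters_def image_image)
  qed
  also have "\<dots> = {1..int n} - {\<bar>w (int n)\<bar>}"
    using i by (subst inj_on_image_set_diff[OF inj_on_abs_signed_perm[OF perm]]) (auto simp: abs_signed_perm_image[OF perm])
  finally show ?thesis
    using cyclic_interval_Diff_singleton[of "\<bar>w (int n)\<bar>" n] signed_perms_abs_mem_iff[OF perm, of "int n"] i by simp
qed

lemma signed_arc_neighbour: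
  assumes w: "w \<in> signed_arc_perms n" and i: "i \<in> {2..<n}"
  shows "\<exists>a\<in>prefix_letters w i. [\<bar>w (int i)\<bar> - 1 = a] (mod int n) \<or> [\<bar>w (int i)\<bar> + 1 = a] (mod int n)"
proof -
  note perm = conjunct1[OF w[unfolded signed_arc_perms_iff]]
  have Suc: "prefix_letters w (Suc i) = insert \<bar>w (int i)\<bar> (prefix_letters w i)"
  proof -
    have "{1..<Suc i} = insert i {1..<i}" using i by auto
    then show ?thesis by (simp add: prefix_letters_def)
  qed
  have "\<bar>w (int 1)\<bar> \<in> prefix_letters w (Suc i)"
    unfolding prefix_letters_def using i by (intro imageI) simp
  moreover have "\<not> [\<bar>w (int i)\<bar> = \<bar>w (int 1)\<bar>] (mod int n)"
    using signed_perms_abs_cong_iff[OF perm, of i 1] i by simp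
  moreover have "cyclic_interval n (prefix_letters w (Suc i))"
    using cyclic_interval_prefix_letters[OF w] i by simp
  ultimately obtain z where z: "z \<in> prefix_letters w (Suc i)"
    "[\<bar>w (int i)\<bar> - 1 = z] (mod int n) \<or> [\<bar>w (int i)\<bar> + 1 = z] (mod int n)"
    using cyclic_interval_neighbour[of n "prefix_letters w (Suc i)" "\<bar>w (int i)\<bar>"] by (auto simp: Suc)
  have "\<not> int n dvd 1" using i by (simp add: zdvd1_eq)
  then have "z \<noteq> \<bar>w (int i)\<bar>" using z(2) by (auto simp: cong_iff_dvd_diff)
  then show ?thesis using z Suc by blast
qed

lemma next_letter_iff:
  assumes A: "A = residue_rep n ` {l..<h}" and bounds: "l < h" "h - l + 1 < int n"
    and new: "\<not> (\<exists>a\<in>A. [x = a] (mod int n))"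
  shows "((\<exists>a\<in>A. [x - 1 = a] (mod int n) \<or> [x + 1 = a] (mod int n)) \<and>
      ((\<exists>a\<in>A. [x - 1 = a] (mod int n)) \<longrightarrow> p) \<and> ((\<exists>a\<in>A. [x + 1 = a] (mod int n)) \<longrightarrow> \<not> p))
    \<longleftrightarrow> [x = (if p then h else l - 1)] (mod int n)"
proof -
  have cong_A: "(\<exists>a\<in>A. [y = a] (mod int n)) \<longleftrightarrow> (\<exists>a\<in>{l..<h}. [y = a] (mod int n))" for y
    by (simp add: A cong_residue_rep_iff)
  have "\<not> [h = l - 1] (mod int n)" using cong_eq_of_bounds[of h "l - 1" n] bounds by auto
  then have "\<not> ([x = h] (mod int n) \<and> [x = l - 1] (mod int n))" using cong_sym cong_trans by blast
  then show ?thesis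
    using pred_cong_interval_iff[OF new[unfolded cong_A] bounds(1)]
      succ_cong_interval_iff[OF new[unfolded cong_A] bounds(1)]
    unfolding bex_disj_distrib cong_A by auto
qed

lemma arc_perm_mem_signed_arc_perms:
  assumes "n \<ge> 2" shows "arc_perm n b e \<in> signed_arc_perms n"
  unfolding signed_arc_perms_iff
proof (intro conjI[OF _ ballI])
  let ?w = "arc_perm n b e"
  show perm: "?w \<in> signed_perms n" using arc_perm_signed_perm assms by simp
  fix i assume i: "i \<in> {2..<n}"
  let ?x = "\<bar>?w (int i)\<bar>"
  have mem: "i \<in> {1..n}" using i by simp
  have prefix: "prefix_letters ?w i = residue_rep n ` {arc_lower b e i..<arc_upper b e i}"
    using i by (intro prefix_letters_eq_residues abs_arc_perm) auto
  have "[?x = (if e i then arc_upper b e i else arc_lower b e i - 1)] (mod int n)"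
    unfolding abs_arc_perm[OF mem] arc_pos_def by (rule residue_rep_cong)
  then have "((\<exists>a\<in>prefix_letters ?w i. [?x - 1 = a] (mod int n)) \<longrightarrow> e i)
      \<and> ((\<exists>a\<in>prefix_letters ?w i. [?x + 1 = a] (mod int n)) \<longrightarrow> \<not> e i)"
    using next_letter_iff[OF prefix _ _ not_cong_prefix_letters[OF perm mem], of "e i"] arc_upper_eq[of i b e] i
    by simp
  moreover have "?w (int i) \<noteq> 0" using signed_perms_eq_0_iff[OF perm] i by simp
  ultimately show "cyclic_interval n (prefix_letters ?w i) \<and>
      ((\<exists>a\<in>prefix_letters ?w i. [?x - 1 = a] (mod int n)) \<longrightarrow> 0 < ?w (int i)) \<and>
      ((\<exists>a\<in>prefix_letters ?w i. [?x + 1 = a] (mod int n)) \<longrightarrow> ?w (int i) < 0)"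
    using prefix cyclic_interval_residue_rep arc_perm_pos_iff[OF mem] by (metis linorder_neqE_linordered_idom)
qed

lemma last_letter_cong:
  assumes w: "w \<in> signed_perms n" and "n \<ge> 1"
    and prefix: "prefix_letters w n = residue_rep n ` {arc_lower b e n..<arc_upper b e n}"
  shows "[\<bar>w (int n)\<bar> = arc_pos b e n] (mod int n)"
proof -
  let ?l = "arc_lower b e n" and ?h = "arc_upper b e n"
  have upper_eq: "?h = ?l + int n - 1" using arc_upper_eq \<open>n \<ge> 1\<close> by simp
  have "\<bar>w (int n)\<bar> \<in> residue_rep n ` {?l..<?l + int n}"
    using bij_betw_residue_rep[OF \<open>n \<ge> 1\<close>, of ?l] signed_perms_abs_mem_iff[OF w, of "int n"] \<open>n \<ge> 1\<close>
    by (simp add: bij_betw_def)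
  then obtain x where x: "x \<in> {?l..<?l + int n}" "\<bar>w (int n)\<bar> = residue_rep n x" by blast
  moreover have "\<bar>w (int n)\<bar> \<notin> prefix_letters w n"
    using not_cong_prefix_letters[OF w, of n] \<open>n \<ge> 1\<close> cong_refl by auto
  ultimately have "x \<notin> {?l..<?h}" unfolding prefix by blast
  then have "x = ?h" using x(1) upper_eq by auto
  moreover have "[?h = ?l - 1] (mod int n)" by (simp add: upper_eq cong_iff_dvd_diff)
  ultimately show ?thesis
    using x(2) residue_rep_cong[of n ?h] cong_trans[OF residue_rep_cong[of n ?h]] by (simp add: arc_pos_def)
qed

lemma signed_arc_perm_letters:
  assumes w: "w \<in> signed_arc_perms n" and sign: "\<And>i. i \<in> {1..n} \<Longrightarrow> e i \<longleftrightarrow> 0 < w (int i)"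
    and first_letter: "[\<bar>w 1\<bar> = arc_pos b e 1] (mod int n)" and "i \<in> {1..n}"
  shows "\<bar>w (int i)\<bar> = residue_rep n (arc_pos b e i)"
  using \<open>i \<in> {1..n}\<close>
proof (induction i rule: less_induct)
  case (less i)
  note perm = conjunct1[OF w[unfolded signed_arc_perms_iff]]
  let ?x = "\<bar>w (int i)\<bar>"
  have prefix: "prefix_letters w i = residue_rep n ` {arc_lower b e i..<arc_upper b e i}"
    using less by (intro prefix_letters_eq_residues) auto
  consider (first) "i = 1" | (middle) "i \<in> {2..<n}" | (last) "i = n" using less.prems by fastforce
  then have "[?x = arc_pos b e i] (mod int n)"
  proof cases
    case first
    then show ?thesis using first_letter by simp
  next
    case middle
    have "((\<exists>a\<in>prefix_letters w i. [?x - 1 = a] (mod int n)) \<longrightarrow> e i)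
        \<and> ((\<exists>a\<in>prefix_letters w i. [?x + 1 = a] (mod int n)) \<longrightarrow> \<not> e i)"
      using w middle sign[OF less.prems] by (auto simp: signed_arc_perms_iff)
    then show ?thesis
      using next_letter_iff[OF prefix _ _ not_cong_prefix_letters[OF perm less.prems], of "e i"]
        signed_arc_neighbour[OF w middle] arc_upper_eq[of i b e] middle by (simp add: arc_pos_def)
  next
    case last
    then show ?thesis using last_letter_cong[OF perm _ prefix[unfolded last]] less.prems by simp
  qed
  moreover have "residue_rep n ?x = ?x"
    using signed_perms_abs_mem_iff[OF perm, of "int i"] less.prems by (intro residue_rep_id) simp
  ultimately show ?case by (metis residue_rep_eq_iff)
qed

lemma signed_arc_perm_eq_arc_perm:
  assumes "n \<ge> 2" and w: "w \<in> signed_arc_perms n"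
  obtains b e where "b \<in> {1..int n}" "e \<in> {1..n} \<rightarrow>\<^sub>E UNIV" "w = arc_perm n b e"
proof
  note perm = conjunct1[OF w[unfolded signed_arc_perms_iff]]
  define e where "e = (\<lambda>i\<in>{1..n}. 0 < w (int i))"
  define b where "b = residue_rep n (if e 1 then \<bar>w 1\<bar> else \<bar>w 1\<bar> + 1)"
  show "e \<in> {1..n} \<rightarrow>\<^sub>E UNIV" by (simp add: e_def)
  show "b \<in> {1..int n}" unfolding b_def using assms(1) by (intro residue_rep_mem) simp
  have first: "[\<bar>w 1\<bar> = arc_pos b e 1] (mod int n)"
  proof -
    have "[b = (if e 1 then \<bar>w 1\<bar> else \<bar>w 1\<bar> + 1)] (mod int n)" unfolding b_def by (rule residue_rep_cong)
    then show ?thesis by (auto simp: arc_pos_def arc_lower_1 arc_upper_1 cong_iff_dvd_diff dvd_diff_commute algebra_simps)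
  qed
  show "w = arc_perm n b e"
  proof (rule signed_perms_eqI[OF perm arc_perm_signed_perm])
    show "n \<ge> 1" using assms(1) by simp
    fix i' assume "i' \<in> {1..int n}"
    then obtain i where i: "i' = int i" "i \<in> {1..n}" by (cases i' rule: int_cases3) auto
    have sign: "e i \<longleftrightarrow> 0 < w (int i)" using i(2) by (simp add: e_def)
    have "\<bar>w (int i)\<bar> = residue_rep n (arc_pos b e i)"
      by (rule signed_arc_perm_letters[OF w _ first i(2)]) (simp add: e_def)
    then show "w i' = arc_perm n b e i'" using sign by (auto simp: i(1) arc_perm_apply[OF i(2)])
  qed
qed

lemma bij_betw_arc_perm:
  assumes "n \<ge> 2"
  shows "bij_betw (\<lambda>(e, b). arc_perm n b e) (({1..n} \<rightarrow>\<^sub>E UNIV) \<times> {1..int n}) (signed_arc_perms n)"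
  unfolding bij_betw_def
proof
  show "inj_on (\<lambda>(e, b). arc_perm n b e) (({1..n} \<rightarrow>\<^sub>E UNIV) \<times> {1..int n})"
  proof (rule inj_onI, clarify)
    fix e e' :: "nat \<Rightarrow> bool" and b b'
    assume e: "e \<in> {1..n} \<rightarrow>\<^sub>E UNIV" "e' \<in> {1..n} \<rightarrow>\<^sub>E UNIV" and b: "b \<in> {1..int n}" "b' \<in> {1..int n}"
      and eq: "arc_perm n b e = arc_perm n b' e'"
    have "e i = e' i" if "i \<in> {1..n}" for i using arc_perm_pos_iff[OF that] eq by metis
    then have signs: "e = e'" by (rule PiE_ext[OF e])
    have "residue_rep n (arc_pos b e 1) = residue_rep n (arc_pos b' e 1)"
      using abs_arc_perm[of 1 n b e] abs_arc_perm[of 1 n b' e] eq assms signs by simp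
    then have "[b = b'] (mod int n)"
      unfolding residue_rep_eq_iff arc_pos_translate[of b] arc_pos_translate[of b'] by (simp add: cong_iff_dvd_diff)
    then have "b = b'" using b by (intro cong_eq_of_bounds) auto
    then show "e = e' \<and> b = b'" using signs by simp
  qed
  show "(\<lambda>(e, b). arc_perm n b e) ` (({1..n} \<rightarrow>\<^sub>E UNIV) \<times> {1..int n}) = signed_arc_perms n"
  proof (intro equalityI subsetI)
    fix w assume "w \<in> signed_arc_perms n"
    then obtain b e where "b \<in> {1..int n}" "e \<in> {1..n} \<rightarrow>\<^sub>E UNIV" "w = arc_perm n b e"
      by (rule signed_arc_perm_eq_arc_perm[OF assms])
    then show "w \<in> (\<lambda>(e, b). arc_perm n b e) ` (({1..n} \<rightarrow>\<^sub>E UNIV) \<times> {1..int n})"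
      by (intro image_eqI[of _ _ "(e, b)"]) auto
  qed (auto simp: arc_perm_mem_signed_arc_perms[OF assms])
qed

definition arc_descents :: "nat \<Rightarrow> (nat \<Rightarrow> bool) \<Rightarrow> nat set \<Rightarrow> nat set" where
  "arc_descents n e T = {n} \<union> {s \<in> {1..n - 1}. e s \<noteq> e (Suc s) \<or> (e s \<longleftrightarrow> s \<in> T)}"

definition arc_signs :: "nat \<Rightarrow> (nat \<Rightarrow> bool) \<Rightarrow> nat \<Rightarrow> int" where
  "arc_signs n e s = (if s \<in> {1..n} \<and> \<not> e s then - 1 else 1)"

definition arc_step :: "int \<Rightarrow> (nat \<Rightarrow> bool) \<Rightarrow> nat \<Rightarrow> int" where
  "arc_step b e s = min (arc_pos b e s) (arc_pos b e (Suc s))"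

lemma arc_pos_Suc:
  "s \<ge> 1 \<Longrightarrow> e s = e (Suc s) \<Longrightarrow> arc_pos b e (Suc s) = (if e s then arc_pos b e s + 1 else arc_pos b e s - 1)"
  by (simp add: arc_pos_def arc_lower_Suc arc_upper_Suc)

lemma residue_rep_Suc_less_iff:
  assumes "n \<ge> 2" shows "residue_rep n (x + 1) < residue_rep n x \<longleftrightarrow> int n dvd x"
proof -
  let ?r = "residue_rep n x"
  have r: "?r \<in> {1..int n}" using residue_rep_mem assms by simp
  have successor: "residue_rep n (x + 1) = residue_rep n (?r + 1)"
    unfolding residue_rep_eq_iff by (intro cong_add cong_sym[OF residue_rep_cong]) simp
  have "int n dvd x \<longleftrightarrow> int n dvd ?r" using cong_dvd_iff[OF residue_rep_cong[of n x]] by simp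
  also have "\<dots> \<longleftrightarrow> ?r = int n" using r zdvd_imp_le[of "int n" ?r] by auto
  finally have dvd: "int n dvd x \<longleftrightarrow> ?r = int n" .
  show ?thesis
  proof (cases "?r = int n")
    case True
    have "residue_rep n (int n + 1) = 1"
      using residue_rep_id[of 1 n] assms by (simp add: residue_rep_def)
    then show ?thesis using True successor dvd assms by simp
  next
    case False
    then have "residue_rep n (?r + 1) = ?r + 1" using r by (intro residue_rep_id) simp
    then show ?thesis using False successor dvd by simp
  qed
qed

lemma residue_rep_Suc_neq: "n \<ge> 2 \<Longrightarrow> residue_rep n (x + 1) \<noteq> residue_rep n x"
  by (simp add: residue_rep_eq_iff cong_iff_dvd_diff)

lemma arc_perm_descent_iff:
  fixes b :: int and e :: "nat \<Rightarrow> bool"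
  assumes n: "n \<ge> 2" and s: "s \<in> {1..n - 1}"
  defines "w \<equiv> arc_perm n b e"
  shows "less_r (w (int s + 1)) (w (int s)) \<or> (w (int s) < 0 \<and> w (int s + 1) > 0)
    \<longleftrightarrow> e s \<noteq> e (Suc s) \<or> (e s \<longleftrightarrow> int n dvd arc_step b e s)"
proof -
  let ?L = "\<lambda>i. residue_rep n (arc_pos b e i)"
  have mem: "s \<in> {1..n}" "Suc s \<in> {1..n}" using s by auto
  have pos: "0 < ?L i" for i using residue_rep_mem[of n "arc_pos b e i"] n by simp
  have letters: "w (int s) = (if e s then 1 else - 1) * ?L s"
    "w (int s + 1) = (if e (Suc s) then 1 else - 1) * ?L (Suc s)"
    using arc_perm_apply[OF mem(1)] arc_perm_apply[OF mem(2), of b e] by (simp_all add: w_def add.commute)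
  show ?thesis
  proof (cases "e s = e (Suc s)")
    case False
    then show ?thesis using pos[of s] pos[of "Suc s"] by (auto simp: letters less_r_def)
  next
    case True
    have "?L (Suc s) < ?L s \<longleftrightarrow> (e s \<longleftrightarrow> int n dvd arc_step b e s)"
      using residue_rep_Suc_less_iff[OF n, of "arc_step b e s"] residue_rep_Suc_neq[OF n, of "arc_step b e s"]
        arc_pos_Suc[of s e b] True s by (auto simp: arc_step_def min_def)
    then show ?thesis using True pos[of s] pos[of "Suc s"] by (auto simp: letters less_r_def)
  qed
qed

lemma sDes_arc_perm:
  assumes "n \<ge> 2"
  shows "sDes n (arc_perm n b e) = (arc_descents n e {s. int n dvd arc_step b e s}, arc_signs n e)"
proof -
  let ?w = "arc_perm n b e"
  have perm: "?w \<in> signed_perms n" using arc_perm_signed_perm assms by simp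
  have "(if ?w (int s) < 0 then - 1 else 1) = arc_signs n e s" for s
  proof (cases "s \<in> {1..n}")
    case True
    then have "?w (int s) \<noteq> 0" using signed_perms_eq_0_iff[OF perm] by simp
    then show ?thesis using True arc_perm_pos_iff[OF True, of b e] by (auto simp: arc_signs_def)
  next
    case False
    then have "?w (int s) = int s" by (intro signed_perms_outside[OF perm]) auto
    then show ?thesis using False by (auto simp: arc_signs_def)
  qed
  moreover have "{s \<in> {1..n - 1}. less_r (?w (int s + 1)) (?w (int s)) \<or> (?w (int s) < 0 \<and> ?w (int s + 1) > 0)}
      = {s \<in> {1..n - 1}. e s \<noteq> e (Suc s) \<or> (e s \<longleftrightarrow> s \<in> {s. int n dvd arc_step b e s})}"
    using arc_perm_descent_iff[OF assms, of _ b e] by blast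
  ultimately show ?thesis by (simp only: sDes_def arc_descents_def)
qed

definition equal_sign_positions :: "nat \<Rightarrow> (nat \<Rightarrow> bool) \<Rightarrow> nat set" where
  "equal_sign_positions n e = {s \<in> {1..n - 1}. e s = e (Suc s)}"

text \<open>A step is a pair of cyclically adjacent letters, and different pairs of adjacent positions carry different
  pairs of letters.\<close>

lemma inj_on_arc_step:
  "inj_on (\<lambda>s. residue_rep n (- arc_step 0 e s)) (equal_sign_positions n e)"
proof (rule inj_onI)
  fix s t assume s: "s \<in> equal_sign_positions n e" and t: "t \<in> equal_sign_positions n e"
    and eq: "residue_rep n (- arc_step 0 e s) = residue_rep n (- arc_step 0 e t)"
  let ?p = "arc_pos 0 e"
  have pair: "{?p r, ?p (Suc r)} = {arc_step 0 e r, arc_step 0 e r + 1}" and mem: "{r, Suc r} \<subseteq> {1..n}"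
    if "r \<in> equal_sign_positions n e" for r
    using that arc_pos_Suc[of r e 0] by (auto simp: equal_sign_positions_def arc_step_def min_def)
  have bij: "bij_betw ?p {1..n} {arc_lower 0 e (Suc n)..<arc_lower 0 e (Suc n) + int n}"
    by (rule bij_betw_arc_pos)
  have step: "arc_step 0 e r \<in> {arc_lower 0 e (Suc n)..<arc_lower 0 e (Suc n) + int n}"
    if "r \<in> equal_sign_positions n e" for r
    using bij_betw_apply[OF bij, of r] bij_betw_apply[OF bij, of "Suc r"] mem[OF that] by (auto simp: arc_step_def min_def)
  have "[arc_step 0 e s = arc_step 0 e t] (mod int n)"
    using eq by (simp add: residue_rep_eq_iff cong_minus_minus_iff)
  then have "arc_step 0 e s = arc_step 0 e t"
    using step[OF s] step[OF t] by (intro cong_eq_of_bounds) auto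
  then have "?p ` {s, Suc s} = ?p ` {t, Suc t}" using pair[OF s] pair[OF t] by simp
  then have "{s, Suc s} = {t, Suc t}"
    using inj_on_image_eq_iff[OF bij_betw_imp_inj_on[OF bij] mem[OF s] mem[OF t]] by blast
  then show "s = t" by (auto simp: doubleton_eq_iff)
qed

lemma sum_eq_by_partial_injection:
  fixes g :: "'a \<Rightarrow> 'c :: comm_monoid_add"
  assumes "finite A" "finite B" "card A = card B" "Q \<subseteq> A" "inj_on f Q" "f ` Q \<subseteq> B"
    and on: "\<And>x. x \<in> Q \<Longrightarrow> g (f x) = h x"
    and off: "\<And>y. y \<in> B - f ` Q \<Longrightarrow> g y = c" "\<And>x. x \<in> A - Q \<Longrightarrow> h x = c"
  shows "sum g B = sum h A"
proof -
  have "card (B - f ` Q) = card (A - Q)"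
    using assms(1-6) by (simp add: card_Diff_subset card_image finite_subset)
  then obtain k where k_bij: "bij_betw k (A - Q) (B - f ` Q)"
    using assms(1,2) by (metis finite_Diff finite_same_card_bij)
  have "sum g B = sum g (B - f ` Q) + sum g (f ` Q)" by (rule sum.subset_diff[OF assms(6,2)])
  also have "sum g (f ` Q) = sum h Q" using on by (simp add: sum.reindex[OF assms(5)])
  also have "sum g (B - f ` Q) = (\<Sum>x\<in>A - Q. g (k x))" by (rule sum.reindex_bij_betw[OF k_bij, symmetric])
  also have "\<dots> = sum h (A - Q)" using off bij_betw_apply[OF k_bij] by (intro sum.cong) auto
  also have "sum h (A - Q) + sum h Q = sum h A" by (rule sum.subset_diff[OF assms(4,1), symmetric])
  finally show ?thesis .
qed

text \<open>Rotating the letters moves the step from \<open>n\<close> to \<open>1\<close> through all pairs of adjacent positions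
  of equal sign; whenever that step is not between adjacent positions, it does not affect the
  descents.\<close>

lemma sum_arc_descents:
  fixes F :: "nat set \<Rightarrow> 'c :: comm_monoid_add"
  assumes "n \<ge> 1"
  shows "(\<Sum>b = 1..int n. F (arc_descents n e {s. int n dvd arc_step b e s}))
    = (\<Sum>s = 1..n. F (arc_descents n e {s}))"
proof (rule sum_eq_by_partial_injection[where Q = "equal_sign_positions n e" and c = "F (arc_descents n e {})"
      and f = "\<lambda>s. residue_rep n (- arc_step 0 e s)"])
  let ?Q = "equal_sign_positions n e" and ?f = "\<lambda>s. residue_rep n (- arc_step 0 e s)"
  have descents_cong: "arc_descents n e U = arc_descents n e V" if "\<And>s. s \<in> ?Q \<Longrightarrow> s \<in> U \<longleftrightarrow> s \<in> V" for U V
    using that by (auto simp: arc_descents_def equal_sign_positions_def)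
  have wrap_iff: "int n dvd arc_step b e s \<longleftrightarrow> b = ?f s" if "b \<in> {1..int n}" for b s
  proof -
    have "arc_step b e s = b + arc_step 0 e s"
      unfolding arc_step_def arc_pos_translate[of b] by (simp add: min_add_distrib_right)
    then have "int n dvd arc_step b e s \<longleftrightarrow> [b = - arc_step 0 e s] (mod int n)"
      by (simp add: cong_iff_dvd_diff)
    then show ?thesis unfolding residue_rep_eq_iff[symmetric] residue_rep_id[OF that] .
  qed
  have f_mem: "?f s \<in> {1..int n}" for s by (rule residue_rep_mem[OF assms])
  show "inj_on ?f ?Q" by (rule inj_on_arc_step)
  show "?f ` ?Q \<subseteq> {1..int n}" using f_mem by blast
  show "?Q \<subseteq> {1..n}" by (auto simp: equal_sign_positions_def)
  show "F (arc_descents n e {s. int n dvd arc_step (?f r) e s}) = F (arc_descents n e {r})" if "r \<in> ?Q" for r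
    using inj_onD[OF inj_on_arc_step _ that] by (intro arg_cong[of _ _ F] descents_cong) (auto simp: wrap_iff[OF f_mem])
  show "F (arc_descents n e {s. int n dvd arc_step b e s}) = F (arc_descents n e {})"
    if "b \<in> {1..int n} - ?f ` ?Q" for b
    using that by (intro arg_cong[of _ _ F] descents_cong) (auto simp: wrap_iff)
  show "F (arc_descents n e {r}) = F (arc_descents n e {})" if "r \<in> {1..n} - ?Q" for r
    using that by (intro arg_cong[of _ _ F] descents_cong) auto
qed auto

lemma sum_signed_arc_perms:
  fixes F :: "signed_set \<Rightarrow> 'c :: comm_monoid_add"
  assumes "n \<ge> 2"
  shows "(\<Sum>w\<in>signed_arc_perms n. F (sDes n w))
    = (\<Sum>e\<in>{1..n} \<rightarrow>\<^sub>E UNIV. \<Sum>s = 1..n. F (arc_descents n e {s}, arc_signs n e))"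
proof -
  have "(\<Sum>w\<in>signed_arc_perms n. F (sDes n w))
      = (\<Sum>(e, b)\<in>({1..n} \<rightarrow>\<^sub>E UNIV) \<times> {1..int n}. F (sDes n (arc_perm n b e)))"
    unfolding sum.reindex_bij_betw[OF bij_betw_arc_perm[OF assms], symmetric] by (simp add: case_prod_unfold)
  also have "\<dots> = (\<Sum>e\<in>{1..n} \<rightarrow>\<^sub>E UNIV. \<Sum>b = 1..int n. F (sDes n (arc_perm n b e)))"
    by (rule sum.cartesian_product[symmetric])
  also have "\<dots> = (\<Sum>e\<in>{1..n} \<rightarrow>\<^sub>E UNIV. \<Sum>s = 1..n. F (arc_descents n e {s}, arc_signs n e))"
    unfolding sDes_arc_perm[OF assms] using assms
    by (intro sum.cong refl sum_arc_descents[where F = "\<lambda>S. F (S, arc_signs n _)"]) simp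
  finally show ?thesis .
qed

lemma finite_signed_arc_perms: "finite (signed_arc_perms n)"
  by (rule finite_subset[OF _ signed_perms.finite_carrier[of n]]) (auto simp: signed_arc_perms_def)

section \<open>The weights of the signed arc permutations\<close>

lemma sign_vector_arc:
  assumes "j \<in> {1..n}"
  shows "sign_vector (arc_descents n e T, arc_signs n e) j = arc_signs n e j"
proof -
  let ?P = "\<lambda>s. s \<in> arc_descents n e T \<and> j \<le> s"
  define t where "t = (LEAST s. ?P s)"
  have n_mem: "?P n" using assms by (simp add: arc_descents_def)
  have t: "?P t" "t \<le> n" unfolding t_def using n_mem by (rule LeastI, rule Least_le)
  have same_sign: "arc_signs n e j = arc_signs n e i" if "j \<le> i" "i \<le> t" for i
    using that
  proof (induction i rule: dec_induct)
    case (step i)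
    then have "i \<notin> arc_descents n e T" using not_less_Least[of i ?P] by (auto simp: t_def)
    moreover have "i \<in> {1..n - 1}" using step t assms by auto
    ultimately have "e i = e (Suc i)" by (simp add: arc_descents_def)
    then show ?case using step t assms by (simp add: arc_signs_def)
  qed simp
  have "arc_signs n e t = arc_signs n e j" using same_sign[of t] t by simp
  then show ?thesis unfolding sign_vector_def fst_conv snd_conv t_def .
qed

lemma partial_sum_Suc: "i < length \<gamma> \<Longrightarrow> partial_sum \<gamma> (Suc i) = partial_sum \<gamma> i + nat \<bar>\<gamma> ! i\<bar>"
  by (simp add: partial_sum_def take_Suc_conv_app_nth)

lemma partial_sum_eq_sum: "k \<le> length \<gamma> \<Longrightarrow> partial_sum \<gamma> k = (\<Sum>i<k. nat \<bar>\<gamma> ! i\<bar>)"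
  by (induction k) (simp_all add: partial_sum_Suc, simp add: partial_sum_def)

lemma partial_sum_mono: "i \<le> j \<Longrightarrow> j \<le> length \<gamma> \<Longrightarrow> partial_sum \<gamma> i \<le> partial_sum \<gamma> j"
  by (simp add: partial_sum_eq_sum sum_mono2)

lemma partial_sum_length:
  assumes "\<gamma> \<in> signed_compositions n" shows "partial_sum \<gamma> (length \<gamma>) = n"
proof -
  have "int (\<Sum>x\<leftarrow>\<gamma>. nat \<bar>x\<bar>) = (\<Sum>x\<leftarrow>\<gamma>. \<bar>x\<bar>)" by (induction \<gamma>) auto
  then show ?thesis using assms by (simp add: partial_sum_def signed_compositions_def)
qed

lemma signed_compositions_nth_neq_0: "\<gamma> \<in> signed_compositions n \<Longrightarrow> i < length \<gamma> \<Longrightarrow> \<gamma> ! i \<noteq> 0"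
  unfolding signed_compositions_def by (metis (no_types, lifting) mem_Collect_eq nth_mem)

lemma block_unique:
  assumes "i < length \<gamma>" "k < length \<gamma>" "j \<in> block \<gamma> i" "j \<in> block \<gamma> k" shows "i = k"
proof (rule ccontr)
  assume "i \<noteq> k"
  then consider "Suc i \<le> k" | "Suc k \<le> i" by linarith
  then show False
    using assms partial_sum_mono[of "Suc i" k \<gamma>] partial_sum_mono[of "Suc k" i \<gamma>]
    by cases (auto simp: block_def)
qed

lemma UN_block: "k \<le> length \<gamma> \<Longrightarrow> (\<Union>i<k. block \<gamma> i) = {1..partial_sum \<gamma> k}"
proof (induction k)
  case (Suc k)
  then have "(\<Union>i<Suc k. block \<gamma> i) = {1..partial_sum \<gamma> k} \<union> block \<gamma> k"
    by (simp add: lessThan_Suc Un_commute)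
  then show ?case using partial_sum_mono[of k "Suc k" \<gamma>] Suc.prems by (auto simp: block_def)
qed (simp add: partial_sum_def)

lemma block_subset: "i < length \<gamma> \<Longrightarrow> block \<gamma> i \<subseteq> {1..partial_sum \<gamma> (length \<gamma>)}"
  using UN_block[of "length \<gamma>" \<gamma>] by blast

lemma partial_sum_Suc_in_block:
  "\<gamma> \<in> signed_compositions n \<Longrightarrow> i < length \<gamma> \<Longrightarrow> partial_sum \<gamma> (Suc i) \<in> block \<gamma> i"
  using signed_compositions_nth_neq_0[of \<gamma> n i] by (simp add: block_def partial_sum_Suc)

definition inner_block :: "int list \<Rightarrow> nat \<Rightarrow> nat set" where
  "inner_block \<gamma> i = {partial_sum \<gamma> i + 1..<partial_sum \<gamma> (i + 1)}"

lemma inner_block_subset: "inner_block \<gamma> i \<subseteq> block \<gamma> i"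
  by (auto simp: inner_block_def block_def)

lemma Suc_inner_block: "j \<in> inner_block \<gamma> i \<Longrightarrow> Suc j \<in> block \<gamma> i"
  by (auto simp: inner_block_def block_def)

lemma finite_inner_block: "finite (inner_block \<gamma> i)"
  by (simp add: inner_block_def)

lemma card_inner_block: "i < length \<gamma> \<Longrightarrow> card (inner_block \<gamma> i) = nat \<bar>\<gamma> ! i\<bar> - 1"
  by (simp add: inner_block_def partial_sum_Suc)

lemma disjoint_family_inner_block: "disjoint_family_on (inner_block \<gamma>) {..<length \<gamma>}"
  using block_unique inner_block_subset by (fastforce simp: disjoint_family_on_def)

lemma UN_inner_block:
  assumes "\<gamma> \<in> signed_compositions n"
  shows "(\<Union>i<length \<gamma>. inner_block \<gamma> i) = {1..n} - partial_sum \<gamma> ` {1..length \<gamma>}"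
proof (intro equalityI subsetI)
  fix j assume "j \<in> (\<Union>i<length \<gamma>. inner_block \<gamma> i)"
  then obtain i where i: "i < length \<gamma>" "j \<in> inner_block \<gamma> i" by blast
  have "j \<noteq> partial_sum \<gamma> k" if "k \<in> {1..length \<gamma>}" for k
    using i that partial_sum_mono[of k i \<gamma>] partial_sum_mono[of "Suc i" k \<gamma>]
    by (cases "k \<le> i") (auto simp: inner_block_def)
  moreover have "j \<in> {1..n}"
    using block_subset[OF i(1)] inner_block_subset i(2) partial_sum_length[OF assms] by blast
  ultimately show "j \<in> {1..n} - partial_sum \<gamma> ` {1..length \<gamma>}" by blast
next
  fix j assume j: "j \<in> {1..n} - partial_sum \<gamma> ` {1..length \<gamma>}"
  then obtain i where i: "i < length \<gamma>" "j \<in> block \<gamma> i"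
    using UN_block[of "length \<gamma>" \<gamma>] partial_sum_length[OF assms] by blast
  then have "j \<noteq> partial_sum \<gamma> (Suc i)" using j by auto
  then have "j \<in> inner_block \<gamma> i" using i by (auto simp: block_def inner_block_def)
  then show "j \<in> (\<Union>i<length \<gamma>. inner_block \<gamma> i)" using i by blast
qed

definition segment_sign :: "nat set \<Rightarrow> nat set \<Rightarrow> int" where
  "segment_sign D J = (if initial_segment D J then (- 1) ^ card D else 0)"

lemma wt_not_constant:
  assumes "i < length \<gamma>" "j \<in> block \<gamma> i" "k \<in> block \<gamma> i" "sign_vector \<sigma> j \<noteq> sign_vector \<sigma> k"
  shows "wt \<gamma> \<sigma> = 0"
proof -
  have "\<not> (\<exists>x. \<forall>j\<in>block \<gamma> i. sign_vector \<sigma> j = x)" using assms(2-4) by metis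
  then show ?thesis unfolding wt_def using assms(1) by (intro if_P) blast
qed

lemma wt_eq_prod_segment_sign:
  assumes \<gamma>: "\<gamma> \<in> signed_compositions n" and "fst \<sigma> \<subseteq> {1..n}"
    and \<eta>: "\<And>i j. i < length \<gamma> \<Longrightarrow> j \<in> block \<gamma> i \<Longrightarrow> sign_vector \<sigma> j = \<eta> i"
  shows "wt \<gamma> \<sigma> = (\<Prod>i<length \<gamma>. segment_sign (fst \<sigma> \<inter> inner_block \<gamma> i) (inner_block \<gamma> i)
    * (if \<eta> i = - 1 \<and> \<gamma> ! i < 0 then - 1 else 1))"
proof -
  let ?m = "length \<gamma>" and ?D = "\<lambda>i. fst \<sigma> \<inter> inner_block \<gamma> i"
  let ?N = "{i \<in> {..<?m}. \<eta> i = - 1 \<and> \<gamma> ! i < 0}"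
  have "\<exists>x. \<forall>j\<in>block \<gamma> i. sign_vector \<sigma> j = x" if "i < ?m" for i using \<eta>[OF that] by blast
  then have "(\<exists>i<?m. \<not> initial_segment (?D i) (inner_block \<gamma> i) \<or> \<not> (\<exists>x. \<forall>j\<in>block \<gamma> i. sign_vector \<sigma> j = x))
      \<longleftrightarrow> (\<exists>i<?m. \<not> initial_segment (?D i) (inner_block \<gamma> i))"
    by blast
  moreover have "{i. i < ?m \<and> (\<forall>j\<in>block \<gamma> i. sign_vector \<sigma> j = - 1) \<and> \<gamma> ! i < 0} = ?N"
    using \<eta> partial_sum_Suc_in_block[OF \<gamma>] by fastforce
  ultimately have wt: "wt \<gamma> \<sigma> = (if \<exists>i<?m. \<not> initial_segment (?D i) (inner_block \<gamma> i) then 0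
      else (- 1) ^ (card (fst \<sigma> - partial_sum \<gamma> ` {1..?m}) + card ?N))"
    unfolding wt_def Let_def inner_block_def[symmetric] by (simp only:)
  show ?thesis
  proof (cases "\<exists>i<?m. \<not> initial_segment (?D i) (inner_block \<gamma> i)")
    case True
    then obtain i where "i < ?m" "segment_sign (?D i) (inner_block \<gamma> i) = 0"
      by (auto simp: segment_sign_def)
    then have "(\<Prod>i<?m. segment_sign (?D i) (inner_block \<gamma> i) * (if \<eta> i = - 1 \<and> \<gamma> ! i < 0 then - 1 else 1)) = 0"
      by (intro prod_zero bexI[of _ i]) simp_all
    then show ?thesis unfolding wt if_P[OF True] by simp
  next
    case False
    have "fst \<sigma> - partial_sum \<gamma> ` {1..?m} = fst \<sigma> \<inter> ({1..n} - partial_sum \<gamma> ` {1..?m})"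
      using assms(2) by blast
    also have "\<dots> = (\<Union>i<?m. ?D i)" unfolding UN_inner_block[OF \<gamma>, symmetric] by blast
    also have "card (\<Union>i<?m. ?D i) = (\<Sum>i<?m. card (?D i))"
      using disjoint_family_inner_block[of \<gamma>] finite_inner_block
      by (intro card_UN_disjoint) (auto simp: disjoint_family_on_def)
    finally have "(- 1 :: int) ^ card (fst \<sigma> - partial_sum \<gamma> ` {1..?m}) = (\<Prod>i<?m. (- 1) ^ card (?D i))"
      by (simp add: power_sum)
    moreover have "(- 1 :: int) ^ card ?N = (\<Prod>i<?m. if \<eta> i = - 1 \<and> \<gamma> ! i < 0 then - 1 else 1)"
      by (simp add: prod.inter_filter[symmetric])
    moreover have "(\<Prod>i<?m. segment_sign (?D i) (inner_block \<gamma> i)) = (\<Prod>i<?m. (- 1) ^ card (?D i))"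
      using False by (intro prod.cong) (auto simp: segment_sign_def)
    ultimately show ?thesis
      unfolding wt if_not_P[OF False] power_add prod.distrib by (simp only:)
  qed
qed

definition toggle_sign :: "nat \<Rightarrow> nat set \<Rightarrow> nat \<Rightarrow> int" where
  "toggle_sign t J s = (if s \<notin> J then 1 else if s = t then - 1 else 0)"

lemma segment_sign_Int_singleton: "segment_sign ({a..<b} \<inter> {s}) {a..<b} = toggle_sign a {a..<b} s"
proof (cases "s \<in> {a..<b}")
  case True
  then have "initial_segment {s} {a..<b} \<longleftrightarrow> (\<forall>r\<in>{a..<b}. \<not> r < s)"
    by (auto simp: initial_segment_def)
  also have "\<dots> \<longleftrightarrow> s = a"
    using True by (auto dest: bspec[of _ _ a])
  finally show ?thesis using True by (simp add: segment_sign_def toggle_sign_def)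
qed (simp add: segment_sign_def toggle_sign_def initial_segment_def)

lemma segment_sign_Diff_singleton:
  "segment_sign ({a..<b} - {s}) {a..<b} = (- 1) ^ (b - a) * toggle_sign (b - 1) {a..<b} s"
proof (cases "s \<in> {a..<b}")
  case True
  then have "initial_segment ({a..<b} - {s}) {a..<b} \<longleftrightarrow> (\<forall>r\<in>{a..<b}. \<not> s < r)"
    unfolding initial_segment_def by (fastforce simp del: atLeastLessThan_iff)
  also have "\<dots> \<longleftrightarrow> s = b - 1"
    using True by (auto dest: bspec[of _ _ "b - 1"])
  finally have "initial_segment ({a..<b} - {s}) {a..<b} \<longleftrightarrow> s = b - 1" .
  moreover have "(- 1 :: int) ^ card ({a..<b} - {s}) = - ((- 1) ^ (b - a))"
    using True by (cases "b - a") auto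
  ultimately show ?thesis using True by (simp add: segment_sign_def toggle_sign_def)
qed (simp add: segment_sign_def toggle_sign_def initial_segment_def)

lemma prod_toggle_sign:
  assumes "finite I" "disjoint_family_on J I" and t_mem: "\<And>i. i \<in> I \<Longrightarrow> J i \<noteq> {} \<Longrightarrow> t i \<in> J i"
  shows "(\<Prod>i\<in>I. toggle_sign (t i) (J i) s)
    = of_bool (s \<notin> (\<Union>i\<in>I. J i)) - of_bool (s \<in> t ` {i \<in> I. J i \<noteq> {}})"
proof (cases "s \<in> (\<Union>i\<in>I. J i)")
  case True
  then obtain i where i: "i \<in> I" "s \<in> J i" by blast
  have other: "s \<notin> J k" if "k \<in> I" "k \<noteq> i" for k
    using assms(2) i that by (auto simp: disjoint_family_on_def)
  have "(\<Prod>k\<in>I. toggle_sign (t k) (J k) s) = (\<Prod>k\<in>{i}. toggle_sign (t k) (J k) s)"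
    using i other assms(1) by (intro prod.mono_neutral_right) (auto simp: toggle_sign_def)
  moreover have "s \<in> t ` {i \<in> I. J i \<noteq> {}} \<longleftrightarrow> s = t i" using i other t_mem by auto
  ultimately show ?thesis using True i by (simp add: toggle_sign_def)
next
  case False
  then have "toggle_sign (t i) (J i) s = 1" if "i \<in> I" for i using that by (simp add: toggle_sign_def)
  moreover have "s \<notin> t ` {i \<in> I. J i \<noteq> {}}" using False t_mem by blast
  ultimately show ?thesis using False by simp
qed

lemma sum_prod_toggle_sign:
  assumes "finite A" "finite I" "disjoint_family_on J I" "(\<Union>i\<in>I. J i) \<subseteq> A"
    and t_mem: "\<And>i. i \<in> I \<Longrightarrow> J i \<noteq> {} \<Longrightarrow> t i \<in> J i"
  shows "(\<Sum>s\<in>A. \<Prod>i\<in>I. toggle_sign (t i) (J i) s)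
    = int (card (A - (\<Union>i\<in>I. J i))) - int (card {i \<in> I. J i \<noteq> {}})"
proof -
  let ?I = "{i \<in> I. J i \<noteq> {}}" and ?U = "\<Union>i\<in>I. J i"
  have "inj_on t ?I"
  proof (rule inj_onI, rule ccontr)
    fix i k assume ik: "i \<in> ?I" "k \<in> ?I" "t i = t k" "i \<noteq> k"
    then have "t i \<in> J i \<inter> J k" using t_mem by fastforce
    then show False using assms(3) ik by (auto simp: disjoint_family_on_def)
  qed
  then have "card (t ` ?I) = card ?I" by (rule card_image)
  moreover have "t ` ?I \<subseteq> A" using t_mem assms(4) by blast
  then have "(\<Sum>s\<in>A. of_bool (s \<in> t ` ?I)) = int (card (t ` ?I))"
    using assms(1) by (simp add: of_bool_def sum.If_cases Int_absorb1)
  moreover have "(\<Sum>s\<in>A. of_bool (s \<notin> ?U)) = int (card (A - ?U))"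
    using assms(1) by (simp add: of_bool_def sum.If_cases set_diff_eq Int_def)
  moreover have "(\<Prod>i\<in>I. toggle_sign (t i) (J i) s) = of_bool (s \<notin> ?U) - of_bool (s \<in> t ` ?I)" for s
    using assms(2,3) t_mem by (rule prod_toggle_sign)
  ultimately show ?thesis by (simp only: sum_subtractf)
qed

definition sign_weight :: "int \<Rightarrow> int" where
  "sign_weight x = (- 1) ^ (nat \<bar>x\<bar> - 1) * sgn x"

definition toggle_point :: "int list \<Rightarrow> bool \<Rightarrow> nat \<Rightarrow> nat" where
  "toggle_point \<gamma> p i = (if p then partial_sum \<gamma> i + 1 else partial_sum \<gamma> (i + 1) - 1)"

lemma arc_descents_Int_inner_block:
  assumes \<gamma>: "\<gamma> \<in> signed_compositions n" and i: "i < length \<gamma>" and e_block: "\<And>j. j \<in> block \<gamma> i \<Longrightarrow> e j = p"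
  shows "arc_descents n e {s} \<inter> inner_block \<gamma> i
    = (if p then inner_block \<gamma> i \<inter> {s} else inner_block \<gamma> i - {s})"
proof -
  have "j \<in> arc_descents n e {s} \<longleftrightarrow> (p \<longleftrightarrow> j = s)" if j: "j \<in> inner_block \<gamma> i" for j
  proof -
    have blocks: "j \<in> block \<gamma> i" "Suc j \<in> block \<gamma> i" using inner_block_subset Suc_inner_block j by auto
    then have "j \<in> {1..n - 1}" "j \<noteq> n"
      using block_subset[OF i] partial_sum_length[OF \<gamma>] by fastforce+
    then show ?thesis using e_block[OF blocks(1)] e_block[OF blocks(2)] by (auto simp: arc_descents_def)
  qed
  then show ?thesis by auto
qed

lemma wt_arc:
  assumes \<gamma>: "\<gamma> \<in> signed_compositions n" and "n \<ge> 1"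
    and e_block: "\<And>i j. i < length \<gamma> \<Longrightarrow> j \<in> block \<gamma> i \<Longrightarrow> e j = E i"
  shows "wt \<gamma> (arc_descents n e {s}, arc_signs n e)
    = (\<Prod>i<length \<gamma>. (if E i then 1 else sign_weight (\<gamma> ! i))
        * toggle_sign (toggle_point \<gamma> (E i) i) (inner_block \<gamma> i) s)"
proof -
  let ?\<sigma> = "(arc_descents n e {s}, arc_signs n e)" and ?\<eta> = "\<lambda>i. if E i then 1 else - 1 :: int"
  have "wt \<gamma> ?\<sigma> = (\<Prod>i<length \<gamma>. segment_sign (fst ?\<sigma> \<inter> inner_block \<gamma> i) (inner_block \<gamma> i)
      * (if ?\<eta> i = - 1 \<and> \<gamma> ! i < 0 then - 1 else 1))"
  proof (rule wt_eq_prod_segment_sign[OF \<gamma>])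
    show "fst ?\<sigma> \<subseteq> {1..n}" using \<open>n \<ge> 1\<close> by (auto simp: arc_descents_def)
    show "sign_vector ?\<sigma> j = ?\<eta> i" if "i < length \<gamma>" "j \<in> block \<gamma> i" for i j
    proof -
      have "j \<in> {1..n}" using block_subset[OF that(1)] that(2) partial_sum_length[OF \<gamma>] by blast
      then show ?thesis using e_block[OF that] by (simp add: sign_vector_arc arc_signs_def)
    qed
  qed
  also have "\<dots> = (\<Prod>i<length \<gamma>. (if E i then 1 else sign_weight (\<gamma> ! i))
        * toggle_sign (toggle_point \<gamma> (E i) i) (inner_block \<gamma> i) s)"
  proof (rule prod.cong[OF refl])
    fix i assume "i \<in> {..<length \<gamma>}"
    then have i: "i < length \<gamma>" by simp
    have card: "partial_sum \<gamma> (i + 1) - (partial_sum \<gamma> i + 1) = nat \<bar>\<gamma> ! i\<bar> - 1"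
      using partial_sum_Suc[OF i] by simp
    have descents: "fst ?\<sigma> \<inter> inner_block \<gamma> i = (if E i then inner_block \<gamma> i \<inter> {s} else inner_block \<gamma> i - {s})"
      using arc_descents_Int_inner_block[OF \<gamma> i e_block[OF i]] by simp
    show "segment_sign (fst ?\<sigma> \<inter> inner_block \<gamma> i) (inner_block \<gamma> i) * (if ?\<eta> i = - 1 \<and> \<gamma> ! i < 0 then - 1 else 1)
      = (if E i then 1 else sign_weight (\<gamma> ! i)) * toggle_sign (toggle_point \<gamma> (E i) i) (inner_block \<gamma> i) s"
      unfolding descents unfolding inner_block_def toggle_point_def
      using signed_compositions_nth_neq_0[OF \<gamma> i] card
      by (auto simp: segment_sign_Int_singleton segment_sign_Diff_singleton sign_weight_def sgn_if)
  qed
  finally show ?thesis .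
qed

lemma sum_prod_toggle_sign_blocks:
  assumes \<gamma>: "\<gamma> \<in> signed_compositions n"
  shows "(\<Sum>s = 1..n. \<Prod>i<length \<gamma>. toggle_sign (toggle_point \<gamma> (E i) i) (inner_block \<gamma> i) s)
    = int (card {i. i < length \<gamma> \<and> \<bar>\<gamma> ! i\<bar> = 1})"
proof -
  let ?m = "length \<gamma>" and ?U = "\<Union>i<length \<gamma>. inner_block \<gamma> i"
  let ?long = "{i \<in> {..<?m}. inner_block \<gamma> i \<noteq> {}}" and ?unit = "{i. i < ?m \<and> \<bar>\<gamma> ! i\<bar> = 1}"
  have size: "nat \<bar>\<gamma> ! i\<bar> = Suc (card (inner_block \<gamma> i))" if "i < ?m" for i
    using card_inner_block[OF that] signed_compositions_nth_neq_0[OF \<gamma> that] by simp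
  have UN_subset: "?U \<subseteq> {1..n}" unfolding UN_inner_block[OF \<gamma>] by blast
  have "n = (\<Sum>i<?m. Suc (card (inner_block \<gamma> i)))"
    using partial_sum_length[OF \<gamma>] size by (simp add: partial_sum_eq_sum)
  also have "\<dots> = card ?U + ?m"
    using disjoint_family_inner_block[of \<gamma>] finite_inner_block
    by (subst card_UN_disjoint) (auto simp: disjoint_family_on_def sum_Suc)
  finally have n_eq: "n = card ?U + ?m" .
  have "card ({1..n} - ?U) = card {1..n} - card ?U"
    using UN_subset finite_subset by (intro card_Diff_subset) blast+
  also have "\<dots> = ?m" unfolding card_atLeastAtMost using n_eq by linarith
  finally have outside: "card ({1..n} - ?U) = ?m" .
  have unit_iff: "\<bar>\<gamma> ! i\<bar> = 1 \<longleftrightarrow> inner_block \<gamma> i = {}" if "i < ?m" for i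
  proof -
    have "\<bar>\<gamma> ! i\<bar> = 1 \<longleftrightarrow> card (inner_block \<gamma> i) = 0" using size[OF that] by linarith
    then show ?thesis by (simp add: finite_inner_block)
  qed
  have "?long \<union> ?unit = {..<?m}" using unit_iff by auto
  moreover have "card (?long \<union> ?unit) = card ?long + card ?unit"
    by (rule card_Un_disjoint) (auto simp: unit_iff)
  ultimately have split: "?m = card ?long + card ?unit" by simp
  have "(\<Sum>s = 1..n. \<Prod>i<?m. toggle_sign (toggle_point \<gamma> (E i) i) (inner_block \<gamma> i) s)
      = int (card ({1..n} - ?U)) - int (card ?long)"
    by (rule sum_prod_toggle_sign[OF _ _ disjoint_family_inner_block UN_subset])
      (auto simp: toggle_point_def inner_block_def)
  then show ?thesis using outside split by linarith
qed

definition block_index :: "int list \<Rightarrow> nat \<Rightarrow> nat" where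
  "block_index \<gamma> j = (THE i. i < length \<gamma> \<and> j \<in> block \<gamma> i)"

definition spread :: "int list \<Rightarrow> (nat \<Rightarrow> bool) \<Rightarrow> nat \<Rightarrow> bool" where
  "spread \<gamma> E = (\<lambda>j\<in>{1..partial_sum \<gamma> (length \<gamma>)}. E (block_index \<gamma> j))"

lemma block_index_eq: "i < length \<gamma> \<Longrightarrow> j \<in> block \<gamma> i \<Longrightarrow> block_index \<gamma> j = i"
  unfolding block_index_def using block_unique[of _ \<gamma> i j] by (intro the_equality) blast+

lemma block_index_less:
  assumes "j \<in> {1..partial_sum \<gamma> (length \<gamma>)}"
  shows "block_index \<gamma> j < length \<gamma>" "j \<in> block \<gamma> (block_index \<gamma> j)"
proof -
  obtain i where "i < length \<gamma>" "j \<in> block \<gamma> i" using assms UN_block[of "length \<gamma>" \<gamma>] by blast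
  then show "block_index \<gamma> j < length \<gamma>" "j \<in> block \<gamma> (block_index \<gamma> j)" using block_index_eq by simp_all
qed

lemma spread_eq:
  assumes "i < length \<gamma>" "j \<in> block \<gamma> i" shows "spread \<gamma> E j = E i"
  using block_index_eq[OF assms] block_subset[OF assms(1)] assms(2) by (auto simp: spread_def)

lemma bij_betw_spread:
  assumes \<gamma>: "\<gamma> \<in> signed_compositions n"
  shows "bij_betw (spread \<gamma>) ({..<length \<gamma>} \<rightarrow>\<^sub>E UNIV)
    {e \<in> {1..n} \<rightarrow>\<^sub>E UNIV. \<forall>i<length \<gamma>. \<forall>j\<in>block \<gamma> i. \<forall>k\<in>block \<gamma> i. e j = e k}"
proof -
  have total: "partial_sum \<gamma> (length \<gamma>) = n" by (rule partial_sum_length[OF \<gamma>])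
  note last = partial_sum_Suc_in_block[OF \<gamma>]
  let ?E = "{..<length \<gamma>} \<rightarrow>\<^sub>E (UNIV :: bool set)" and ?r = "\<lambda>e. \<lambda>i\<in>{..<length \<gamma>}. e (partial_sum \<gamma> (Suc i))"
  let ?C = "{e \<in> {1..n} \<rightarrow>\<^sub>E UNIV. \<forall>i<length \<gamma>. \<forall>j\<in>block \<gamma> i. \<forall>k\<in>block \<gamma> i. e j = e k}"
  show ?thesis
  proof (rule bij_betw_byWitness[where f' = ?r])
    show "\<forall>E\<in>?E. ?r (spread \<gamma> E) = E"
    proof
      fix E assume E: "E \<in> ?E"
      show "?r (spread \<gamma> E) = E" by (rule PiE_ext[OF _ E]) (simp_all add: spread_eq last)
    qed
    show "\<forall>e\<in>?C. spread \<gamma> (?r e) = e"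
    proof
      fix e :: "nat \<Rightarrow> bool" assume e: "e \<in> ?C"
      show "spread \<gamma> (?r e) = e"
      proof (rule PiE_ext)
        show "spread \<gamma> (?r e) \<in> {1..n} \<rightarrow>\<^sub>E UNIV" by (simp add: spread_def total)
        show "e \<in> {1..n} \<rightarrow>\<^sub>E UNIV" using e by blast
        fix j assume "j \<in> {1..n}"
        then have j: "j \<in> {1..partial_sum \<gamma> (length \<gamma>)}" by (simp add: total)
        note index = block_index_less[OF j]
        have "e (partial_sum \<gamma> (Suc (block_index \<gamma> j))) = e j"
          using e index last[OF index(1)] by blast
        then show "spread \<gamma> (?r e) j = e j" by (simp add: spread_eq[OF index] index(1))
      qed
    qed
    show "spread \<gamma> ` ?E \<subseteq> ?C"
    proof (rule image_subsetI)
      show "spread \<gamma> E \<in> ?C" for E using spread_eq[of _ \<gamma> _ E] by (simp add: spread_def total)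
    qed
  qed auto
qed

lemma sum_wt_signed_arc_perms:
  assumes \<gamma>: "\<gamma> \<in> signed_compositions n" and "n \<ge> 2"
  shows "(\<Sum>w\<in>signed_arc_perms n. wt \<gamma> (sDes n w))
    = int (card {i. i < length \<gamma> \<and> \<bar>\<gamma> ! i\<bar> = 1}) * (\<Prod>i<length \<gamma>. 1 + sign_weight (\<gamma> ! i))"
proof -
  let ?m = "length \<gamma>" and ?units = "int (card {i. i < length \<gamma> \<and> \<bar>\<gamma> ! i\<bar> = 1})"
  let ?W = "\<lambda>e. \<Sum>s = 1..n. wt \<gamma> (arc_descents n e {s}, arc_signs n e)"
  let ?constant = "{e \<in> {1..n} \<rightarrow>\<^sub>E UNIV. \<forall>i<?m. \<forall>j\<in>block \<gamma> i. \<forall>k\<in>block \<gamma> i. e j = e k}"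
  let ?p = "\<lambda>E. \<Prod>i<?m. if E i then 1 else sign_weight (\<gamma> ! i)"
  have not_constant: "?W e = 0" if e: "e \<in> ({1..n} \<rightarrow>\<^sub>E UNIV) - ?constant" for e
  proof -
    obtain i j k where ijk: "i < ?m" "j \<in> block \<gamma> i" "k \<in> block \<gamma> i" "e j \<noteq> e k" using e by blast
    then have "j \<in> {1..n}" "k \<in> {1..n}"
      using block_subset[OF ijk(1)] partial_sum_length[OF \<gamma>] by blast+
    then have "sign_vector (arc_descents n e {s}, arc_signs n e) j
        \<noteq> sign_vector (arc_descents n e {s}, arc_signs n e) k" for s
      using ijk(4) by (simp add: sign_vector_arc arc_signs_def)
    then show ?thesis using wt_not_constant[OF ijk(1-3)] by simp
  qed
  have "(\<Sum>w\<in>signed_arc_perms n. wt \<gamma> (sDes n w)) = (\<Sum>e\<in>{1..n} \<rightarrow>\<^sub>E UNIV. ?W e)"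
    by (rule sum_signed_arc_perms[OF \<open>n \<ge> 2\<close>])
  also have "\<dots> = (\<Sum>e\<in>?constant. ?W e)"
    using not_constant by (intro sum.mono_neutral_right finite_PiE ballI) auto
  also have "\<dots> = (\<Sum>E\<in>{..<?m} \<rightarrow>\<^sub>E UNIV. ?W (spread \<gamma> E))"
    by (rule sum.reindex_bij_betw[OF bij_betw_spread[OF \<gamma>], symmetric])
  also have "\<dots> = (\<Sum>E\<in>{..<?m} \<rightarrow>\<^sub>E UNIV. ?p E * ?units)"
  proof (rule sum.cong[OF refl])
    fix E
    have "wt \<gamma> (arc_descents n (spread \<gamma> E) {s}, arc_signs n (spread \<gamma> E))
        = ?p E * (\<Prod>i<?m. toggle_sign (toggle_point \<gamma> (E i) i) (inner_block \<gamma> i) s)" for s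
      using wt_arc[OF \<gamma> _ spread_eq, where s = s and E = E] \<open>n \<ge> 2\<close> by (simp add: prod.distrib)
    then show "?W (spread \<gamma> E) = ?p E * ?units"
      by (simp only: sum_distrib_left[symmetric] sum_prod_toggle_sign_blocks[OF \<gamma>])
  qed
  also have "\<dots> = ?units * (\<Prod>i<?m. \<Sum>p\<in>UNIV. if p then 1 else sign_weight (\<gamma> ! i))"
    by (subst prod_sum_PiE) (simp_all add: sum_distrib_left mult.commute)
  finally show ?thesis by (simp add: UNIV_bool add.commute)
qed

lemma type_product_composition_type:
  "0 \<notin> set \<gamma> \<Longrightarrow> type_product (composition_type \<gamma>) = (\<Prod>i<length \<gamma>. 1 + sign_weight (\<gamma> ! i))"
proof (induction \<gamma>)
  case (Cons x \<gamma>)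
  have "(\<Prod>i<length (x # \<gamma>). 1 + sign_weight ((x # \<gamma>) ! i)) = (1 + sign_weight x) * type_product (composition_type \<gamma>)"
    using Cons by (simp add: prod.lessThan_Suc_shift del: prod.lessThan_Suc)
  also have "\<dots> = type_product (composition_type (x # \<gamma>))"
    using Cons.prems by (cases x "0 :: int" rule: linorder_cases)
      (auto simp: type_product_def composition_type_def sign_weight_def mult_ac)
  finally show ?case by simp
qed (simp add: type_product_def composition_type_def)

lemma count_unbarred_units:
  "count (fst (composition_type \<gamma>)) 1 = card {i. i < length \<gamma> \<and> \<gamma> ! i = 1}"
proof -
  have "count (fst (composition_type \<gamma>)) 1 = length (filter (\<lambda>x. x = 1) \<gamma>)"
    by (induction \<gamma>) (auto simp: composition_type_def nat_eq_iff)
  then show ?thesis by (simp add: length_filter_conv_card)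
qed

text \<open>A barred part \<open>1\<close> contributes the factor \<open>0\<close>, so in its absence the parts \<open>\<plusminus>1\<close> are the unbarred parts \<open>1\<close>.\<close>

lemma units_mult_type_product:
  assumes "0 \<notin> set \<gamma>"
  shows "int (card {i. i < length \<gamma> \<and> \<bar>\<gamma> ! i\<bar> = 1}) * type_product (composition_type \<gamma>)
    = int (count (fst (composition_type \<gamma>)) 1) * type_product (composition_type \<gamma>)"
proof (cases "- 1 \<in> set \<gamma>")
  case True
  then obtain i where "i < length \<gamma>" "\<gamma> ! i = - 1" by (auto simp: in_set_conv_nth)
  then have "(\<Prod>i<length \<gamma>. 1 + sign_weight (\<gamma> ! i)) = 0"
    by (intro prod_zero bexI[of _ i]) (simp_all add: sign_weight_def)
  then show ?thesis by (simp add: type_product_composition_type[OF assms])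
next
  case False
  then have "\<gamma> ! i \<noteq> - 1" if "i < length \<gamma>" for i using that by (metis nth_mem)
  then have "{i. i < length \<gamma> \<and> \<bar>\<gamma> ! i\<bar> = 1} = {i. i < length \<gamma> \<and> \<gamma> ! i = 1}" by fastforce
  then show ?thesis by (simp only: count_unbarred_units)
qed

lemma fine_set_signed_arc_perms:
  assumes "n \<ge> 2"
  shows "fine_set n (signed_arc_perms n) (sDes n)
    (induced (signed_perms (n - 1)) (signed_perms n) (ext_char (n - 1)))"
  unfolding fine_set_def
proof (intro conjI ballI impI)
  show "finite (signed_arc_perms n)" by (rule finite_signed_arc_perms)
  fix \<gamma> w assume \<gamma>: "\<gamma> \<in> signed_compositions n" and w: "w \<in> signed_perms n"
    and type: "signed_cycle_type n w = composition_type \<gamma>"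
  have nonzero: "0 \<notin> set \<gamma>" using \<gamma> by (simp add: signed_compositions_def)
  have "induced (signed_perms (n - 1)) (signed_perms n) (ext_char (n - 1)) w
      = of_int (int (count (fst (composition_type \<gamma>)) 1) * type_product (composition_type \<gamma>))"
    using induced_ext_char[OF _ w] assms type by simp
  also have "int (count (fst (composition_type \<gamma>)) 1) * type_product (composition_type \<gamma>)
      = (\<Sum>b\<in>signed_arc_perms n. wt \<gamma> (sDes n b))"
    unfolding sum_wt_signed_arc_perms[OF \<gamma> assms] units_mult_type_product[OF nonzero, symmetric]
    by (simp only: type_product_composition_type[OF nonzero])
  finally show "induced (signed_perms (n - 1)) (signed_perms n) (ext_char (n - 1)) w
      = of_int (\<Sum>b\<in>signed_arc_perms n. wt \<gamma> (sDes n b))" .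
qed

section \<open>Coefficients of series\<close>

lemma mcoeff_0: "mcoeff 0 M = 0" and mcoeff_add: "mcoeff (f + g) M = mcoeff f M + mcoeff g M"
  by (simp_all add: zero_mseries.rep_eq plus_mseries.rep_eq)

lemma mcoeff_diff: "mcoeff (f - g) M = mcoeff f M - mcoeff g M"
  by (simp add: minus_mseries.rep_eq)

lemma mcoeff_mult: "mcoeff (f * g) M = (\<Sum>A | A \<subseteq># M. mcoeff f A * mcoeff g (M - A))"
  by (simp add: times_mseries.rep_eq)

lemma mcoeff_sum: "mcoeff (sum f A) M = (\<Sum>x\<in>A. mcoeff (f x) M)"
  by (induction A rule: infinite_finite_induct) (simp_all add: mcoeff_0 mcoeff_add)

lemma finite_submultisets: "finite {A. A \<subseteq># M}"
proof (rule finite_subset)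
  show "{A. A \<subseteq># M} \<subseteq> mset ` {xs. set xs \<subseteq> set_mset M \<and> length xs \<le> size M}"
  proof
    fix A assume "A \<in> {A. A \<subseteq># M}"
    then have "set_mset A \<subseteq> set_mset M" "size A \<le> size M" by (auto dest: set_mset_mono size_mset_mono)
    moreover obtain xs where "mset xs = A" using ex_mset by blast
    ultimately show "A \<in> mset ` {xs. set xs \<subseteq> set_mset M \<and> length xs \<le> size M}" by force
  qed
  show "finite (mset ` {xs. set xs \<subseteq> set_mset M \<and> length xs \<le> size M})"
    by (intro finite_imageI finite_lists_length_le finite_set_mset)
qed

lemma mcoeff_mult_eq_sum:
  assumes "S \<subseteq> {A. A \<subseteq># M}" "\<And>A. A \<subseteq># M \<Longrightarrow> A \<notin> S \<Longrightarrow> mcoeff f A * mcoeff g (M - A) = 0"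
  shows "mcoeff (f * g) M = (\<Sum>A\<in>S. mcoeff f A * mcoeff g (M - A))"
  unfolding mcoeff_mult using assms by (intro sum.mono_neutral_right finite_submultisets) auto

section \<open>Words in the ordered alphabet\<close>

fun var_rank :: "var \<Rightarrow> nat" where
  "var_rank (Y i) = 2 * i" | "var_rank (X i) = 2 * i + 1"

fun is_X :: "var \<Rightarrow> bool" where
  "is_X (X i) = True" | "is_X (Y i) = False"

fun var_index :: "var \<Rightarrow> nat" where
  "var_index (X i) = i" | "var_index (Y i) = i"

definition mk_var :: "bool \<Rightarrow> nat \<Rightarrow> var" where
  "mk_var p i = (if p then X i else Y i)"

lemma is_X_mk_var [simp]: "is_X (mk_var p i) = p"
  by (simp add: mk_var_def)

lemma var_index_mk_var [simp]: "var_index (mk_var p i) = i"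
  by (simp add: mk_var_def)

lemma mk_var_eq_iff [simp]: "mk_var p i = mk_var q j \<longleftrightarrow> p = q \<and> i = j"
  by (auto simp: mk_var_def)

lemma mk_var_var_index: "is_X x = p \<Longrightarrow> mk_var p (var_index x) = x"
  by (cases x) (auto simp: mk_var_def)

text \<open>The order \<open>y\<^sub>0 < x\<^sub>0 < y\<^sub>1 < x\<^sub>1 < \<dots>\<close>. It makes the words counted by the quasisymmetric functions
  weakly increasing.\<close>

instantiation var :: linorder
begin

definition less_eq_var :: "var \<Rightarrow> var \<Rightarrow> bool" where "x \<le> y \<longleftrightarrow> var_rank x \<le> var_rank y"

definition less_var :: "var \<Rightarrow> var \<Rightarrow> bool" where "x < y \<longleftrightarrow> var_rank x < var_rank y"

instance
proof
  fix x y :: var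
  show "x = y" if "x \<le> y" "y \<le> x"
    using that by (cases x; cases y) (auto simp: less_eq_var_def, presburger+)
qed (auto simp: less_eq_var_def less_var_def)

end

lemma mk_var_le_iff:
  "mk_var p i \<le> mk_var q j \<longleftrightarrow> i < j \<or> (i = j \<and> (p \<longrightarrow> q))"
  by (auto simp: mk_var_def less_eq_var_def)

lemma sorted_mset_eq_iff: "sorted xs \<and> mset xs = M \<longleftrightarrow> xs = sorted_list_of_multiset M"
  by (metis mset_sorted_list_of_multiset sorted_list_of_multiset_mset sorted_sort_id sorted_sorted_list_of_multiset)

lemma length_sorted_list_of_multiset: "length (sorted_list_of_multiset M) = size M"
  by (metis mset_sorted_list_of_multiset size_mset)

lemma mset_map_enumeration:
  assumes "inj_on g {..<k}"
  shows "image_mset f (mset_set (g ` {..<k})) = mset (map (\<lambda>j. f (g j)) [0..<k])"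
  by (simp add: image_mset_mset_set_image[OF assms] atLeast0LessThan)

lemma bij_betw_PiE_lists:
  fixes g :: "nat \<Rightarrow> 'a"
  assumes g_inj: "inj_on g {..<k}"
  shows "bij_betw (\<lambda>T. map (\<lambda>j. T (g j)) [0..<k]) (g ` {..<k} \<rightarrow>\<^sub>E UNIV) {xs :: 'b list. length xs = k}"
proof (rule bij_betw_byWitness[where f' = "\<lambda>xs. \<lambda>c\<in>g ` {..<k}. xs ! the_inv_into {..<k} g c"])
  have "(\<lambda>c\<in>g ` {..<k}. map (\<lambda>j. T (g j)) [0..<k] ! the_inv_into {..<k} g c) = T"
    if T: "T \<in> g ` {..<k} \<rightarrow>\<^sub>E UNIV" for T :: "'a \<Rightarrow> 'b"
    by (rule PiE_ext[OF _ T]) (use the_inv_into_f_f[OF g_inj] in auto)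
  then show "\<forall>T\<in>g ` {..<k} \<rightarrow>\<^sub>E UNIV. (\<lambda>c\<in>g ` {..<k}. map (\<lambda>j. T (g j)) [0..<k] ! the_inv_into {..<k} g c) = (T :: 'a \<Rightarrow> 'b)"
    by blast
  show "\<forall>xs\<in>{xs. length xs = k}. map (\<lambda>j. (\<lambda>c\<in>g ` {..<k}. xs ! the_inv_into {..<k} g c) (g j)) [0..<k] = (xs :: 'b list)"
    using the_inv_into_f_f[OF g_inj] by (auto intro!: nth_equalityI)
qed auto

definition y_squarefree :: "var multiset \<Rightarrow> bool" where
  "y_squarefree M \<longleftrightarrow> (\<forall>i. count M (Y i) \<le> 1)"

lemma y_squarefree_empty: "y_squarefree {#}"
  by (simp add: y_squarefree_def)

lemma y_squarefree_add_mset: "y_squarefree (add_mset x M) \<longleftrightarrow> y_squarefree M \<and> (x \<in># M \<longrightarrow> is_X x)"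
proof (cases x)
  case (Y i)
  have "count (add_mset (Y i) M) (Y k) \<le> 1 \<longleftrightarrow> count M (Y k) \<le> 1 \<and> (k = i \<longrightarrow> count M (Y i) = 0)" for k
    by (auto simp: le_Suc_eq)
  then have "y_squarefree (add_mset (Y i) M) \<longleftrightarrow> y_squarefree M \<and> count M (Y i) = 0"
    unfolding y_squarefree_def by blast
  then show ?thesis using Y by (simp add: not_in_iff)
qed (simp add: y_squarefree_def)

lemma y_squarefree_mset_iff:
  "sorted xs \<Longrightarrow> y_squarefree (mset xs)
    \<longleftrightarrow> (\<forall>j<length xs - 1. xs ! j = xs ! Suc j \<longrightarrow> is_X (xs ! j))"
proof (induction xs rule: induct_list012)
  case (3 x y xs)
  then have "x \<in> set (y # xs) \<longleftrightarrow> x = y" by auto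
  then have "y_squarefree (mset (x # y # xs)) \<longleftrightarrow> y_squarefree (mset (y # xs)) \<and> (x = y \<longrightarrow> is_X x)"
    unfolding mset.simps(2)[of x] y_squarefree_add_mset set_mset_mset by simp
  moreover have "(\<forall>j<length (x # y # xs) - 1. (x # y # xs) ! j = (x # y # xs) ! Suc j \<longrightarrow> is_X ((x # y # xs) ! j))
      \<longleftrightarrow> (x = y \<longrightarrow> is_X x) \<and> (\<forall>j<length (y # xs) - 1. (y # xs) ! j = (y # xs) ! Suc j \<longrightarrow> is_X ((y # xs) ! j))"
    by (simp add: All_less_Suc2)
  moreover have "sorted (y # xs)" using 3 by simp
  ultimately show ?case using "3.IH"(2) by blast
qed (simp_all add: y_squarefree_def)

definition admissible :: "nat \<Rightarrow> var list \<Rightarrow> bool" where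
  "admissible p xs \<longleftrightarrow> (\<forall>j<length xs - 1. xs ! j = xs ! Suc j \<longrightarrow> (is_X (xs ! j) \<longleftrightarrow> j \<noteq> p))"

lemma admissible_Cons_Cons_0:
  "sorted (y # xs) \<Longrightarrow> admissible 0 (x # y # xs) \<longleftrightarrow> (x = y \<longrightarrow> \<not> is_X x) \<and> y_squarefree (mset (y # xs))"
  unfolding y_squarefree_mset_iff by (simp add: admissible_def All_less_Suc2)

lemma admissible_Cons_Cons_Suc:
  "admissible (Suc p) (x # y # xs) \<longleftrightarrow> (x = y \<longrightarrow> is_X x) \<and> admissible p (y # xs)"
  by (auto simp: admissible_def All_less_Suc2)

lemma removable_add_mset_new:
  assumes "x \<notin># M"
  shows "{z \<in> set_mset (add_mset x M). y_squarefree (add_mset x M - {#z#})}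
    = (if y_squarefree M then {x} else {}) \<union> {z \<in> set_mset M. y_squarefree (M - {#z#})}"
proof -
  have "add_mset x M - {#z#} = add_mset x (M - {#z#})" if "z \<in># M" for z
    using that by simp
  moreover have "x \<notin># M - {#z#}" for z using assms by (meson in_diffD)
  ultimately show ?thesis using assms by (auto simp: y_squarefree_add_mset)
qed

lemma removable_add_mset_old:
  assumes "x \<in># M"
  shows "{z \<in> set_mset (add_mset x M). y_squarefree (add_mset x M - {#z#})}
    = (if is_X x then {z \<in> set_mset M. y_squarefree (M - {#z#})} else if y_squarefree M then {x} else {})"
proof (cases "is_X x")
  case True
  have diff: "add_mset x M - {#z#} = add_mset x (M - {#z#})" if "z \<in># M" for z
    using that by simp
  show ?thesis using assms True by (auto simp: diff y_squarefree_add_mset insert_absorb simp del: diff_union_swap2)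
next
  case False
  have "y_squarefree (add_mset x M - {#z#}) \<longleftrightarrow> z = x \<and> y_squarefree M" if "z \<in># M" for z
  proof (cases "z = x")
    case False
    then have "add_mset x M - {#z#} = add_mset x (M - {#z#})" "x \<in># M - {#z#}"
      using assms that by (simp_all add: in_diff_count)
    then show ?thesis using False \<open>\<not> is_X x\<close> by (simp add: y_squarefree_add_mset)
  qed simp
  then show ?thesis using assms False by auto
qed

lemma card_admissible:
  "sorted xs \<Longrightarrow> card {p. p < length xs \<and> admissible p xs} = card {x \<in> set xs. y_squarefree (mset xs - {#x#})}"
proof (induction xs rule: induct_list012)
  case (2 x)
  have "{p. p < length [x] \<and> admissible p [x]} = {0}" "{z \<in> set [x]. y_squarefree (mset [x] - {#z#})} = {x}"
    by (auto simp: admissible_def y_squarefree_empty)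
  then show ?case by simp
next
  case (3 x y xs)
  define ys where "ys = y # xs"
  have sorted: "sorted ys" and mem: "x \<in> set ys \<longleftrightarrow> x = y"
    using "3.prems" by (auto simp: ys_def)
  have admissible_0: "admissible 0 (x # ys) \<longleftrightarrow> (x = y \<longrightarrow> \<not> is_X x) \<and> y_squarefree (mset ys)"
    using admissible_Cons_Cons_0[of y xs x] sorted by (simp only: ys_def)
  have admissible_Suc: "admissible (Suc p) (x # ys) \<longleftrightarrow> (x = y \<longrightarrow> is_X x) \<and> admissible p ys" for p
    unfolding ys_def by (rule admissible_Cons_Cons_Suc)
  have "{p. p < length (x # ys) \<and> admissible p (x # ys)}
      = (if admissible 0 (x # ys) then {0} else {}) \<union> Suc ` {p. p < length ys \<and> admissible (Suc p) (x # ys)}"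
    by (auto simp: less_Suc_eq_0_disj)
  then have "card {p. p < length (x # ys) \<and> admissible p (x # ys)}
      = of_bool (admissible 0 (x # ys)) + card {p. p < length ys \<and> admissible (Suc p) (x # ys)}"
    by (simp add: card_insert_if card_image)
  also have "\<dots> = of_bool ((x = y \<longrightarrow> \<not> is_X x) \<and> y_squarefree (mset ys))
      + (if x = y \<longrightarrow> is_X x then card {z \<in> set ys. y_squarefree (mset ys - {#z#})} else 0)"
    using "3.IH"(2) sorted unfolding admissible_0 admissible_Suc ys_def[symmetric] by simp
  also have "\<dots> = card {z \<in> set (x # ys). y_squarefree (mset (x # ys) - {#z#})}"
  proof (cases "x = y")
    case True
    then show ?thesis using removable_add_mset_old[of x "mset ys"] mem by simp
  next
    case False
    then show ?thesis using removable_add_mset_new[of x "mset ys"] mem by (simp add: card_insert_if)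
  qed
  also have "x # ys = x # y # xs" unfolding ys_def ..
  finally show ?case .
qed simp

section \<open>Quasisymmetric functions and Schur functions\<close>

lemma bij_betw_signed_words:
  "bij_betw (\<lambda>i. map (\<lambda>j. mk_var (e (Suc j)) (i (Suc j))) [0..<n]) ({1..n} \<rightarrow>\<^sub>E UNIV)
    {xs. length xs = n \<and> (\<forall>j<n. is_X (xs ! j) \<longleftrightarrow> e (Suc j))}"
proof (rule bij_betw_byWitness[where f' = "\<lambda>xs. \<lambda>j\<in>{1..n}. var_index (xs ! (j - 1))"])
  have "(\<lambda>j\<in>{1..n}. var_index (map (\<lambda>j. mk_var (e (Suc j)) (i (Suc j))) [0..<n] ! (j - 1))) = i"
    if "i \<in> {1..n} \<rightarrow>\<^sub>E UNIV" for i
    by (rule PiE_ext[OF _ that]) auto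
  then show "\<forall>i\<in>{1..n} \<rightarrow>\<^sub>E UNIV.
      (\<lambda>j\<in>{1..n}. var_index (map (\<lambda>j. mk_var (e (Suc j)) (i (Suc j))) [0..<n] ! (j - 1))) = i"
    by blast
  show "\<forall>xs\<in>{xs. length xs = n \<and> (\<forall>j<n. is_X (xs ! j) \<longleftrightarrow> e (Suc j))}.
      map (\<lambda>j. mk_var (e (Suc j)) ((\<lambda>j\<in>{1..n}. var_index (xs ! (j - 1))) (Suc j))) [0..<n] = xs"
  proof safe
    fix xs :: "var list" assume "n = length xs" "\<forall>j<length xs. is_X (xs ! j) \<longleftrightarrow> e (Suc j)"
    then show "map (\<lambda>j. mk_var (e (Suc j)) ((\<lambda>j\<in>{1..length xs}. var_index (xs ! (j - 1))) (Suc j))) [0..<length xs] = xs"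
      by (intro nth_equalityI) (simp_all add: mk_var_var_index flip: \<open>n = length xs\<close>)
  qed
qed auto

lemma F_fun_coeff:
  fixes M :: "var multiset"
  assumes wDes: "wDes \<sigma> \<subseteq> {1..<n}"
    and change: "\<And>j. j \<in> {1..<n} \<Longrightarrow> (sign_vector \<sigma> j = 1) \<noteq> (sign_vector \<sigma> (Suc j) = 1)
      \<Longrightarrow> j \<in> wDes \<sigma> \<longleftrightarrow> sign_vector \<sigma> j = 1"
  defines "xs \<equiv> sorted_list_of_multiset M"
  shows "mcoeff (F_fun n \<sigma>) M = of_bool (size M = n \<and> (\<forall>j<n. is_X (xs ! j) \<longleftrightarrow> sign_vector \<sigma> (Suc j) = 1)
    \<and> (\<forall>j. Suc j < n \<longrightarrow> xs ! j = xs ! Suc j \<longrightarrow> Suc j \<notin> wDes \<sigma>))"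
proof -
  define word where "word i = map (\<lambda>j. mk_var (sign_vector \<sigma> (Suc j) = 1) (i (Suc j))) [0..<n]" for i
  define W where "W = {ys. length ys = n \<and> (\<forall>j<n. is_X (ys ! j) \<longleftrightarrow> sign_vector \<sigma> (Suc j) = 1)}"
  define unbroken where "unbroken ys \<longleftrightarrow> (\<forall>j. Suc j < n \<longrightarrow> ys ! j = ys ! Suc j \<longrightarrow> Suc j \<notin> wDes \<sigma>)" for ys :: "var list"
  have bij: "bij_betw word ({1..n} \<rightarrow>\<^sub>E UNIV) W"
    unfolding word_def[abs_def] W_def by (rule bij_betw_signed_words)
  have step: "i (Suc j) \<le> i (Suc (Suc j)) \<and> (Suc j \<in> wDes \<sigma> \<longrightarrow> i (Suc j) < i (Suc (Suc j)))
      \<longleftrightarrow> word i ! j \<le> word i ! Suc j \<and> (word i ! j = word i ! Suc j \<longrightarrow> Suc j \<notin> wDes \<sigma>)"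
    if "Suc j < n" for i j
    using that change[of "Suc j"]
    by (cases "sign_vector \<sigma> (Suc j) = 1"; cases "sign_vector \<sigma> (Suc (Suc j)) = 1")
      (auto simp: word_def mk_var_le_iff)
  have monotone: "(\<forall>j\<in>{1..<n}. i j \<le> i (j + 1)) \<and> (\<forall>j\<in>wDes \<sigma>. i j < i (j + 1)) \<longleftrightarrow> sorted (word i) \<and> unbroken (word i)" for i
  proof -
    have "(\<forall>j\<in>{1..<n}. i j \<le> i (j + 1)) \<and> (\<forall>j\<in>wDes \<sigma>. i j < i (j + 1))
        \<longleftrightarrow> (\<forall>j\<in>{1..<n}. i j \<le> i (Suc j) \<and> (j \<in> wDes \<sigma> \<longrightarrow> i j < i (Suc j)))"
      using wDes by auto
    also have "\<dots> \<longleftrightarrow> (\<forall>j. Suc j < n \<longrightarrow> i (Suc j) \<le> i (Suc (Suc j)) \<and> (Suc j \<in> wDes \<sigma> \<longrightarrow> i (Suc j) < i (Suc (Suc j))))"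
      by (auto simp: Suc_le_eq gr0_conv_Suc)
    also have "\<dots> \<longleftrightarrow> (\<forall>j. Suc j < n \<longrightarrow> word i ! j \<le> word i ! Suc j \<and> (word i ! j = word i ! Suc j \<longrightarrow> Suc j \<notin> wDes \<sigma>))"
      using step by auto
    also have "\<dots> \<longleftrightarrow> sorted (word i) \<and> unbroken (word i)"
      by (auto simp: sorted_iff_nth_Suc unbroken_def word_def)
    finally show ?thesis .
  qed
  have content: "image_mset (\<lambda>j. if sign_vector \<sigma> j = 1 then X (i j) else Y (i j)) (mset_set {1..n}) = mset (word i)" for i
    using mset_map_enumeration[of Suc n "\<lambda>j. if sign_vector \<sigma> j = 1 then X (i j) else Y (i j)"]
    by (simp add: word_def image_Suc_lessThan mk_var_def)
  have "mcoeff (F_fun n \<sigma>) M = of_nat (card {i \<in> {1..n} \<rightarrow>\<^sub>E UNIV. word i = xs \<and> unbroken (word i)})"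
    unfolding F_fun.rep_eq content xs_def sorted_mset_eq_iff[symmetric] using monotone by (intro arg_cong[where f = "\<lambda>A. of_nat (card A)"]) auto
  also have "\<dots> = of_nat (card {ys \<in> W. ys = xs \<and> unbroken ys})"
    by (subst bij_betw_same_card[OF bij_betw_Collect[OF bij refl]]) simp
  also have "{ys \<in> W. ys = xs \<and> unbroken ys} = (if xs \<in> W \<and> unbroken xs then {xs} else {})" by auto
  finally show ?thesis
    by (simp add: W_def unbroken_def xs_def length_sorted_list_of_multiset)
qed

lemma wDes_arc:
  assumes "j \<in> {1..<n}"
  shows "j \<in> wDes (arc_descents n e T, arc_signs n e)
    \<longleftrightarrow> (e j \<and> \<not> e (Suc j)) \<or> (e j = e (Suc j) \<and> (e j \<longleftrightarrow> j \<in> T))"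
proof -
  let ?S = "arc_descents n e T" and ?\<epsilon> = "arc_signs n e"
  have "Suc j \<in> {1..n}" using assms by auto
  from sign_vector_arc[OF this] have "?\<epsilon> (LEAST t. t \<in> ?S \<and> j < t) = ?\<epsilon> (Suc j)"
    by (simp add: sign_vector_def Suc_le_eq)
  moreover have "n \<in> ?S" "j < n" using assms by (simp_all add: arc_descents_def)
  then have "\<exists>t\<in>?S. j < t" by blast
  ultimately have "j \<in> wDes (?S, ?\<epsilon>) \<longleftrightarrow> j \<in> ?S \<and> (?\<epsilon> j = ?\<epsilon> (Suc j) \<or> (?\<epsilon> j = 1 \<and> ?\<epsilon> (Suc j) = - 1))"
    by (simp add: wDes_def Let_def)
  moreover have "j \<in> {1..n - 1}" "j \<noteq> n" "j \<in> {1..n}" "Suc j \<in> {1..n}" using assms by auto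
  ultimately show ?thesis by (auto simp: arc_descents_def arc_signs_def)
qed

lemma wDes_arc_subset: "wDes (arc_descents n e T, arc_signs n e) \<subseteq> {1..<n}"
  by (auto simp: wDes_def arc_descents_def)

lemma sign_vector_arc_eq_1_iff:
  "j \<in> {1..n} \<Longrightarrow> sign_vector (arc_descents n e T, arc_signs n e) j = 1 \<longleftrightarrow> e j"
  by (simp add: sign_vector_arc) (simp add: arc_signs_def)

lemma F_fun_arc_coeff:
  fixes M :: "var multiset"
  assumes s: "s \<in> {1..n}"
  defines "xs \<equiv> sorted_list_of_multiset M"
  shows "mcoeff (F_fun n (arc_descents n e {s}, arc_signs n e)) M
    = of_bool (size M = n \<and> (\<forall>j<n. e (Suc j) \<longleftrightarrow> is_X (xs ! j)) \<and> admissible (s - 1) xs)"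
proof -
  let ?\<sigma> = "(arc_descents n e {s}, arc_signs n e)"
  have change: "j \<in> wDes ?\<sigma> \<longleftrightarrow> sign_vector ?\<sigma> j = 1"
    if "j \<in> {1..<n}" "(sign_vector ?\<sigma> j = 1) \<noteq> (sign_vector ?\<sigma> (Suc j) = 1)" for j
    using that sign_vector_arc_eq_1_iff[of j n e "{s}"] sign_vector_arc_eq_1_iff[of "Suc j" n e "{s}"]
    by (auto simp: wDes_arc)
  have "Suc j \<notin> wDes ?\<sigma> \<longleftrightarrow> (is_X (xs ! j) \<longleftrightarrow> j \<noteq> s - 1)"
    if "Suc j < n" "xs ! j = xs ! Suc j" "\<forall>j<n. e (Suc j) \<longleftrightarrow> is_X (xs ! j)" for j
    using that s by (auto simp: wDes_arc)
  then have admissible: "(\<forall>j. Suc j < n \<longrightarrow> xs ! j = xs ! Suc j \<longrightarrow> Suc j \<notin> wDes ?\<sigma>) \<longleftrightarrow> admissible (s - 1) xs"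
    if "size M = n" "\<forall>j<n. e (Suc j) \<longleftrightarrow> is_X (xs ! j)"
    using that unfolding admissible_def xs_def length_sorted_list_of_multiset less_diff_conv by simp
  have "mcoeff (F_fun n ?\<sigma>) M = of_bool (size M = n \<and> (\<forall>j<n. is_X (xs ! j) \<longleftrightarrow> e (Suc j))
      \<and> (\<forall>j. Suc j < n \<longrightarrow> xs ! j = xs ! Suc j \<longrightarrow> Suc j \<notin> wDes ?\<sigma>))"
    unfolding xs_def by (subst F_fun_coeff[OF wDes_arc_subset change]) (auto simp: sign_vector_arc_eq_1_iff)
  also have "\<dots> = of_bool (size M = n \<and> (\<forall>j<n. e (Suc j) \<longleftrightarrow> is_X (xs ! j)) \<and> admissible (s - 1) xs)"
    using admissible by (intro arg_cong[where f = of_bool]) blast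
  finally show ?thesis .
qed

lemma sum_F_fun_arc_coeff:
  "(\<Sum>e\<in>{1..n} \<rightarrow>\<^sub>E UNIV. \<Sum>s = 1..n. mcoeff (F_fun n (arc_descents n e {s}, arc_signs n e)) M)
    = of_bool (size M = n) * of_nat (card {x \<in> set_mset M. y_squarefree (M - {#x#})})"
proof -
  define xs where "xs = sorted_list_of_multiset M"
  define e0 where "e0 = (\<lambda>j\<in>{1..n}. is_X (xs ! (j - 1)))"
  have e0: "e0 \<in> {1..n} \<rightarrow>\<^sub>E UNIV" by (simp add: e0_def)
  have e0_iff: "(\<forall>j<n. e (Suc j) \<longleftrightarrow> is_X (xs ! j)) \<longleftrightarrow> e = e0" if e: "e \<in> {1..n} \<rightarrow>\<^sub>E UNIV" for e
  proof
    assume signs: "\<forall>j<n. e (Suc j) \<longleftrightarrow> is_X (xs ! j)"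
    have "e j = e0 j" if "j \<in> {1..n}" for j
      using that signs[rule_format, of "j - 1"] by (cases j) (simp_all add: e0_def)
    then show "e = e0" by (rule PiE_ext[OF e e0])
  qed (simp add: e0_def)
  have "(\<Sum>e\<in>{1..n} \<rightarrow>\<^sub>E UNIV. \<Sum>s = 1..n. mcoeff (F_fun n (arc_descents n e {s}, arc_signs n e)) M)
      = (\<Sum>e\<in>{1..n} \<rightarrow>\<^sub>E UNIV. if e = e0 then \<Sum>s = 1..n. of_bool (size M = n \<and> admissible (s - 1) xs) else 0)"
    by (intro sum.cong refl) (simp add: F_fun_arc_coeff e0_iff flip: xs_def)
  also have "\<dots> = (\<Sum>s = 1..n. of_bool (size M = n \<and> admissible (s - 1) xs))"
    using e0 by (simp add: finite_PiE)
  also have "\<dots> = (\<Sum>p<n. of_bool (size M = n \<and> admissible p xs))"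
    by (rule sum.reindex_bij_witness[of _ Suc "\<lambda>s. s - 1"]) auto
  also have "\<dots> = of_bool (size M = n) * of_nat (card {p. p < length xs \<and> admissible p xs})"
    by (simp add: xs_def length_sorted_list_of_multiset of_bool_conj sum_of_bool_eq flip: sum_distrib_left)
      (auto simp: Int_def)
  also have "card {p. p < length xs \<and> admissible p xs} = card {x \<in> set_mset M. y_squarefree (M - {#x#})}"
    by (simp add: card_admissible xs_def)
  finally show ?thesis .
qed

lemma image_mset_mk_var_eq_iff:
  "image_mset (mk_var p) A = M \<longleftrightarrow> (\<forall>x\<in>#M. is_X x = p) \<and> A = image_mset var_index M"
proof safe
  assume "\<forall>x\<in>#M. is_X x = p"
  then have "image_mset (\<lambda>x. mk_var p (var_index x)) M = image_mset (\<lambda>x. x) M"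
    by (intro image_mset_cong) (simp add: mk_var_var_index)
  then show "image_mset (mk_var p) (image_mset var_index M) = M"
    by (simp add: image_mset.compositionality comp_def)
qed (auto simp: image_mset.compositionality comp_def)

lemma card_fillings:
  fixes z :: "nat \<Rightarrow> var"
  assumes "inj_on g {..<k}" and D_eq: "D = g ` {..<k}"
  shows "card {T \<in> D \<rightarrow>\<^sub>E UNIV. P (map (\<lambda>j. T (g j)) [0..<k]) \<and> image_mset (\<lambda>c. z (T c)) (mset_set D) = M}
    = card {xs. length xs = k \<and> P xs \<and> image_mset z (mset xs) = M}"
proof -
  have content: "image_mset (\<lambda>c. z (T c)) (mset_set D) = image_mset z (mset (map (\<lambda>j. T (g j)) [0..<k]))" for T
    unfolding D_eq mset_map_enumeration[OF assms(1)] mset_map image_mset.compositionality comp_def ..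
  show ?thesis
    unfolding content unfolding D_eq
    by (subst bij_betw_same_card[OF bij_betw_Collect[OF bij_betw_PiE_lists[OF assms(1)] refl]]) simp
qed

lemma schur_row_coeff:
  "mcoeff (schur X [k]) M = of_bool (size M = k \<and> (\<forall>x\<in>#M. is_X x))"
proof -
  let ?N = "image_mset var_index M"
  have X_eq: "X = mk_var True" by (simp add: mk_var_def fun_eq_iff)
  have D_eq: "young_diagram [k] = Pair 0 ` {..<k}" by (auto simp: young_diagram_def)
  have "ssyt [k] = {T \<in> young_diagram [k] \<rightarrow>\<^sub>E UNIV. sorted (map (\<lambda>j. T (0, j)) [0..<k])}"
    by (auto simp: ssyt_def young_diagram_def sorted_iff_nth_Suc)
  then have "mcoeff (schur X [k]) M = of_nat (card {T \<in> young_diagram [k] \<rightarrow>\<^sub>E UNIV.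
      sorted (map (\<lambda>j. T (0, j)) [0..<k]) \<and> image_mset (\<lambda>c. X (T c)) (mset_set (young_diagram [k])) = M})"
    unfolding schur.rep_eq by (simp only: mem_Collect_eq conj_assoc)
  also have "\<dots> = of_nat (card {xs. length xs = k \<and> sorted xs \<and> image_mset X (mset xs) = M})"
    by (subst card_fillings[OF _ D_eq]) (simp_all add: inj_on_def)
  also have "{xs. length xs = k \<and> sorted xs \<and> image_mset X (mset xs) = M}
      = {xs. (size M = k \<and> (\<forall>x\<in>#M. is_X x)) \<and> xs = sorted_list_of_multiset ?N}"
    unfolding X_eq image_mset_mk_var_eq_iff sorted_mset_eq_iff[symmetric]
    by (auto dest: arg_cong[where f = size])
  finally show ?thesis by simp
qed

lemma schur_column_coeff:
  "mcoeff (schur Y (replicate k 1)) M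
    = of_bool (size M = k \<and> (\<forall>x\<in>#M. \<not> is_X x) \<and> y_squarefree M)"
proof -
  let ?N = "image_mset var_index M" and ?lam = "replicate k (1 :: nat)"
  have Y_eq: "Y = mk_var False" by (simp add: mk_var_def fun_eq_iff)
  have D_eq: "young_diagram ?lam = (\<lambda>i. (i, 0)) ` {..<k}" by (auto simp: young_diagram_def)
  have "ssyt ?lam = {T \<in> young_diagram ?lam \<rightarrow>\<^sub>E UNIV. sorted_wrt (<) (map (\<lambda>i. T (i, 0)) [0..<k])}"
    by (auto simp: ssyt_def young_diagram_def sorted_wrt_iff_nth_Suc_transp)
  then have "mcoeff (schur Y ?lam) M = of_nat (card {T \<in> young_diagram ?lam \<rightarrow>\<^sub>E UNIV.
      sorted_wrt (<) (map (\<lambda>i. T (i, 0)) [0..<k]) \<and> image_mset (\<lambda>c. Y (T c)) (mset_set (young_diagram ?lam)) = M})"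
    unfolding schur.rep_eq by (simp only: mem_Collect_eq conj_assoc)
  also have "\<dots> = of_nat (card {xs. length xs = k \<and> sorted_wrt (<) xs \<and> image_mset Y (mset xs) = M})"
    by (subst card_fillings[OF _ D_eq]) (simp_all add: inj_on_def)
  also have "{xs. length xs = k \<and> sorted_wrt (<) xs \<and> image_mset Y (mset xs) = M}
      = {xs. (size M = k \<and> (\<forall>x\<in>#M. \<not> is_X x) \<and> y_squarefree M) \<and> xs = sorted_list_of_multiset ?N}"
  proof -
    have "distinct xs \<longleftrightarrow> y_squarefree M" if "image_mset Y (mset xs) = M" for xs
    proof -
      have "count M (Y i) = count (mset xs) i" for i
        unfolding that[symmetric] by (induction xs) auto
      then show ?thesis unfolding y_squarefree_def distinct_count_atmost_1 by (auto simp: le_Suc_eq count_eq_zero_iff)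
    qed
    then have "{xs. length xs = k \<and> sorted_wrt (<) xs \<and> image_mset Y (mset xs) = M}
        = {xs. length xs = k \<and> sorted xs \<and> y_squarefree M \<and> image_mset Y (mset xs) = M}"
      by (auto simp: strict_sorted_iff)
    then show ?thesis
      unfolding Y_eq image_mset_mk_var_eq_iff sorted_mset_eq_iff[symmetric]
      by (auto dest: arg_cong[where f = size])
  qed
  finally show ?thesis by simp
qed

lemma schur_row_column_coeff:
  "mcoeff (schur X [k] * schur Y (replicate j 1)) M
    = of_bool (size (filter_mset is_X M) = k \<and> size (filter_mset (\<lambda>x. \<not> is_X x) M) = j \<and> y_squarefree M)"
proof -
  let ?A = "filter_mset is_X M" and ?B = "filter_mset (\<lambda>x. \<not> is_X x) M"
  have split: "M - ?A = ?B" by (metis add_diff_cancel_left' multiset_partition)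
  have unique: "A = ?A" if "A \<subseteq># M" "\<forall>x\<in>#A. is_X x" "\<forall>x\<in>#M - A. \<not> is_X x" for A
  proof -
    have "filter_mset is_X M = filter_mset is_X A + filter_mset is_X (M - A)"
      using that(1) by (metis filter_union_mset subset_mset.add_diff_inverse)
    also have "filter_mset is_X A = A" using that(2) by (simp add: filter_mset_eq_conv)
    also have "filter_mset is_X (M - A) = {#}" using that(3) by (simp only: filter_mset_eq_mempty_iff) blast
    finally show ?thesis by simp
  qed
  have "mcoeff (schur X [k] * schur Y (replicate j 1)) M
      = (\<Sum>A\<in>{?A}. mcoeff (schur X [k]) A * mcoeff (schur Y (replicate j 1)) (M - A))"
  proof (rule mcoeff_mult_eq_sum)
    fix A assume "A \<subseteq># M" "A \<notin> {?A}"
    then show "mcoeff (schur X [k]) A * mcoeff (schur Y (replicate j 1)) (M - A) = 0"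
      using unique[of A] unfolding schur_row_coeff schur_column_coeff by auto
  qed simp
  moreover have "y_squarefree ?B \<longleftrightarrow> y_squarefree M" by (simp add: y_squarefree_def)
  ultimately show ?thesis by (simp add: schur_row_coeff schur_column_coeff[unfolded One_nat_def] split)
qed

lemma sum_schur_coeff:
  "mcoeff (\<Sum>k = 0..m. schur X [k] * schur Y (replicate (m - k) 1)) M = of_bool (size M = m \<and> y_squarefree M)"
proof -
  let ?a = "size (filter_mset is_X M)" and ?b = "size (filter_mset (\<lambda>x. \<not> is_X x) M)"
  have size: "size M = ?a + ?b" by (metis multiset_partition size_union)
  have "mcoeff (\<Sum>k = 0..m. schur X [k] * schur Y (replicate (m - k) 1)) M
      = (\<Sum>k = 0..m. if ?a = k then of_bool (?b = m - k \<and> y_squarefree M) else 0)"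
    unfolding mcoeff_sum schur_row_column_coeff by (intro sum.cong refl) auto
  also have "\<dots> = of_bool (size M = m \<and> y_squarefree M)"
    unfolding size by auto
  finally show ?thesis .
qed

lemma power_sum_coeff:
  assumes "r \<noteq> 0"
  shows "mcoeff (power_sum z r) A = (\<Sum>v | replicate_mset r v = A. of_bool (v \<in> range z))"
proof (cases "\<exists>v. A = replicate_mset r v")
  case True
  then obtain v where A_eq: "A = replicate_mset r v" by blast
  have eq_iff: "replicate_mset r u = replicate_mset r u' \<longleftrightarrow> u = u'" for u u' :: var
    using assms by (simp add: replicate_mset_eq_iff)
  then have "{u. replicate_mset r u = A} = {v}" unfolding A_eq by blast
  moreover have "mcoeff (power_sum z r) A = of_bool (v \<in> range z)"
    unfolding A_eq power_sum.rep_eq eq_iff by (auto simp: image_iff)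
  ultimately show ?thesis by simp
next
  case False
  then have "{v. replicate_mset r v = A} = {}" by blast
  moreover have "mcoeff (power_sum z r) A = 0" unfolding power_sum.rep_eq using False by auto
  ultimately show ?thesis by simp
qed

lemma
  assumes "r \<noteq> 0"
  shows p_plus_coeff: "mcoeff (p_plus r) A = (\<Sum>v | replicate_mset r v = A. 1)"
    and p_minus_coeff: "mcoeff (p_minus r) A = (\<Sum>v | replicate_mset r v = A. if is_X v then 1 else - 1)"
proof -
  have "of_bool (v \<in> range X) + of_bool (v \<in> range Y) = (1 :: complex)"
    "of_bool (v \<in> range X) - of_bool (v \<in> range Y) = (if is_X v then 1 else - 1 :: complex)" for v
    by (cases v; auto)+
  then show "mcoeff (p_plus r) A = (\<Sum>v | replicate_mset r v = A. 1)"
      "mcoeff (p_minus r) A = (\<Sum>v | replicate_mset r v = A. if is_X v then 1 else - 1)"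
    unfolding p_plus_def p_minus_def mcoeff_add mcoeff_diff power_sum_coeff[OF assms]
      sum.distrib[symmetric] sum_subtractf[symmetric] by simp_all
qed

lemma mcoeff_power_sum_mult:
  assumes r_nonzero: "r \<noteq> 0" and f_coeff: "\<And>A. mcoeff f A = (\<Sum>v | replicate_mset r v = A. \<omega> v)"
  shows "mcoeff (f * g) M = (\<Sum>v | replicate_mset r v \<subseteq># M. \<omega> v * mcoeff g (M - replicate_mset r v))"
proof -
  have eq_iff: "replicate_mset r u = replicate_mset r v \<longleftrightarrow> u = v" for u v :: 'a
    using r_nonzero by (simp add: replicate_mset_eq_iff)
  have "mcoeff (f * g) M = (\<Sum>A\<in>replicate_mset r ` {v. replicate_mset r v \<subseteq># M}. mcoeff f A * mcoeff g (M - A))"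
  proof (rule mcoeff_mult_eq_sum)
    fix A assume "A \<subseteq># M" "A \<notin> replicate_mset r ` {v. replicate_mset r v \<subseteq># M}"
    then have "{v. replicate_mset r v = A} = {}" by blast
    then show "mcoeff f A * mcoeff g (M - A) = 0" unfolding f_coeff by (simp only: sum.empty mult_zero_left)
  qed auto
  also have "\<dots> = (\<Sum>v | replicate_mset r v \<subseteq># M. mcoeff f (replicate_mset r v) * mcoeff g (M - replicate_mset r v))"
    by (subst sum.reindex) (simp_all add: inj_on_def eq_iff)
  also have "\<dots> = (\<Sum>v | replicate_mset r v \<subseteq># M. \<omega> v * mcoeff g (M - replicate_mset r v))"
    unfolding f_coeff eq_iff by simp
  finally show ?thesis .
qed

lemma mcoeff_p_plus_1_mult: "mcoeff (p_plus 1 * f) M = (\<Sum>x\<in>set_mset M. mcoeff f (M - {#x#}))"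
proof -
  have "mcoeff (p_plus 1 * f) M = (\<Sum>x | replicate_mset 1 x \<subseteq># M. 1 * mcoeff f (M - replicate_mset 1 x))"
    by (intro mcoeff_power_sum_mult p_plus_coeff) simp_all
  then show ?thesis by simp
qed

lemma sum_F_signed_arc_perms:
  assumes "n \<ge> 2"
  shows "(\<Sum>w\<in>signed_arc_perms n. F_fun n (sDes n w))
    = p_plus 1 * (\<Sum>k = 0..n - 1. schur X [k] * schur Y (replicate (n - 1 - k) 1))"
proof (rule mseries_eqI)
  fix M :: "var multiset"
  have size: "size (M - {#x#}) = n - 1 \<longleftrightarrow> size M = n" if "x \<in># M" for x
    using that assms by (cases M) (auto simp: size_Diff_singleton)
  have "mcoeff (p_plus 1 * (\<Sum>k = 0..n - 1. schur X [k] * schur Y (replicate (n - 1 - k) 1))) M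
      = (\<Sum>x\<in>set_mset M. of_bool (size M = n \<and> y_squarefree (M - {#x#})))"
    unfolding mcoeff_p_plus_1_mult sum_schur_coeff using size by (intro sum.cong) simp_all
  also have "\<dots> = of_bool (size M = n) * of_nat (card {x \<in> set_mset M. y_squarefree (M - {#x#})})"
    by (simp add: of_bool_conj sum_of_bool_eq Int_def flip: sum_distrib_left)
  finally show "mcoeff (\<Sum>w\<in>signed_arc_perms n. F_fun n (sDes n w)) M
      = mcoeff (p_plus 1 * (\<Sum>k = 0..n - 1. schur X [k] * schur Y (replicate (n - 1 - k) 1))) M"
    unfolding sum_signed_arc_perms[OF assms, of "F_fun n"] mcoeff_sum sum_F_fun_arc_coeff ..
qed

section \<open>The Frobenius characteristic\<close>

definition type_series :: "nat multiset \<times> nat multiset \<Rightarrow> var mseries" where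
  "type_series t = (\<Prod>a\<in>#fst t. p_plus a) * (\<Prod>a\<in>#snd t. p_minus a)"

lemma mcoeff_mconst_mult: "mcoeff (mconst a * f) M = a * mcoeff f M"
  by (subst mcoeff_mult_eq_sum[of "{{#}}"]) (auto simp: mconst.rep_eq)

lemma ch_eq: "ch n f = mconst (1 / of_nat (card (signed_perms n)))
    * (\<Sum>w\<in>signed_perms n. mconst (f w) * type_series (signed_cycle_type n w))"
  unfolding ch_def type_series_def card_signed_perms
  by (simp add: case_prod_unfold mult.assoc)

lemma mcoeff_ch:
  "mcoeff (ch n f) M = (\<Sum>w\<in>signed_perms n. f w * mcoeff (type_series (signed_cycle_type n w)) M)
    / of_nat (card (signed_perms n))"
  unfolding ch_eq mcoeff_mconst_mult mcoeff_sum by simp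

lemma ch_induced:
  assumes "n \<ge> 1"
  shows "ch n (induced (signed_perms (n - 1)) (signed_perms n) f) = p_plus 1 * ch (n - 1) f"
proof (rule mseries_eqI)
  fix M
  let ?G = "signed_perms n" and ?H = "signed_perms (n - 1)"
  let ?q = "\<lambda>w. mcoeff (type_series (signed_cycle_type n w)) M"
  have "?H \<subseteq> ?G" unfolding signed_perms_stabilizer[OF assms] by blast
  moreover have "class_function ?G ?q"
    using class_function_signed_cycle_type[of n] by (simp add: class_function_def)
  ultimately have "(\<Sum>w\<in>?G. induced ?H ?G f w * ?q w)
      = of_nat (card ?G) / of_nat (card ?H) * (\<Sum>h\<in>?H. f h * ?q h)"
    by (rule signed_perms.Frobenius_reciprocity)
  then have "mcoeff (ch n (induced ?H ?G f)) M
      = mcoeff (mconst (1 / of_nat (card ?H)) * (\<Sum>h\<in>?H. mconst (f h) * type_series (signed_cycle_type n h))) M"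
    unfolding mcoeff_ch mcoeff_mconst_mult mcoeff_sum by (simp add: card_signed_perms)
  also have "(\<Sum>h\<in>?H. mconst (f h) * type_series (signed_cycle_type n h))
      = p_plus 1 * (\<Sum>h\<in>?H. mconst (f h) * type_series (signed_cycle_type (n - 1) h))"
    unfolding sum_distrib_left
    by (intro sum.cong refl) (simp add: signed_cycle_type_fix_last[OF assms] type_series_def mult_ac)
  finally show "mcoeff (ch n (induced ?H ?G f)) M = mcoeff (p_plus 1 * ch (n - 1) f) M"
    unfolding ch_eq[of "n - 1"] by (simp only: mult.left_commute)
qed

section \<open>Colourings\<close>

lemma finite_replicate_mset_subset: "r \<noteq> 0 \<Longrightarrow> finite {v. replicate_mset r v \<subseteq># M}"
  by (rule finite_subset[of _ "set_mset M"]) (auto dest: mset_subset_eqD)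

lemma finite_replicate_mset_families:
  assumes "finite Q" "\<And>b. b \<in> Q \<Longrightarrow> r b \<noteq> 0"
  shows "finite {\<kappa> \<in> Q \<rightarrow>\<^sub>E UNIV. (\<Sum>b\<in>Q. replicate_mset (r b) (\<kappa> b)) = M}"
proof (rule finite_subset)
  have "\<kappa> b \<in># (\<Sum>b\<in>Q. replicate_mset (r b) (\<kappa> b))" if "b \<in> Q" for \<kappa> b
    using assms that by (auto simp: set_mset_sum intro!: bexI[of _ b])
  then show "{\<kappa> \<in> Q \<rightarrow>\<^sub>E UNIV. (\<Sum>b\<in>Q. replicate_mset (r b) (\<kappa> b)) = M} \<subseteq> Q \<rightarrow>\<^sub>E set_mset M"
    by (auto simp: PiE_iff extensional_def)
  show "finite (Q \<rightarrow>\<^sub>E set_mset M)" using assms(1) by (simp add: finite_PiE)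
qed

lemma bij_betw_replicate_mset_families_insert:
  assumes "finite Q" "b \<notin> Q"
  shows "bij_betw (\<lambda>(v, \<kappa>). \<kappa>(b := v))
    (SIGMA v:{v. replicate_mset (r b) v \<subseteq># M}.
      {\<kappa> \<in> Q \<rightarrow>\<^sub>E UNIV. (\<Sum>a\<in>Q. replicate_mset (r a) (\<kappa> a)) = M - replicate_mset (r b) v})
    {\<kappa> \<in> insert b Q \<rightarrow>\<^sub>E UNIV. (\<Sum>a\<in>insert b Q. replicate_mset (r a) (\<kappa> a)) = M}"
    (is "bij_betw ?h (Sigma ?V ?K) ?K'")
proof (rule bij_betw_byWitness[where f' = "\<lambda>\<kappa>. (\<kappa> b, \<kappa>(b := undefined))"])
  let ?rep = "\<lambda>v. replicate_mset (r b) v" and ?content = "\<lambda>Q \<kappa>. \<Sum>a\<in>Q. replicate_mset (r a) (\<kappa> a)"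
  have upd: "?content Q (\<kappa>(b := v)) = ?content Q \<kappa>" for \<kappa> v
    using assms by (auto intro!: sum.cong)
  have "\<kappa>(b := undefined) = \<kappa>" if "\<kappa> \<in> Q \<rightarrow>\<^sub>E UNIV" for \<kappa>
    using PiE_arb[OF that assms(2)] by (rule fun_upd_idem)
  then show "\<forall>p\<in>Sigma ?V ?K. (?h p b, (?h p)(b := undefined)) = p"
    by auto
  show "\<forall>\<kappa>\<in>?K'. ?h (\<kappa> b, \<kappa>(b := undefined)) = \<kappa>" by simp
  show "?h ` Sigma ?V ?K \<subseteq> ?K'"
  proof (rule image_subsetI)
    fix p assume "p \<in> Sigma ?V ?K"
    then obtain v \<kappa> where p: "p = (v, \<kappa>)" "?rep v \<subseteq># M" "\<kappa> \<in> Q \<rightarrow>\<^sub>E UNIV" "?content Q \<kappa> = M - ?rep v" by blast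
    have "\<kappa>(b := v) \<in> insert b Q \<rightarrow>\<^sub>E UNIV" using p(3) by (intro PiE_fun_upd) auto
    moreover have "?content (insert b Q) (\<kappa>(b := v)) = M"
      unfolding sum.insert[OF assms] upd p(4) using p(2) by simp
    ultimately show "?h p \<in> ?K'" unfolding p(1) prod.case mem_Collect_eq by (rule conjI)
  qed
  show "(\<lambda>\<kappa>. (\<kappa> b, \<kappa>(b := undefined))) ` ?K' \<subseteq> Sigma ?V ?K"
  proof (rule image_subsetI)
    fix \<kappa> assume \<kappa>: "\<kappa> \<in> ?K'"
    then have "M = ?rep (\<kappa> b) + ?content Q (\<kappa>(b := undefined))"
      unfolding upd sum.insert[OF assms] by (elim CollectE conjE) (rule sym)
    moreover have "\<kappa>(b := undefined) \<in> Q \<rightarrow>\<^sub>E UNIV"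
      using \<kappa> fun_upd_in_PiE[OF assms(2)] by (elim CollectE conjE)
    ultimately show "(\<kappa> b, \<kappa>(b := undefined)) \<in> Sigma ?V ?K"
      by (simp del: fun_upd_apply)
  qed
qed

lemma mcoeff_prod_power_sums:
  assumes "finite Q" "\<And>b. b \<in> Q \<Longrightarrow> r b \<noteq> 0"
    and "\<And>b A. b \<in> Q \<Longrightarrow> mcoeff (f b) A = (\<Sum>v | replicate_mset (r b) v = A. \<omega> b v)"
  shows "mcoeff (\<Prod>b\<in>Q. f b) M
    = (\<Sum>\<kappa> | \<kappa> \<in> Q \<rightarrow>\<^sub>E UNIV \<and> (\<Sum>b\<in>Q. replicate_mset (r b) (\<kappa> b)) = M. \<Prod>b\<in>Q. \<omega> b (\<kappa> b))"
  using assms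
proof (induction Q arbitrary: M rule: finite_induct)
  case empty
  have "{\<kappa>. \<kappa> \<in> {} \<rightarrow>\<^sub>E UNIV \<and> (\<Sum>b\<in>{}. replicate_mset (r b) (\<kappa> b)) = M} = (if M = {#} then {\<lambda>_. undefined} else {})"
    by auto
  then show ?case by (simp add: one_mseries.rep_eq)
next
  case (insert b Q)
  let ?rep = "\<lambda>v. replicate_mset (r b) v" and ?content = "\<lambda>Q \<kappa>. \<Sum>b\<in>Q. replicate_mset (r b) (\<kappa> b)"
  have weight: "(\<Prod>a\<in>insert b Q. \<omega> a ((\<kappa>(b := v)) a)) = \<omega> b v * (\<Prod>a\<in>Q. \<omega> a (\<kappa> a))" for \<kappa> v
    unfolding prod.insert[OF insert.hyps] using insert.hyps by (auto intro!: arg_cong2[where f = "(*)"] prod.cong)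
  have "mcoeff (\<Prod>b\<in>insert b Q. f b) M
      = (\<Sum>v | ?rep v \<subseteq># M. \<omega> b v * mcoeff (\<Prod>b\<in>Q. f b) (M - ?rep v))"
    unfolding prod.insert[OF insert.hyps] by (intro mcoeff_power_sum_mult insert.prems) auto
  also have "\<dots> = (\<Sum>v | ?rep v \<subseteq># M. \<Sum>\<kappa> | \<kappa> \<in> Q \<rightarrow>\<^sub>E UNIV \<and> ?content Q \<kappa> = M - ?rep v. \<omega> b v * (\<Prod>b\<in>Q. \<omega> b (\<kappa> b)))"
    using insert by (simp add: sum_distrib_left)
  also have "\<dots> = (\<Sum>(v, \<kappa>)\<in>(SIGMA v:{v. ?rep v \<subseteq># M}. {\<kappa> \<in> Q \<rightarrow>\<^sub>E UNIV. ?content Q \<kappa> = M - ?rep v}).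
      \<omega> b v * (\<Prod>b\<in>Q. \<omega> b (\<kappa> b)))"
    using insert.hyps insert.prems(1)
    by (intro sum.Sigma finite_replicate_mset_subset ballI finite_replicate_mset_families) auto
  also have "\<dots> = (\<Sum>p\<in>(SIGMA v:{v. ?rep v \<subseteq># M}. {\<kappa> \<in> Q \<rightarrow>\<^sub>E UNIV. ?content Q \<kappa> = M - ?rep v}).
      \<Prod>a\<in>insert b Q. \<omega> a ((case p of (v, \<kappa>) \<Rightarrow> \<kappa>(b := v)) a))"
    by (intro sum.cong refl) (simp only: weight split_paired_all prod.case)
  also have "\<dots> = (\<Sum>\<kappa> | \<kappa> \<in> insert b Q \<rightarrow>\<^sub>E UNIV \<and> ?content (insert b Q) \<kappa> = M. \<Prod>a\<in>insert b Q. \<omega> a (\<kappa> a))"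
    by (rule sum.reindex_bij_betw[OF bij_betw_replicate_mset_families_insert[OF insert.hyps]])
  finally show ?case .
qed

definition colourings :: "nat \<Rightarrow> var multiset \<Rightarrow> (int \<Rightarrow> var) set" where
  "colourings n M = {c \<in> {1..int n} \<rightarrow>\<^sub>E UNIV. image_mset c (mset_set {1..int n}) = M}"

definition colour_sign :: "nat \<Rightarrow> (int \<Rightarrow> var) \<Rightarrow> (int \<Rightarrow> int) \<Rightarrow> int" where
  "colour_sign n c w = (\<Prod>i\<in>{1..int n}. if is_X (c i) then 1 else sgn (w i))"

definition colour_stabilizer :: "nat \<Rightarrow> (int \<Rightarrow> var) \<Rightarrow> (int \<Rightarrow> int) set" where
  "colour_stabilizer n c = {w \<in> signed_perms n. \<forall>i\<in>{1..int n}. c (unsigned w i) = c i}"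

lemma finite_colourings: "finite (colourings n M)"
proof (rule finite_subset)
  show "colourings n M \<subseteq> {1..int n} \<rightarrow>\<^sub>E set_mset M" by (auto simp: colourings_def)
qed (intro finite_PiE; simp)

lemma colour_stabilizerD: "w \<in> colour_stabilizer n c \<Longrightarrow> w \<in> signed_perms n"
  by (simp add: colour_stabilizer_def)

lemma colour_stabilizer_eq: "w \<in> colour_stabilizer n c \<Longrightarrow> i \<in> {1..int n} \<Longrightarrow> c (unsigned w i) = c i"
  unfolding colour_stabilizer_def by blast

lemma finite_colour_stabilizer: "finite (colour_stabilizer n c)"
  using signed_perms.finite_carrier[of n] by (simp add: colour_stabilizer_def)

lemma colour_stabilizer_iff:
  assumes w: "w \<in> signed_perms n"
  shows "w \<in> colour_stabilizer n c \<longleftrightarrow> (\<forall>b\<in>abs_cycles n w. \<forall>i\<in>b. \<forall>j\<in>b. c i = c j)"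
proof
  assume stab: "w \<in> colour_stabilizer n c"
  have power: "c ((unsigned w ^^ k) i) = c i" if "i \<in> {1..int n}" for i k
    using stab that unsigned_funpow_mem[OF w that]
    by (induction k) (simp_all add: colour_stabilizer_def del: atLeastAtMost_iff)
  show "\<forall>b\<in>abs_cycles n w. \<forall>i\<in>b. \<forall>j\<in>b. c i = c j"
  proof (intro ballI)
    fix b i j assume "b \<in> abs_cycles n w" "i \<in> b" "j \<in> b"
    moreover from this obtain x where "x \<in> {1..int n}" "b = range (\<lambda>k. (unsigned w ^^ k) x)"
      unfolding abs_cycles_def orbit_eq_range[OF unsigned_permutation[OF w]] by blast
    ultimately show "c i = c j" using power by auto
  qed
next
  assume const: "\<forall>b\<in>abs_cycles n w. \<forall>i\<in>b. \<forall>j\<in>b. c i = c j"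
  have "c (unsigned w i) = c i" if "i \<in> {1..int n}" for i
    using const orbit_in_abs_cycles[OF that] self_in_abs_cycle[OF w, of i] orbit.base[of "unsigned w" i] by blast
  then show "w \<in> colour_stabilizer n c" using w by (simp add: colour_stabilizer_def)
qed

lemma bij_betw_colourings_constant_on_cycles:
  assumes w: "w \<in> signed_perms n"
  shows "bij_betw (\<lambda>\<kappa>. \<lambda>i\<in>{1..int n}. \<kappa> (orbit (unsigned w) i)) (abs_cycles n w \<rightarrow>\<^sub>E UNIV)
    {c \<in> {1..int n} \<rightarrow>\<^sub>E UNIV. w \<in> colour_stabilizer n c}"
proof (rule bij_betw_byWitness[where f' = "\<lambda>c. \<lambda>b\<in>abs_cycles n w. c (Min b)"])
  note Min_mem = Min_abs_cycle(1)[OF w] and Min_range = Min_abs_cycle(2)[OF w]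
  have "(\<lambda>b\<in>abs_cycles n w. (\<lambda>i\<in>{1..int n}. \<kappa> (orbit (unsigned w) i)) (Min b)) = \<kappa>"
    if "\<kappa> \<in> abs_cycles n w \<rightarrow>\<^sub>E UNIV" for \<kappa> :: "int set \<Rightarrow> var"
    by (rule PiE_ext[OF _ that]) (use Min_range abs_cycle_eq_orbit[OF w _ Min_mem] in auto)
  then show "\<forall>\<kappa>\<in>abs_cycles n w \<rightarrow>\<^sub>E UNIV.
      (\<lambda>b\<in>abs_cycles n w. (\<lambda>i\<in>{1..int n}. \<kappa> (orbit (unsigned w) i)) (Min b)) = (\<kappa> :: int set \<Rightarrow> var)" by blast
  show "\<forall>c\<in>{c \<in> {1..int n} \<rightarrow>\<^sub>E UNIV. w \<in> colour_stabilizer n c}.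
      (\<lambda>i\<in>{1..int n}. (\<lambda>b\<in>abs_cycles n w. c (Min b)) (orbit (unsigned w) i)) = c"
  proof safe
    fix c :: "int \<Rightarrow> var" assume c: "c \<in> {1..int n} \<rightarrow>\<^sub>E UNIV" "w \<in> colour_stabilizer n c"
    show "(\<lambda>i\<in>{1..int n}. (\<lambda>b\<in>abs_cycles n w. c (Min b)) (orbit (unsigned w) i)) = c"
    proof (rule PiE_ext[OF _ c(1)])
      fix i assume "i \<in> {1..int n}"
      note b = orbit_in_abs_cycles[OF this]
      have "c (Min (orbit (unsigned w) i)) = c i"
        using c(2) Min_mem[OF b] self_in_abs_cycle[OF w] b unfolding colour_stabilizer_iff[OF w] by blast
      then show "(\<lambda>i\<in>{1..int n}. (\<lambda>b\<in>abs_cycles n w. c (Min b)) (orbit (unsigned w) i)) i = c i"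
        using \<open>i \<in> {1..int n}\<close> b by simp
    qed simp
  qed
  show "(\<lambda>\<kappa>. \<lambda>i\<in>{1..int n}. \<kappa> (orbit (unsigned w) i)) ` (abs_cycles n w \<rightarrow>\<^sub>E UNIV)
      \<subseteq> {c \<in> {1..int n} \<rightarrow>\<^sub>E UNIV. w \<in> colour_stabilizer n c}"
  proof safe
    fix \<kappa> :: "int set \<Rightarrow> var"
    show "w \<in> colour_stabilizer n (\<lambda>i\<in>{1..int n}. \<kappa> (orbit (unsigned w) i))"
      unfolding colour_stabilizer_iff[OF w]
    proof (intro ballI)
      fix b i j assume b: "b \<in> abs_cycles n w" "i \<in> b" "j \<in> b"
      then show "(\<lambda>i\<in>{1..int n}. \<kappa> (orbit (unsigned w) i)) i = (\<lambda>i\<in>{1..int n}. \<kappa> (orbit (unsigned w) i)) j"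
        using abs_cycle_subset[OF w b(1)] abs_cycle_eq_orbit[OF w b(1)] by (simp add: subset_iff del: atLeastAtMost_iff)
    qed
  qed auto
qed (simp add: image_subset_iff)

lemma image_mset_mset_set_eq_sum: "finite A \<Longrightarrow> image_mset f (mset_set A) = (\<Sum>x\<in>A. {#f x#})"
  by (induction A rule: finite_induct) simp_all

lemma
  assumes w: "w \<in> signed_perms n"
    and c: "\<And>b i. b \<in> abs_cycles n w \<Longrightarrow> i \<in> b \<Longrightarrow> c i = \<kappa> b"
  shows content_of_constant_on_cycles:
      "image_mset c (mset_set {1..int n}) = (\<Sum>b\<in>abs_cycles n w. replicate_mset (card b) (\<kappa> b))"
    and colour_sign_of_constant_on_cycles:
      "colour_sign n c w = (\<Prod>b\<in>abs_cycles n w. if is_X (\<kappa> b) then 1 else cycle_sign w b)"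
proof -
  let ?Q = "abs_cycles n w"
  have fin: "\<forall>b\<in>?Q. finite b" using finite_abs_cycle[OF w] by blast
  have disj: "\<forall>b\<in>?Q. \<forall>b'\<in>?Q. b \<noteq> b' \<longrightarrow> b \<inter> b' = {}" using abs_cycles_disjoint[OF w] by blast
  have "image_mset c (mset_set {1..int n}) = (\<Sum>b\<in>?Q. \<Sum>i\<in>b. {#c i#})"
    using sum.Union_disjoint[OF fin disj, of "\<lambda>i. {#c i#}"]
    by (simp add: image_mset_mset_set_eq_sum Union_abs_cycles[OF w])
  also have "\<dots> = (\<Sum>b\<in>?Q. replicate_mset (card b) (\<kappa> b))"
  proof (rule sum.cong[OF refl])
    fix b assume b: "b \<in> ?Q"
    have "(\<Sum>i\<in>b. {#c i#}) = image_mset (\<lambda>_. \<kappa> b) (mset_set b)"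
      using c[OF b] finite_abs_cycle[OF w b] by (simp add: image_mset_mset_set_eq_sum)
    then show "(\<Sum>i\<in>b. {#c i#}) = replicate_mset (card b) (\<kappa> b)" by (simp add: image_mset_const_eq)
  qed
  finally show "image_mset c (mset_set {1..int n}) = \<dots>" .
  have "colour_sign n c w = (\<Prod>b\<in>?Q. \<Prod>i\<in>b. if is_X (c i) then 1 else sgn (w i))"
    using prod.Union_disjoint[OF fin disj, of "\<lambda>i. if is_X (c i) then 1 else sgn (w i)"]
    by (simp add: colour_sign_def Union_abs_cycles[OF w])
  also have "\<dots> = (\<Prod>b\<in>?Q. if is_X (\<kappa> b) then 1 else cycle_sign w b)"
    using c by (intro prod.cong refl) (simp add: cycle_sign_def)
  finally show "colour_sign n c w = \<dots>" .
qed

lemma mcoeff_type_series: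
  assumes w: "w \<in> signed_perms n"
  shows "mcoeff (type_series (signed_cycle_type n w)) M
    = (\<Sum>c\<in>colourings n M. if w \<in> colour_stabilizer n c then of_int (colour_sign n c w) else 0)"
proof -
  let ?Q = "abs_cycles n w" and ?colouring = "\<lambda>\<kappa>. \<lambda>i\<in>{1..int n}. \<kappa> (orbit (unsigned w) i)"
  let ?\<omega> = "\<lambda>b v. if is_X v then 1 else of_int (cycle_sign w b) :: complex"
  have factor: "mcoeff (if cycle_sign w b = 1 then p_plus (card b) else p_minus (card b)) A
      = (\<Sum>v | replicate_mset (card b) v = A. ?\<omega> b v)" if "b \<in> ?Q" for b A
  proof -
    have "card b \<noteq> 0" using finite_abs_cycle[OF w that] abs_cycle_nonempty[OF that] by simp
    then show ?thesis
      by (cases rule: cycle_sign_cases[OF w that]) (simp_all add: p_plus_coeff p_minus_coeff if_distrib[of of_int] cong: if_cong)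
  qed
  have constant_on_cycles: "?colouring \<kappa> i = \<kappa> b" if "b \<in> ?Q" "i \<in> b" for \<kappa> :: "int set \<Rightarrow> var" and b i
    using that subsetD[OF abs_cycle_subset[OF w that(1)] that(2)] abs_cycle_eq_orbit[OF w] by simp
  have content: "image_mset (?colouring \<kappa>) (mset_set {1..int n}) = (\<Sum>b\<in>?Q. replicate_mset (card b) (\<kappa> b))"
    for \<kappa> :: "int set \<Rightarrow> var"
    by (rule content_of_constant_on_cycles[OF w]) (rule constant_on_cycles)
  have "colour_sign n (?colouring \<kappa>) w = (\<Prod>b\<in>?Q. if is_X (\<kappa> b) then 1 else cycle_sign w b)" for \<kappa>
    by (rule colour_sign_of_constant_on_cycles[OF w]) (rule constant_on_cycles)
  then have sign: "of_int (colour_sign n (?colouring \<kappa>) w) = (\<Prod>b\<in>?Q. ?\<omega> b (\<kappa> b))" for \<kappa>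
    by (simp add: if_distrib[of of_int] cong: if_cong)
  have "type_series (signed_cycle_type n w) = (\<Prod>b\<in>?Q. if cycle_sign w b = 1 then p_plus (card b) else p_minus (card b))"
    unfolding type_series_def prod_abs_cycles_eq_prod_type[OF w] ..
  also have "mcoeff \<dots> M = (\<Sum>\<kappa> | \<kappa> \<in> ?Q \<rightarrow>\<^sub>E UNIV \<and> (\<Sum>b\<in>?Q. replicate_mset (card b) (\<kappa> b)) = M. \<Prod>b\<in>?Q. ?\<omega> b (\<kappa> b))"
    using finite_abs_cycles factor finite_abs_cycle[OF w] abs_cycle_nonempty by (intro mcoeff_prod_power_sums) auto
  also have "\<dots> = (\<Sum>\<kappa> | \<kappa> \<in> ?Q \<rightarrow>\<^sub>E UNIV \<and> ?colouring \<kappa> \<in> colourings n M. of_int (colour_sign n (?colouring \<kappa>) w))"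
    unfolding sign colourings_def mem_Collect_eq content by simp
  also have "\<dots> = (\<Sum>c | c \<in> colourings n M \<and> w \<in> colour_stabilizer n c. of_int (colour_sign n c w))"
  proof (rule sum.reindex_bij_betw)
    show "bij_betw ?colouring {\<kappa>. \<kappa> \<in> ?Q \<rightarrow>\<^sub>E UNIV \<and> ?colouring \<kappa> \<in> colourings n M}
        {c. c \<in> colourings n M \<and> w \<in> colour_stabilizer n c}"
      using bij_betw_Collect[OF bij_betw_colourings_constant_on_cycles[OF w] refl, of "\<lambda>c. c \<in> colourings n M"]
      by (simp add: colourings_def conj_ac)
  qed
  finally show ?thesis by (simp add: sum.inter_filter[OF finite_colourings])
qed

lemma mcoeff_ch_colourings:
  "mcoeff (ch n f) M = (\<Sum>c\<in>colourings n M. \<Sum>w\<in>colour_stabilizer n c. f w * of_int (colour_sign n c w))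
    / of_nat (card (signed_perms n))"
proof -
  let ?G = "signed_perms n" and ?t = "\<lambda>c w. f w * of_int (colour_sign n c w)"
  have "(\<Sum>w\<in>?G. f w * mcoeff (type_series (signed_cycle_type n w)) M)
      = (\<Sum>w\<in>?G. \<Sum>c\<in>colourings n M. if w \<in> colour_stabilizer n c then ?t c w else 0)"
    by (simp add: mcoeff_type_series sum_distrib_left if_distrib cong: if_cong)
  also have "\<dots> = (\<Sum>c\<in>colourings n M. \<Sum>w\<in>?G. if w \<in> colour_stabilizer n c then ?t c w else 0)"
    by (rule sum.swap)
  also have "\<dots> = (\<Sum>c\<in>colourings n M. \<Sum>w\<in>colour_stabilizer n c. ?t c w)"
    by (intro sum.cong refl sum.mono_neutral_cong_right)
      (auto simp: signed_perms.finite_carrier dest: colour_stabilizerD)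
  finally show ?thesis unfolding mcoeff_ch by (simp only:)
qed

section \<open>The exterior powers\<close>

definition sign_flip :: "nat \<Rightarrow> int \<Rightarrow> int \<Rightarrow> int" where
  "sign_flip n k = odd_extension n (\<lambda>i. if i = k then - i else i)"

lemma sign_flip_mem: "sign_flip n k \<in> signed_perms n"
  unfolding sign_flip_def
proof (rule odd_extension_signed_perm)
  show "inj_on (\<lambda>i. \<bar>if i = k then - i else i\<bar>) {1..int n}"
    by (rule inj_onI) (auto split: if_splits)
qed auto

lemma sign_flip_eq: "i \<in> {1..int n} \<Longrightarrow> sign_flip n k i = (if i = k then - i else i)"
  unfolding sign_flip_def by (rule odd_extension_eq)

lemma unsigned_sign_flip: "unsigned (sign_flip n k) = id"
  by (rule signed_perms_eqI[OF unsigned_signed_perm[OF sign_flip_mem] signed_perms.id_mem])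
    (simp add: unsigned_eq_abs sign_flip_eq)

lemma prod_sgn_sign_flip:
  assumes "I \<subseteq> {1..int n}"
  shows "(\<Prod>i\<in>I. sgn (sign_flip n k i)) = (if k \<in> I then - 1 else 1)"
proof -
  have "(\<Prod>i\<in>I. sgn (sign_flip n k i)) = (\<Prod>i\<in>I. if i = k then - 1 else 1)"
    using assms by (intro prod.cong refl) (auto simp: sign_flip_eq subset_iff)
  then show ?thesis using finite_subset[OF assms] by simp
qed

lemma ext_sign_sign_flip:
  assumes "I \<subseteq> {1..int n}"
  shows "ext_sign (sign_flip n k) I = (if k \<in> I then - 1 else 1)"
  using prod_sgn_sign_flip[OF assms] finite_subset[OF assms]
  by (simp add: ext_sign_def unsigned_sign_flip inv_sign_id)

definition y_positions :: "nat \<Rightarrow> (int \<Rightarrow> var) \<Rightarrow> int set" where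
  "y_positions n c = {i \<in> {1..int n}. \<not> is_X (c i)}"

lemma y_positions_subset: "y_positions n c \<subseteq> {1..int n}"
  by (auto simp: y_positions_def)

lemma finite_y_positions: "finite (y_positions n c)"
  by (rule finite_subset[OF y_positions_subset]) simp

lemma colour_sign_eq_prod: "colour_sign n c w = (\<Prod>i\<in>y_positions n c. sgn (w i))"
  unfolding colour_sign_def y_positions_def by (subst prod.inter_filter) (auto intro!: prod.cong)

lemma colour_sign_sign_flip:
  assumes "k \<in> {1..int n}"
  shows "colour_sign n c (sign_flip n k) = (if is_X (c k) then 1 else - 1)"
  unfolding colour_sign_eq_prod prod_sgn_sign_flip[OF y_positions_subset]
  using assms by (simp add: y_positions_def)

lemma sign_flip_mem_colour_stabilizer: "sign_flip n k \<in> colour_stabilizer n c"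
  by (simp add: colour_stabilizer_def sign_flip_mem unsigned_sign_flip)

lemma colour_stabilizer_comp:
  assumes "u \<in> colour_stabilizer n c" "v \<in> colour_stabilizer n c"
  shows "u \<circ> v \<in> colour_stabilizer n c"
proof -
  note mem = colour_stabilizerD[OF assms(1)] colour_stabilizerD[OF assms(2)]
  have "c (unsigned (u \<circ> v) i) = c i" if "i \<in> {1..int n}" for i
    using assms that unsigned_mem[OF mem(2) that] unfolding unsigned_comp[OF mem] colour_stabilizer_def by simp
  then show ?thesis using signed_perms.comp_mem[OF mem] by (simp add: colour_stabilizer_def)
qed

lemma colour_sign_comp:
  assumes u: "u \<in> signed_perms n" and v: "v \<in> signed_perms n"
    and transport: "\<And>i. i \<in> {1..int n} \<Longrightarrow> c (unsigned v i) = c' i"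
  shows "colour_sign n c' (u \<circ> v) = colour_sign n c u * colour_sign n c' v"
proof -
  have "sgn (u (v i)) = sgn (u (unsigned v i)) * sgn (v i)" if "i \<in> {1..int n}" for i
    using signed_perms_sgn_mult[OF u, of "v i" "unsigned v i"] signed_perms_sgn_unsigned[of i v] that
    by (simp add: sgn_mult)
  then have "colour_sign n c' (u \<circ> v)
      = (\<Prod>i\<in>{1..int n}. if is_X (c (unsigned v i)) then 1 else sgn (u (unsigned v i))) * colour_sign n c' v"
    unfolding colour_sign_def prod.distrib[symmetric] using transport by (intro prod.cong refl) simp
  also have "(\<Prod>i\<in>{1..int n}. if is_X (c (unsigned v i)) then 1 else sgn (u (unsigned v i))) = colour_sign n c u"
    unfolding colour_sign_def by (rule prod.reindex_bij_betw[OF bij_betw_unsigned[OF v]])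
  finally show ?thesis .
qed

lemma sum_eq_0_of_sign_reversing:
  fixes t :: "'a \<Rightarrow> int"
  assumes "finite S" "inj_on \<phi> S" "\<And>x. x \<in> S \<Longrightarrow> \<phi> x \<in> S" "\<And>x. x \<in> S \<Longrightarrow> t (\<phi> x) = - t x"
  shows "sum t S = 0"
proof -
  have "\<phi> ` S = S" using assms(1-3) by (intro endo_inj_surj) auto
  then have "sum t S = (\<Sum>x\<in>S. t (\<phi> x))" using sum.reindex[OF assms(2), of t] by simp
  also have "\<dots> = - sum t S" using assms(4) by (simp add: sum_negf)
  finally show ?thesis by simp
qed

text \<open>The summand below is a character of the group over which the sum extends.\<close>

lemma sum_stabilizer_ext_sign_eq_0:
  assumes I: "I \<subseteq> {1..int n}" and T: "T \<in> colour_stabilizer n c" "unsigned T ` I = I"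
    and odd: "ext_sign T I * colour_sign n c T = - 1"
  shows "(\<Sum>w\<in>{w \<in> colour_stabilizer n c. unsigned w ` I = I}. ext_sign w I * colour_sign n c w) = 0"
proof (rule sum_eq_0_of_sign_reversing[where \<phi> = "\<lambda>w. w \<circ> T"])
  note T_mem = colour_stabilizerD[OF T(1)]
  show "inj_on (\<lambda>w. w \<circ> T) {w \<in> colour_stabilizer n c. unsigned w ` I = I}"
  proof (rule inj_onI)
    fix u v assume "u \<circ> T = v \<circ> T"
    then have "u \<circ> (T \<circ> inv T) = v \<circ> (T \<circ> inv T)" by (simp only: comp_assoc[symmetric])
    then show "u = v" by (simp add: signed_perms.comp_inv[OF T_mem])
  qed
  fix w assume "w \<in> {w \<in> colour_stabilizer n c. unsigned w ` I = I}"
  then have w: "w \<in> colour_stabilizer n c" "unsigned w ` I = I" by auto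
  note w_mem = colour_stabilizerD[OF w(1)]
  show "w \<circ> T \<in> {w \<in> colour_stabilizer n c. unsigned w ` I = I}"
    using colour_stabilizer_comp[OF w(1) T(1)] w(2) T(2)
    by (simp add: unsigned_comp[OF w_mem T_mem] flip: image_image image_comp)
  have "ext_sign (w \<circ> T) I * colour_sign n c (w \<circ> T)
      = (ext_sign w I * colour_sign n c w) * (ext_sign T I * colour_sign n c T)"
    using colour_sign_comp[where c = c and c' = c, OF w_mem T_mem colour_stabilizer_eq[OF T(1)]]
    by (simp add: ext_sign_comp[OF w_mem T_mem I] T(2))
  then show "ext_sign (w \<circ> T) I * colour_sign n c (w \<circ> T) = - (ext_sign w I * colour_sign n c w)"
    unfolding odd by simp
qed (simp add: finite_colour_stabilizer)

lemma ext_sign_colour_sign_transposition: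
  assumes pq: "p \<in> I" "q \<in> I" "p \<noteq> q" "c p = c q" and I: "I \<subseteq> {1..int n}"
  defines "T \<equiv> odd_extension n (transpose p q)"
  shows "T \<in> colour_stabilizer n c" "unsigned T ` I = I" "ext_sign T I * colour_sign n c T = - 1"
proof -
  have p: "p \<in> {1..int n}" and q: "q \<in> {1..int n}" using pq I by blast+
  have T_mem: "T \<in> signed_perms n"
    unfolding T_def by (rule odd_extension_permutes[OF permutes_swap_id[OF p q]])
  have T_eq: "T i = transpose p q i" if "i \<in> {1..int n}" for i
    unfolding T_def by (rule odd_extension_eq[OF that])
  have T_pos: "T i > 0" and unsigned_T: "unsigned T i = transpose p q i" if "i \<in> {1..int n}" for i
    using T_eq[OF that] that p q by (auto simp: unsigned_eq_abs transpose_def)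
  show "T \<in> colour_stabilizer n c"
    using T_mem unsigned_T pq(4) by (auto simp: colour_stabilizer_def transpose_def)
  have "unsigned T ` I = transpose p q ` I" using unsigned_T I by (intro image_cong) auto
  also have "\<dots> = I" using pq by (simp add: transpose_image_eq)
  finally show "unsigned T ` I = I" .
  have "inv_sign (unsigned T) I = inv_sign (transpose p q) I"
    using unsigned_T I by (intro inv_sign_cong) blast
  also have "\<dots> = - 1" using pq finite_subset[OF I] by (intro inv_sign_transpose) auto
  finally have "ext_sign T I = - 1" using T_pos I by (simp add: ext_sign_def subset_iff)
  moreover have "colour_sign n c T = 1" using T_pos by (simp add: colour_sign_def prod.neutral)
  ultimately show "ext_sign T I * colour_sign n c T = - 1" by simp
qed

lemma ext_sign_mult_colour_sign_eq_1:
  assumes inj: "inj_on c (y_positions n c)" and w: "w \<in> colour_stabilizer n c"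
  shows "unsigned w ` y_positions n c = y_positions n c" "ext_sign w (y_positions n c) * colour_sign n c w = 1"
proof -
  note w_mem = colour_stabilizerD[OF w]
  have fixed: "unsigned w i = i" if i: "i \<in> y_positions n c" for i
  proof -
    have "i \<in> {1..int n}" using i y_positions_subset by blast
    then have "c (unsigned w i) = c i" "unsigned w i \<in> {1..int n}"
      using w unsigned_mem[OF w_mem] unfolding colour_stabilizer_def by blast+
    then show ?thesis using i by (intro inj_onD[OF inj]) (simp_all add: y_positions_def)
  qed
  then show "unsigned w ` y_positions n c = y_positions n c" by simp
  have "ext_sign w (y_positions n c) = (\<Prod>i\<in>y_positions n c. sgn (w i))"
    using inv_sign_id[OF finite_y_positions, of n c "unsigned w"] fixed by (simp add: ext_sign_def)
  then have "ext_sign w (y_positions n c) * colour_sign n c w = (\<Prod>i\<in>y_positions n c. sgn (w i) * sgn (w i))"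
    by (simp only: colour_sign_eq_prod prod.distrib)
  also have "\<dots> = 1"
  proof (intro prod.neutral ballI)
    fix i assume "i \<in> y_positions n c"
    then have "w i \<noteq> 0" using signed_perms_eq_0_iff[OF w_mem, of i] by (simp add: y_positions_def)
    then show "sgn (w i) * sgn (w i) = 1" by (rule sgn_mult_self)
  qed
  finally show "ext_sign w (y_positions n c) * colour_sign n c w = 1" .
qed

lemma sum_stabilizer_ext_sign:
  assumes I: "I \<subseteq> {1..int n}"
  shows "(\<Sum>w\<in>{w \<in> colour_stabilizer n c. unsigned w ` I = I}. ext_sign w I * colour_sign n c w)
    = (if I = y_positions n c \<and> inj_on c I then int (card (colour_stabilizer n c)) else 0)"
proof -
  consider (flip) k where "k \<in> {1..int n}" "k \<in> I \<longleftrightarrow> is_X (c k)"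
    | (swap) p q where "p \<in> I" "q \<in> I" "p \<noteq> q" "c p = c q" | (fixed) "I = y_positions n c" "inj_on c I"
    using I unfolding inj_on_def y_positions_def by blast
  then show ?thesis
  proof cases
    case flip
    then have "ext_sign (sign_flip n k) I * colour_sign n c (sign_flip n k) = - 1"
      by (simp add: ext_sign_sign_flip[OF I] colour_sign_sign_flip)
    then have "(\<Sum>w\<in>{w \<in> colour_stabilizer n c. unsigned w ` I = I}. ext_sign w I * colour_sign n c w) = 0"
      by (intro sum_stabilizer_ext_sign_eq_0[OF I sign_flip_mem_colour_stabilizer]) (simp_all add: unsigned_sign_flip)
    moreover have "I \<noteq> y_positions n c" using flip by (auto simp: y_positions_def)
    ultimately show ?thesis by simp
  next
    case swap
    note T = ext_sign_colour_sign_transposition[OF swap I]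
    have "\<not> inj_on c I" using swap by (auto simp: inj_on_def)
    then show ?thesis using sum_stabilizer_ext_sign_eq_0[OF I T] by simp
  next
    case fixed
    then have "{w \<in> colour_stabilizer n c. unsigned w ` I = I} = colour_stabilizer n c"
      using ext_sign_mult_colour_sign_eq_1(1)[of c n] by blast
    then show ?thesis using fixed ext_sign_mult_colour_sign_eq_1(2)[of c n] by simp
  qed
qed

definition ext_power_char :: "nat \<Rightarrow> nat \<Rightarrow> (int \<Rightarrow> int) \<Rightarrow> complex" where
  "ext_power_char m j w = (if w \<in> signed_perms m
     then of_int (\<Sum>I | I \<subseteq> {1..int m} \<and> card I = j \<and> unsigned w ` I = I. ext_sign w I) else 0)"

lemma sum_stabilizer_ext_power_char:
  "(\<Sum>w\<in>colour_stabilizer m c. ext_power_char m j w * of_int (colour_sign m c w))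
    = (if card (y_positions m c) = j \<and> inj_on c (y_positions m c) then of_nat (card (colour_stabilizer m c)) else 0)"
proof -
  let ?S = "colour_stabilizer m c" and ?J = "{I. I \<subseteq> {1..int m} \<and> card I = j}"
  let ?t = "\<lambda>w I. ext_sign w I * colour_sign m c w"
  have fin: "finite ?J" by (rule finite_subset[of _ "Pow {1..int m}"]) auto
  have filter: "{I. I \<subseteq> {1..int m} \<and> card I = j \<and> unsigned w ` I = I} = {I \<in> ?J. unsigned w ` I = I}" for w by blast
  have "(\<Sum>w\<in>?S. ext_power_char m j w * of_int (colour_sign m c w))
      = of_int (\<Sum>w\<in>?S. \<Sum>I\<in>{I \<in> ?J. unsigned w ` I = I}. ?t w I)"
    unfolding of_int_sum[of _ ?S] ext_power_char_def filter
    by (intro sum.cong refl) (simp add: colour_stabilizerD sum_distrib_right)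
  also have "(\<Sum>w\<in>?S. \<Sum>I\<in>{I \<in> ?J. unsigned w ` I = I}. ?t w I)
      = (\<Sum>I\<in>?J. \<Sum>w\<in>{w \<in> ?S. unsigned w ` I = I}. ?t w I)"
    using finite_colour_stabilizer fin by (rule sum.swap_restrict)
  also have "\<dots> = (\<Sum>I\<in>?J. if I = y_positions m c then if inj_on c I then int (card ?S) else 0 else 0)"
    by (intro sum.cong refl) (simp add: sum_stabilizer_ext_sign)
  also have "\<dots> = (if card (y_positions m c) = j \<and> inj_on c (y_positions m c) then int (card ?S) else 0)"
    using fin y_positions_subset[of m c] by auto
  finally show ?thesis by simp
qed

lemma colour_transport:
  assumes "c \<in> colourings n M" "c' \<in> colourings n M"
  obtains u where "u \<in> signed_perms n" "\<And>i. i \<in> {1..int n} \<Longrightarrow> c (unsigned u i) = c' i"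
proof -
  have "image_mset c' (mset_set {1..int n}) = image_mset c (mset_set {1..int n})"
    using assms by (simp add: colourings_def)
  then obtain p where p: "p permutes {1..int n}" "\<forall>i\<in>{1..int n}. c' i = c (p i)"
    using image_mset_eq_implies_permutes[of "{1..int n}" c' c] by auto
  have "c (unsigned (odd_extension n p) i) = c' i" if "i \<in> {1..int n}" for i
    using that p(2) permutes_in_image[OF p(1), of i] by (simp add: unsigned_eq_abs odd_extension_eq)
  then show ?thesis using that odd_extension_permutes[OF p(1)] by blast
qed

lemma colourings_translate:
  assumes "c \<in> colourings n M" "w \<in> signed_perms n"
  shows "(\<lambda>i\<in>{1..int n}. c (unsigned w i)) \<in> colourings n M"
proof -
  have "image_mset (\<lambda>i\<in>{1..int n}. c (unsigned w i)) (mset_set {1..int n})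
      = image_mset (\<lambda>i. c (unsigned w i)) (mset_set {1..int n})"
    by (rule image_mset_cong) simp
  also have "\<dots> = image_mset c (image_mset (unsigned w) (mset_set {1..int n}))"
    by (simp add: image_mset.compositionality comp_def)
  also have "image_mset (unsigned w) (mset_set {1..int n}) = mset_set {1..int n}"
    using bij_betw_unsigned[OF assms(2)] by (simp add: image_mset_mset_set bij_betw_def)
  finally have "image_mset (\<lambda>i\<in>{1..int n}. c (unsigned w i)) (mset_set {1..int n}) = M"
    using assms(1) unfolding colourings_def by blast
  moreover have "(\<lambda>i\<in>{1..int n}. c (unsigned w i)) \<in> {1..int n} \<rightarrow>\<^sub>E UNIV" by simp
  ultimately show ?thesis unfolding colourings_def by blast
qed

text \<open>The group acts transitively on the colourings with given content.\<close>

lemma sum_card_colour_stabilizer: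
  assumes c: "c \<in> colourings n M"
  shows "(\<Sum>c'\<in>colourings n M. card (colour_stabilizer n c')) = card (signed_perms n)"
proof -
  let ?G = "signed_perms n" and ?translate = "\<lambda>w. \<lambda>i\<in>{1..int n}. c (unsigned w i)"
  have "card {w \<in> ?G. ?translate w = c'} = card (colour_stabilizer n c')" if c': "c' \<in> colourings n M" for c'
  proof -
    obtain u where u: "u \<in> ?G" "\<And>i. i \<in> {1..int n} \<Longrightarrow> c (unsigned u i) = c' i"
      by (rule colour_transport[OF c c']) blast
    have ext: "c' \<in> extensional {1..int n}" using c' by (auto simp: colourings_def PiE_def)
    have "?translate (u \<circ> w) = c' \<longleftrightarrow> w \<in> colour_stabilizer n c'" if "w \<in> ?G" for w
    proof -
      have "?translate (u \<circ> w) = (\<lambda>i\<in>{1..int n}. c' (unsigned w i))"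
        using unsigned_mem[OF that] u(2) by (intro restrict_ext) (simp add: unsigned_comp[OF u(1) that])
      moreover have "(\<lambda>i\<in>{1..int n}. c' (unsigned w i)) = c' \<longleftrightarrow> w \<in> colour_stabilizer n c'"
        using that ext by (auto simp: colour_stabilizer_def fun_eq_iff extensional_def)
      ultimately show ?thesis by simp
    qed
    then have "{w \<in> ?G. ?translate (u \<circ> w) = c'} = colour_stabilizer n c'" by (auto dest: colour_stabilizerD)
    then show ?thesis using signed_perms.card_translate[OF u(1), of "\<lambda>w. ?translate w = c'"] by simp
  qed
  then have "(\<Sum>c'\<in>colourings n M. card (colour_stabilizer n c'))
      = (\<Sum>c'\<in>colourings n M. \<Sum>w | w \<in> ?G \<and> ?translate w = c'. 1)"
    by simp
  also have "\<dots> = (\<Sum>w\<in>?G. 1)"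
    using colourings_translate[OF c] by (intro sum.group finite_colourings signed_perms.finite_carrier) auto
  finally show ?thesis by simp
qed

lemma y_squarefree_image_mset_iff:
  "finite A \<Longrightarrow> y_squarefree (image_mset c (mset_set A)) \<longleftrightarrow> inj_on c {i \<in> A. \<not> is_X (c i)}"
proof (induction A rule: finite_induct)
  case (insert a A)
  have "{i \<in> insert a A. \<not> is_X (c i)} = (if is_X (c a) then {} else {a}) \<union> {i \<in> A. \<not> is_X (c i)}" by auto
  then show ?case using insert by (auto simp: y_squarefree_add_mset)
qed (simp add: y_squarefree_empty)

lemma colourings_nonempty_iff: "colourings n M \<noteq> {} \<longleftrightarrow> size M = n"
proof
  assume "size M = n"
  then obtain xs where xs: "mset xs = M" "length xs = n" by (metis ex_mset size_mset)
  let ?g = "\<lambda>j. int j + 1"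
  have "x \<in> ?g ` {..<n}" if "x \<in> {1..int n}" for x
    using that by (intro image_eqI[of _ _ "nat (x - 1)"]) auto
  then have range: "{1..int n} = ?g ` {..<n}" by auto
  have inj: "inj_on ?g {..<n}" by (simp add: inj_on_def)
  have "xs \<in> (\<lambda>c. map (\<lambda>j. c (?g j)) [0..<n]) ` (?g ` {..<n} \<rightarrow>\<^sub>E UNIV)"
    unfolding bij_betw_imp_surj_on[OF bij_betw_PiE_lists[OF inj]] using xs(2) by simp
  then obtain c where "xs = map (\<lambda>j. c (?g j)) [0..<n]" "c \<in> ?g ` {..<n} \<rightarrow>\<^sub>E UNIV" by (rule imageE)
  then have "c \<in> colourings n M"
    unfolding colourings_def range mset_map_enumeration[OF inj] using xs(1) by simp
  then show "colourings n M \<noteq> {}" by blast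
qed (auto simp: colourings_def)

lemma ch_ext_power_char:
  assumes "k + j = m"
  shows "ch m (ext_power_char m j) = schur X [k] * schur Y (replicate j 1)"
proof (rule mseries_eqI)
  fix M
  let ?C = "colourings m M" and ?stab = "\<lambda>c. of_nat (card (colour_stabilizer m c)) :: complex"
  let ?Q = "size (filter_mset (\<lambda>x. \<not> is_X x) M) = j \<and> y_squarefree M"
  have Q_iff: "card (y_positions m c) = j \<and> inj_on c (y_positions m c) \<longleftrightarrow> ?Q"
    if "c \<in> ?C" for c
  proof -
    have M_eq: "M = image_mset c (mset_set {1..int m})" using that by (simp add: colourings_def)
    show ?thesis unfolding M_eq y_positions_def by (simp add: y_squarefree_image_mset_iff filter_mset_image_mset)
  qed
  have "(\<Sum>c\<in>?C. ?stab c) = of_bool (size M = m) * of_nat (card (signed_perms m))"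
  proof (cases "?C = {}")
    case False
    then show ?thesis using sum_card_colour_stabilizer colourings_nonempty_iff[of m M]
      by (auto simp flip: of_nat_sum)
  qed (use colourings_nonempty_iff[of m M] in simp)
  moreover have "mcoeff (ch m (ext_power_char m j)) M
      = (\<Sum>c\<in>?C. if ?Q then ?stab c else 0) / of_nat (card (signed_perms m))"
    unfolding mcoeff_ch_colourings sum_stabilizer_ext_power_char
    using Q_iff by (intro arg_cong2[of _ _ _ _ "(/)"] sum.cong refl) simp
  ultimately have "mcoeff (ch m (ext_power_char m j)) M = of_bool (?Q \<and> size M = m)"
    by (cases ?Q) (auto simp: card_signed_perms)
  also have "size M = size (filter_mset is_X M) + size (filter_mset (\<lambda>x. \<not> is_X x) M)"
    by (metis multiset_partition size_union)
  also have "of_bool (?Q \<and> \<dots> = m) = mcoeff (schur X [k] * schur Y (replicate j 1)) M"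
    unfolding schur_row_column_coeff using assms by auto
  finally show "mcoeff (ch m (ext_power_char m j)) M = mcoeff (schur X [k] * schur Y (replicate j 1)) M" .
qed

section \<open>Conjugacy of signed permutations with the same cycles\<close>

definition cycle_letter :: "(int \<Rightarrow> int) \<Rightarrow> int set \<Rightarrow> int \<Rightarrow> nat \<Rightarrow> int" where
  "cycle_letter w b s k = s * (w ^^ k) (Min b)"

lemma cycle_letter_uminus: "cycle_letter w b (- s) k = - cycle_letter w b s k"
  by (simp add: cycle_letter_def)

lemma cycle_letter_Suc:
  assumes "w \<in> signed_perms n" "\<bar>s\<bar> = 1"
  shows "cycle_letter w b s (Suc k) = w (cycle_letter w b s k)"
proof -
  have "s = sgn s" using assms(2) by (auto simp: abs_if sgn_if split: if_splits)
  then show ?thesis using signed_perms_sgn_mult[OF assms(1), of s] by (simp add: cycle_letter_def)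
qed

lemma abs_cycle_letter:
  assumes w: "w \<in> signed_perms n" "b \<in> abs_cycles n w" "\<bar>s\<bar> = 1"
  shows "\<bar>cycle_letter w b s k\<bar> = (unsigned w ^^ k) (Min b)"
  using abs_funpow[OF w(1), of "Min b" k] Min_abs_cycle(2)[OF w(1,2)] w(3)
  by (simp add: cycle_letter_def abs_mult)

lemma cycle_letter_mem:
  assumes "w \<in> signed_perms n" "b \<in> abs_cycles n w" "\<bar>s\<bar> = 1"
  shows "cycle_letter w b s k \<in> signed_letters n"
  using unsigned_funpow_mem[OF assms(1) Min_abs_cycle(2)[OF assms(1,2)], of k]
  by (simp only: mem_signed_letters_iff abs_cycle_letter[OF assms])

lemma orbit_abs_cycle_letter:
  assumes w: "w \<in> signed_perms n" "b \<in> abs_cycles n w" "\<bar>s\<bar> = 1"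
  shows "orbit (unsigned w) \<bar>cycle_letter w b s k\<bar> = b"
proof -
  have "(unsigned w ^^ k) (Min b) \<in> orbit (unsigned w) (Min b)"
    by (simp add: orbit_eq_range[OF unsigned_permutation[OF w(1)]])
  then show ?thesis
    using abs_cycle_eq_orbit[OF w(1,2)] Min_abs_cycle(1)[OF w(1,2)] by (simp add: abs_cycle_letter[OF w])
qed

lemma cycle_letter_cases:
  assumes w: "w \<in> signed_perms n" and y: "y \<in> signed_letters n"
  obtains b s k where "b \<in> abs_cycles n w" "\<bar>s\<bar> = 1" "y = cycle_letter w b s k"
proof -
  define b where "b = orbit (unsigned w) \<bar>y\<bar>"
  have b: "b \<in> abs_cycles n w"
    using y unfolding b_def mem_signed_letters_iff by (rule orbit_in_abs_cycles)
  have "\<bar>y\<bar> \<in> orbit (unsigned w) (Min b)"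
    using abs_cycle_eq_orbit[OF w b Min_abs_cycle(1)[OF w b]] self_in_abs_cycle[OF w] by (simp add: b_def)
  then obtain k where abs_y: "\<bar>y\<bar> = (unsigned w ^^ k) (Min b)"
    unfolding orbit_eq_range[OF unsigned_permutation[OF w]] by blast
  also have "\<dots> = \<bar>cycle_letter w b 1 k\<bar>" using abs_cycle_letter[OF w b, of 1 k] by simp
  finally have "y = cycle_letter w b 1 k \<or> y = cycle_letter w b (- 1) k"
    by (auto simp: abs_eq_iff cycle_letter_uminus)
  then show ?thesis using that[OF b, of 1 k] that[OF b, of "- 1" k] by auto
qed

lemma cycle_letter_eq_iff:
  assumes w: "w \<in> signed_perms n" and b: "b \<in> abs_cycles n w" and st_unit: "\<bar>s\<bar> = 1" "\<bar>t\<bar> = 1" and "k \<le> l"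
  shows "cycle_letter w b s k = cycle_letter w b t l
    \<longleftrightarrow> card b dvd l - k \<and> s * t = cycle_sign w b ^ ((l - k) div card b)"
proof -
  note power = signed_perms.funpow_mem[OF w, of k]
  have "(w ^^ l) (Min b) = (w ^^ k) ((w ^^ (l - k)) (Min b))"
    using \<open>k \<le> l\<close> by (simp flip: comp_apply[of "w ^^ k"] funpow_add)
  moreover have "s = 1 \<or> s = - 1" "t = 1 \<or> t = - 1" using st_unit by linarith+
  ultimately have "cycle_letter w b s k = cycle_letter w b t l \<longleftrightarrow> (w ^^ k) ((w ^^ (l - k)) (Min b)) = (w ^^ k) (s * t * Min b)"
    using signed_perms_uminus[OF power] by (auto simp: cycle_letter_def)
  also have "\<dots> \<longleftrightarrow> (w ^^ (l - k)) (Min b) = s * t * Min b"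
    using signed_perms_inj[OF power] by (rule inj_eq)
  also have "\<dots> \<longleftrightarrow> card b dvd l - k \<and> s * t = cycle_sign w b ^ ((l - k) div card b)"
    using funpow_eq_sign_mult_iff[OF w Min_abs_cycle(2)[OF w b], of "s * t"]
      abs_cycle_eq_orbit[OF w b Min_abs_cycle(1)[OF w b]] st_unit by (simp add: abs_mult)
  finally show ?thesis .
qed

lemma cycle_letter_eq_transfer:
  assumes w: "w \<in> signed_perms n" and v: "v \<in> signed_perms n"
    and cycles: "abs_cycles n w = abs_cycles n v"
    and sign: "\<forall>b\<in>abs_cycles n w. cycle_sign w b = cycle_sign v b"
    and b: "b \<in> abs_cycles n w" "c \<in> abs_cycles n w" and st_unit: "\<bar>s\<bar> = 1" "\<bar>t\<bar> = 1"
  shows "cycle_letter w b s k = cycle_letter w c t l \<longleftrightarrow> cycle_letter v b s k = cycle_letter v c t l"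
proof (cases "b = c")
  case True
  note eq_iff = cycle_letter_eq_iff[OF w b(1)] cycle_letter_eq_iff[OF v b(1)[unfolded cycles]]
  show ?thesis
  proof (cases k l rule: le_cases)
    case le
    show ?thesis
      unfolding True[symmetric] eq_iff(1)[OF st_unit le] eq_iff(2)[OF st_unit le] bspec[OF sign b(1)] ..
  next
    case ge
    show ?thesis
      unfolding True[symmetric] eq_commute[of "cycle_letter _ b s k"]
        eq_iff(1)[OF st_unit(2,1) ge] eq_iff(2)[OF st_unit(2,1) ge] bspec[OF sign b(1)] ..
  qed
next
  case False
  have "cycle_letter f b s k \<noteq> cycle_letter f c t l"
    if f: "f \<in> signed_perms n" "abs_cycles n f = abs_cycles n w" for f
  proof
    assume "cycle_letter f b s k = cycle_letter f c t l"
    then have "b = c"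
      using orbit_abs_cycle_letter[OF f(1) _ st_unit(1), of b k] orbit_abs_cycle_letter[OF f(1) _ st_unit(2), of c l] b f(2) by simp
    then show False using False by simp
  qed
  then show ?thesis using w v cycles by simp
qed

lemma cycle_letter_map:
  assumes w: "w \<in> signed_perms n" and v: "v \<in> signed_perms n"
    and cycles: "abs_cycles n w = abs_cycles n v"
    and sign: "\<forall>b\<in>abs_cycles n w. cycle_sign w b = cycle_sign v b"
  obtains u where "\<And>b s k. b \<in> abs_cycles n w \<Longrightarrow> \<bar>s\<bar> = 1 \<Longrightarrow> u (cycle_letter w b s k) = cycle_letter v b s k"
    "\<And>y. y \<notin> signed_letters n \<Longrightarrow> u y = y"
proof
  let ?Q = "abs_cycles n w"
  let ?matches = "\<lambda>y z. \<exists>b\<in>?Q. \<exists>s k. \<bar>s\<bar> = 1 \<and> y = cycle_letter w b s k \<and> z = cycle_letter v b s k"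
  let ?u = "\<lambda>y. if y \<in> signed_letters n then SOME z. ?matches y z else y"
  note transfer = cycle_letter_eq_transfer[OF w v cycles sign]
  fix b s k assume b: "b \<in> ?Q" "\<bar>s\<bar> = (1 :: int)"
  have "z = cycle_letter v b s k" if "?matches (cycle_letter w b s k) z" for z
  proof -
    obtain c t l where "c \<in> ?Q" "\<bar>t\<bar> = 1" "cycle_letter w b s k = cycle_letter w c t l" "z = cycle_letter v c t l"
      using \<open>?matches (cycle_letter w b s k) z\<close> by blast
    then show ?thesis using transfer[OF b(1) _ b(2), of c t k l] by simp
  qed
  then have "(SOME z. ?matches (cycle_letter w b s k) z) = cycle_letter v b s k"
    using b by (intro some_equality) blast+
  then show "?u (cycle_letter w b s k) = cycle_letter v b s k"
    by (simp only: cycle_letter_mem[OF w b] if_True)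
qed (rule if_not_P)

lemma conjugate_of_same_cycles:
  assumes w: "w \<in> signed_perms n" and v: "v \<in> signed_perms n"
    and cycles: "abs_cycles n w = abs_cycles n v"
    and sign: "\<forall>b\<in>abs_cycles n w. cycle_sign w b = cycle_sign v b"
  obtains u where "u \<in> signed_perms n" "u \<circ> w = v \<circ> u"
proof -
  obtain u where u: "\<And>b s k. b \<in> abs_cycles n w \<Longrightarrow> \<bar>s\<bar> = 1 \<Longrightarrow> u (cycle_letter w b s k) = cycle_letter v b s k"
    and outside: "\<And>y. y \<notin> signed_letters n \<Longrightarrow> u y = y"
    by (rule cycle_letter_map[OF assms]) blast
  have letters: "u y \<in> signed_letters n" "u (- y) = - u y" "u (w y) = v (u y)" if y: "y \<in> signed_letters n" for y
  proof -
    obtain b s k where b: "b \<in> abs_cycles n w" "\<bar>s\<bar> = 1" "y = cycle_letter w b s k"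
      using cycle_letter_cases[OF w y] .
    show "u y \<in> signed_letters n"
      unfolding b(3) u[OF b(1,2)] using b(1,2) cycles by (intro cycle_letter_mem[OF v]) simp_all
    show "u (- y) = - u y"
      using u[of b "- s" k] u[OF b(1,2)] b by (simp add: cycle_letter_uminus)
    show "u (w y) = v (u y)"
      unfolding b(3) cycle_letter_Suc[OF w b(2), symmetric] u[OF b(1,2)] by (rule cycle_letter_Suc[OF v b(2)])
  qed
  have "inj_on u (signed_letters n)"
  proof (rule inj_onI)
    fix y y' assume y: "y \<in> signed_letters n" "y' \<in> signed_letters n" "u y = u y'"
    obtain b s k where b: "b \<in> abs_cycles n w" "\<bar>s\<bar> = 1" "y = cycle_letter w b s k"
      using cycle_letter_cases[OF w y(1)] .
    obtain c t l where c: "c \<in> abs_cycles n w" "\<bar>t\<bar> = 1" "y' = cycle_letter w c t l"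
      using cycle_letter_cases[OF w y(2)] .
    show "y = y'"
      using y(3) unfolding b(3) c(3) u[OF b(1,2)] u[OF c(1,2)]
      by (simp only: cycle_letter_eq_transfer[OF assms b(1) c(1) b(2) c(2)])
  qed
  then have u_mem: "u \<in> signed_perms n" using letters(1,2) outside by (intro signed_permsI)
  have "u \<circ> w = v \<circ> u"
  proof (rule signed_perms_eqI)
    show "u \<circ> w \<in> signed_perms n" "v \<circ> u \<in> signed_perms n"
      using w v u_mem by (simp_all add: signed_perms.comp_mem)
  qed (use letters(3) in simp)
  then show ?thesis using that u_mem by blast
qed

section \<open>The characteristic determines a class function\<close>

lemma colour_stabilizer_conjugate_iff:
  assumes u: "u \<in> signed_perms n" and v: "v \<in> signed_perms n"
    and transport: "\<And>i. i \<in> {1..int n} \<Longrightarrow> c (unsigned u i) = c' i"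
  shows "u \<circ> v \<circ> inv u \<in> colour_stabilizer n c \<longleftrightarrow> v \<in> colour_stabilizer n c'"
proof -
  let ?g = "u \<circ> v \<circ> inv u"
  have g_mem: "?g \<in> signed_perms n" using u v by (intro signed_perms.comp_mem signed_perms.inv_mem)
  have "?g \<circ> u = u \<circ> v" using signed_perms.inv_comp[OF u] by (simp add: comp_assoc)
  then have g_u: "unsigned ?g (unsigned u i) = unsigned u (unsigned v i)" for i
    using unsigned_comp[OF g_mem u] unsigned_comp[OF u v] by (metis comp_apply)
  have "?g \<in> colour_stabilizer n c \<longleftrightarrow> (\<forall>k\<in>unsigned u ` {1..int n}. c (unsigned ?g k) = c k)"
    unfolding unsigned_image[OF u] using g_mem by (simp add: colour_stabilizer_def)
  also have "\<dots> \<longleftrightarrow> (\<forall>i\<in>{1..int n}. c' (unsigned v i) = c' i)"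
    unfolding ball_simps g_u using transport unsigned_mem[OF v] by simp
  finally show ?thesis using v by (simp add: colour_stabilizer_def)
qed

lemma colour_sign_conjugate:
  assumes u: "u \<in> signed_perms n" and v: "v \<in> colour_stabilizer n c'"
    and transport: "\<And>i. i \<in> {1..int n} \<Longrightarrow> c (unsigned u i) = c' i"
  shows "colour_sign n c (u \<circ> v \<circ> inv u) = colour_sign n c' v"
proof -
  let ?g = "u \<circ> v \<circ> inv u"
  note v_mem = colour_stabilizerD[OF v]
  have g_mem: "?g \<in> signed_perms n" using u v_mem by (intro signed_perms.comp_mem signed_perms.inv_mem)
  have "colour_sign n c ?g * colour_sign n c' u = colour_sign n c' (?g \<circ> u)"
    using colour_sign_comp[where c = c and c' = c', OF g_mem u transport] by simp
  also have "?g \<circ> u = u \<circ> v" using signed_perms.inv_comp[OF u] by (simp add: comp_assoc)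
  also have "colour_sign n c' (u \<circ> v) = colour_sign n c' u * colour_sign n c' v"
    using colour_sign_comp[where c = c' and c' = c', OF u v_mem colour_stabilizer_eq[OF v]] .
  finally have "colour_sign n c' u * colour_sign n c ?g = colour_sign n c' u * colour_sign n c' v"
    by (simp only: mult.commute)
  moreover have "colour_sign n c' u \<noteq> 0"
    using signed_perms_eq_0_iff[OF u] by (auto simp: colour_sign_def sgn_eq_0_iff)
  ultimately show ?thesis by (metis mult_left_cancel)
qed

lemma colour_sum_eq_0:
  assumes class_f: "class_function (signed_perms n) f" and ch: "ch n f = 0" and c_ext: "c \<in> {1..int n} \<rightarrow>\<^sub>E UNIV"
  shows "(\<Sum>w\<in>colour_stabilizer n c. f w * of_int (colour_sign n c w)) = 0"
proof -
  let ?G = "signed_perms n" and ?M = "image_mset c (mset_set {1..int n})"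
  let ?s = "\<lambda>c. \<Sum>w\<in>colour_stabilizer n c. f w * of_int (colour_sign n c w)"
  have mem: "c \<in> colourings n ?M" using c_ext by (simp add: colourings_def)
  have sum_if: "?s c' = (\<Sum>w\<in>?G. if w \<in> colour_stabilizer n c' then f w * of_int (colour_sign n c' w) else 0)" for c'
    by (intro sum.mono_neutral_cong_left) (auto simp: signed_perms.finite_carrier dest: colour_stabilizerD)
  have "?s c' = ?s c" if c': "c' \<in> colourings n ?M" for c'
  proof -
    obtain u where u: "u \<in> ?G" and transport: "\<And>i. i \<in> {1..int n} \<Longrightarrow> c (unsigned u i) = c' i"
      by (rule colour_transport[OF mem c']) blast
    have "?s c = (\<Sum>v\<in>?G. if u \<circ> v \<circ> inv u \<in> colour_stabilizer n c
        then f (u \<circ> v \<circ> inv u) * of_int (colour_sign n c (u \<circ> v \<circ> inv u)) else 0)"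
      unfolding sum_if by (rule sum.reindex_bij_betw[OF signed_perms.bij_betw_conjugation[OF u], symmetric])
    also have "\<dots> = ?s c'"
      unfolding sum_if
    proof (rule sum.cong[OF refl])
      fix v assume v: "v \<in> ?G"
      have "u \<circ> v \<circ> inv u \<in> colour_stabilizer n c \<longleftrightarrow> v \<in> colour_stabilizer n c'"
        using u v transport by (rule colour_stabilizer_conjugate_iff)
      moreover have "colour_sign n c (u \<circ> v \<circ> inv u) = colour_sign n c' v" if "v \<in> colour_stabilizer n c'"
        using u that transport by (rule colour_sign_conjugate)
      ultimately show "(if u \<circ> v \<circ> inv u \<in> colour_stabilizer n c
          then f (u \<circ> v \<circ> inv u) * of_int (colour_sign n c (u \<circ> v \<circ> inv u)) else 0)
          = (if v \<in> colour_stabilizer n c' then f v * of_int (colour_sign n c' v) else 0)"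
        unfolding class_functionD[OF class_f u v] by presburger
    qed
    finally show ?thesis ..
  qed
  then have "(\<Sum>c'\<in>colourings n ?M. ?s c') = of_nat (card (colourings n ?M)) * ?s c" by simp
  moreover have "(\<Sum>c'\<in>colourings n ?M. ?s c') = 0"
    using mcoeff_ch_colourings[of n f ?M] ch by (simp add: mcoeff_0 card_signed_perms)
  moreover have "card (colourings n ?M) \<noteq> 0" using mem finite_colourings[of n ?M] by auto
  ultimately show ?thesis by simp
qed

lemma refines_imp_eq:
  assumes "refines A P Q" "finite P" "card P \<le> card Q" shows "P = Q"
proof -
  have P_partition: "partition_on A P" and Q_partition: "partition_on A Q" and "\<forall>X\<in>P. \<exists>Y\<in>Q. X \<subseteq> Y"
    using assms(1) by (auto simp: refines_def)
  then obtain h where h: "\<And>X. X \<in> P \<Longrightarrow> h X \<in> Q" "\<And>X. X \<in> P \<Longrightarrow> X \<subseteq> h X" by metis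
  have h_eq: "h X = Y" if "X \<in> P" "Y \<in> Q" "x \<in> X" "x \<in> Y" for X Y x
    using h[OF that(1)] that disjointD[OF partition_onD2[OF Q_partition], of "h X" Y] by blast
  have cover: "\<exists>X\<in>P. x \<in> X" if "Y \<in> Q" "x \<in> Y" for x Y
    using that partition_onD1[OF P_partition] partition_onD1[OF Q_partition] by blast
  have "Y \<in> h ` P" if "Y \<in> Q" for Y
  proof -
    have "Y \<noteq> {}" using that partition_onD3[OF Q_partition] by metis
    then obtain x where "x \<in> Y" by blast
    then show ?thesis using cover[OF that] h_eq[OF _ that] by blast
  qed
  then have image: "h ` P = Q" using h(1) by blast
  then have "card (h ` P) = card P" using card_image_le[OF assms(2), of h] assms(3) by simp
  then have inj: "inj_on h P" by (rule eq_card_imp_inj_on[OF assms(2)])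
  have "h X = X" if X: "X \<in> P" for X
  proof
    show "h X \<subseteq> X"
    proof
      fix x assume x: "x \<in> h X"
      then obtain X' where X': "X' \<in> P" "x \<in> X'" using cover h(1)[OF X] by blast
      then have "X' = X" using h_eq[OF X'(1) h(1)[OF X] X'(2) x] inj_onD[OF inj _ X'(1) X] by blast
      then show "x \<in> X" using X'(2) by simp
    qed
  qed (rule h(2)[OF X])
  then show ?thesis using image by simp
qed

lemma partition_on_abs_cycles:
  assumes "w \<in> signed_perms n" shows "partition_on {1..int n} (abs_cycles n w)"
  using Union_abs_cycles[OF assms] abs_cycles_disjoint[OF assms]
  by (intro partition_onI) (auto simp: disjnt_def dest: abs_cycle_nonempty)

definition cycle_colouring :: "nat \<Rightarrow> (int \<Rightarrow> int) \<Rightarrow> int set set \<Rightarrow> int \<Rightarrow> var" where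
  "cycle_colouring n v T =
    (\<lambda>i\<in>{1..int n}. mk_var (orbit (unsigned v) i \<notin> T) (nat (Min (orbit (unsigned v) i))))"

lemma cycle_colouring_eq_iff:
  assumes v: "v \<in> signed_perms n" and i: "i \<in> {1..int n}" and j: "j \<in> {1..int n}"
  shows "cycle_colouring n v T i = cycle_colouring n v T j \<longleftrightarrow> orbit (unsigned v) i = orbit (unsigned v) j"
proof
  let ?b = "orbit (unsigned v)"
  note Min_i = Min_abs_cycle[OF v orbit_in_abs_cycles[OF i]] and Min_j = Min_abs_cycle[OF v orbit_in_abs_cycles[OF j]]
  assume "cycle_colouring n v T i = cycle_colouring n v T j"
  then have "nat (Min (?b i)) = nat (Min (?b j))" using i j by (simp add: cycle_colouring_def)
  then have Min_eq: "Min (?b i) = Min (?b j)" using Min_i(2) Min_j(2) by (simp add: eq_nat_nat_iff)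
  have "?b i = ?b (Min (?b i))" by (rule abs_cycle_eq_orbit[OF v orbit_in_abs_cycles[OF i] Min_i(1), symmetric])
  also have "\<dots> = ?b j"
    unfolding Min_eq by (rule abs_cycle_eq_orbit[OF v orbit_in_abs_cycles[OF j] Min_j(1)])
  finally show "?b i = ?b j" .
qed (use i j in \<open>simp add: cycle_colouring_def\<close>)

lemma colour_stabilizer_cycle_colouring:
  assumes v: "v \<in> signed_perms n"
  shows "colour_stabilizer n (cycle_colouring n v T)
    = {w \<in> signed_perms n. refines {1..int n} (abs_cycles n w) (abs_cycles n v)}"
proof -
  have constant_iff: "(\<forall>b\<in>abs_cycles n w. \<forall>i\<in>b. \<forall>j\<in>b. cycle_colouring n v T i = cycle_colouring n v T j)
      \<longleftrightarrow> (\<forall>b\<in>abs_cycles n w. \<exists>d\<in>abs_cycles n v. b \<subseteq> d)" if w: "w \<in> signed_perms n" for w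
  proof (rule ball_cong[OF refl])
    fix b assume b: "b \<in> abs_cycles n w"
    note b_subset = abs_cycle_subset[OF w b] and Min_b = Min_abs_cycle[OF w b]
    have "(\<forall>i\<in>b. \<forall>j\<in>b. cycle_colouring n v T i = cycle_colouring n v T j)
        \<longleftrightarrow> (\<forall>i\<in>b. \<forall>j\<in>b. orbit (unsigned v) i = orbit (unsigned v) j)"
      using cycle_colouring_eq_iff[OF v] b_subset by blast
    also have "\<dots> \<longleftrightarrow> (\<exists>d\<in>abs_cycles n v. b \<subseteq> d)"
    proof
      assume "\<forall>i\<in>b. \<forall>j\<in>b. orbit (unsigned v) i = orbit (unsigned v) j"
      then have "b \<subseteq> orbit (unsigned v) (Min b)" using Min_b(1) self_in_abs_cycle[OF v] by blast
      then show "\<exists>d\<in>abs_cycles n v. b \<subseteq> d" using orbit_in_abs_cycles[OF Min_b(2)] by blast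
    qed (use abs_cycle_eq_orbit[OF v] in blast)
    finally show "(\<forall>i\<in>b. \<forall>j\<in>b. cycle_colouring n v T i = cycle_colouring n v T j) \<longleftrightarrow> \<dots>" .
  qed
  have "w \<in> colour_stabilizer n (cycle_colouring n v T)
      \<longleftrightarrow> w \<in> signed_perms n \<and> refines {1..int n} (abs_cycles n w) (abs_cycles n v)" for w
  proof (cases "w \<in> signed_perms n")
    case True
    then show ?thesis
      using constant_iff[OF True] partition_on_abs_cycles[OF v] partition_on_abs_cycles[OF True]
      by (simp add: refines_def colour_stabilizer_iff[OF True])
  qed (auto dest: colour_stabilizerD)
  then show ?thesis by blast
qed

lemma y_positions_cycle_colouring:
  assumes v: "v \<in> signed_perms n" and T: "T \<subseteq> abs_cycles n v"
  shows "y_positions n (cycle_colouring n v T) = \<Union>T"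
proof -
  have "y_positions n (cycle_colouring n v T) = {i \<in> {1..int n}. orbit (unsigned v) i \<in> T}"
    by (auto simp: y_positions_def cycle_colouring_def)
  also have "\<dots> = \<Union>T"
    using abs_cycle_subset[OF v] abs_cycle_eq_orbit[OF v] self_in_abs_cycle[OF v] T by blast
  finally show ?thesis .
qed

lemma colour_sign_cycle_colouring:
  assumes v: "v \<in> signed_perms n" and T: "T \<subseteq> abs_cycles n v"
  shows "colour_sign n (cycle_colouring n v T) w = (\<Prod>b\<in>T. cycle_sign w b)"
proof -
  have "colour_sign n (cycle_colouring n v T) w = (\<Prod>b\<in>T. \<Prod>i\<in>b. sgn (w i))"
    unfolding colour_sign_eq_prod y_positions_cycle_colouring[OF assms]
    using prod.Union_disjoint[of T "\<lambda>i. sgn (w i)"] finite_abs_cycle[OF v] abs_cycles_disjoint[OF v] T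
    by (simp add: subset_iff)
  then show ?thesis by (simp add: cycle_sign_def)
qed

lemma sum_sign_patterns:
  fixes s t :: "'a \<Rightarrow> int"
  assumes "finite Q" and s_unit: "\<forall>b\<in>Q. \<bar>s b\<bar> = 1" and t_unit: "\<forall>b\<in>Q. \<bar>t b\<bar> = 1"
  shows "(\<Sum>T\<in>Pow Q. (\<Prod>b\<in>T. s b) * (\<Prod>b\<in>T. t b)) = (if \<forall>b\<in>Q. s b = t b then 2 ^ card Q else 0)"
proof -
  have factor: "s b * t b + 1 = (if s b = t b then 2 else 0)" if "b \<in> Q" for b
  proof -
    have "s b = 1 \<or> s b = - 1" "t b = 1 \<or> t b = - 1" using s_unit t_unit that by (auto simp: abs_if split: if_splits)
    then show ?thesis by auto
  qed
  have "(\<Sum>T\<in>Pow Q. (\<Prod>b\<in>T. s b) * (\<Prod>b\<in>T. t b)) = (\<Prod>b\<in>Q. s b * t b + 1)"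
    unfolding prod_add[OF assms(1)] by (simp add: prod.distrib)
  also have "\<dots> = (\<Prod>b\<in>Q. if s b = t b then 2 else 0)"
    using factor by (intro prod.cong) simp_all
  also have "\<dots> = (if \<forall>b\<in>Q. s b = t b then 2 ^ card Q else 0)"
    using assms(1) by auto
  finally show ?thesis .
qed

text \<open>The equations of the colourings \<open>cycle_colouring n v T\<close> are combined with the signs of \<open>v\<close> as coefficients.\<close>

lemma sum_refinements_eq_0:
  assumes class_f: "class_function (signed_perms n) f" and ch: "ch n f = 0" and v: "v \<in> signed_perms n"
  shows "(\<Sum>w | w \<in> signed_perms n \<and> refines {1..int n} (abs_cycles n w) (abs_cycles n v)
      \<and> (\<forall>b\<in>abs_cycles n v. cycle_sign w b = cycle_sign v b). f w) = 0"
proof -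
  let ?Q = "abs_cycles n v" and ?c = "\<lambda>T w. of_int (\<Prod>b\<in>T. cycle_sign w b) :: complex"
  define R where "R = {w \<in> signed_perms n. refines {1..int n} (abs_cycles n w) ?Q}"
  have fin: "finite R" using signed_perms.finite_carrier[of n] by (simp add: R_def)
  have sign: "\<forall>b\<in>?Q. \<bar>cycle_sign w b\<bar> = 1" if "w \<in> signed_perms n" for w
    using abs_cycle_sign[OF that abs_cycle_subset[OF v]] by blast
  have colour_sum: "(\<Sum>w\<in>R. f w * ?c T w) = 0" if T: "T \<subseteq> ?Q" for T
  proof -
    have "cycle_colouring n v T \<in> {1..int n} \<rightarrow>\<^sub>E UNIV" by (simp add: cycle_colouring_def)
    from colour_sum_eq_0[OF class_f ch this] show ?thesis
      unfolding colour_stabilizer_cycle_colouring[OF v] colour_sign_cycle_colouring[OF v T] R_def .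
  qed
  have "0 = (\<Sum>T\<in>Pow ?Q. ?c T v * (\<Sum>w\<in>R. f w * ?c T w))"
    using colour_sum by (simp add: sum.neutral)
  also have "\<dots> = (\<Sum>w\<in>R. f w * of_int (\<Sum>T\<in>Pow ?Q. (\<Prod>b\<in>T. cycle_sign w b) * (\<Prod>b\<in>T. cycle_sign v b)))"
    unfolding sum_distrib_left of_int_sum by (subst sum.swap) (simp add: mult_ac)
  also have "\<dots> = (\<Sum>w\<in>R. if \<forall>b\<in>?Q. cycle_sign w b = cycle_sign v b then 2 ^ card ?Q * f w else 0)"
    using sign v by (intro sum.cong refl) (simp add: sum_sign_patterns finite_abs_cycles R_def)
  also have "\<dots> = 2 ^ card ?Q * (\<Sum>w\<in>{w \<in> R. \<forall>b\<in>?Q. cycle_sign w b = cycle_sign v b}. f w)"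
    unfolding sum_distrib_left by (rule sum.inter_filter[OF fin, symmetric])
  finally show ?thesis by (simp add: R_def)
qed

text \<open>Among the signed permutations whose cycles refine those of \<open>v\<close>, with the same signs, all but the conjugates of
  \<open>v\<close> have more cycles than \<open>v\<close>.\<close>

lemma ch_eq_0_imp_eq_0:
  assumes class_f: "class_function (signed_perms n) f" and ch: "ch n f = 0" and "v \<in> signed_perms n"
  shows "f v = 0"
  using assms(3)
proof (induction "n - card (abs_cycles n v)" arbitrary: v rule: less_induct)
  case less
  note v = less.prems
  let ?Q = "abs_cycles n v"
  define S where "S = {w \<in> signed_perms n. refines {1..int n} (abs_cycles n w) ?Q
    \<and> (\<forall>b\<in>?Q. cycle_sign w b = cycle_sign v b)}"
  have fin: "finite S" using signed_perms.finite_carrier[of n] by (simp add: S_def)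
  have "f w = (if abs_cycles n w = ?Q then f v else 0)" if "w \<in> S" for w
  proof (cases "abs_cycles n w = ?Q")
    case True
    have w: "w \<in> signed_perms n" "\<forall>b\<in>abs_cycles n w. cycle_sign w b = cycle_sign v b"
      using that True by (simp_all add: S_def)
    obtain u where u: "u \<in> signed_perms n" "u \<circ> w = v \<circ> u"
      by (rule conjugate_of_same_cycles[OF w(1) v True w(2)])
    then have "u \<circ> w \<circ> inv u = v" by (simp add: comp_assoc signed_perms.comp_inv)
    then show ?thesis using class_functionD[OF class_f u(1) w(1)] True by simp
  next
    case False
    have w: "w \<in> signed_perms n" "refines {1..int n} (abs_cycles n w) ?Q" using that by (simp_all add: S_def)
    then have "card ?Q < card (abs_cycles n w)"
      using refines_imp_eq[OF w(2) finite_abs_cycles] False by linarith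
    then have "n - card (abs_cycles n w) < n - card ?Q" using card_abs_cycles_le[of n w] by simp
    then show ?thesis using less.hyps w(1) False by simp
  qed
  then have "(\<Sum>w\<in>S. f w) = (\<Sum>w\<in>S. if abs_cycles n w = ?Q then f v else 0)" by (intro sum.cong) simp_all
  also have "\<dots> = of_nat (card {w \<in> S. abs_cycles n w = ?Q}) * f v"
    using fin by (simp flip: sum.inter_filter)
  also have "(\<Sum>w\<in>S. f w) = 0" unfolding S_def by (rule sum_refinements_eq_0[OF class_f ch v])
  finally have "of_nat (card {w \<in> S. abs_cycles n w = ?Q}) * f v = 0" ..
  moreover have "v \<in> {w \<in> S. abs_cycles n w = ?Q}"
    using v refines_refl[OF partition_on_abs_cycles[OF v]] by (simp add: S_def)
  then have "card {w \<in> S. abs_cycles n w = ?Q} \<noteq> 0" using fin by auto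
  ultimately show ?case by simp
qed

section \<open>The exterior powers are irreducible\<close>

lemma ext_sign_id:
  assumes "I \<subseteq> {1..int n}" shows "ext_sign id I = 1"
proof -
  have "(\<Prod>i\<in>I. sgn i) = 1" using assms by (intro prod.neutral) auto
  then show ?thesis using finite_subset[OF assms] by (simp add: ext_sign_def unsigned_id inv_sign_id)
qed

lemma ext_sign_nonzero:
  assumes "w \<in> signed_perms n" "I \<subseteq> {1..int n}" shows "ext_sign w I \<noteq> 0"
proof
  assume "ext_sign w I = 0"
  then have "ext_sign (inv w \<circ> w) I = 0"
    using ext_sign_comp[OF signed_perms.inv_mem[OF assms(1)] assms] by simp
  then show False unfolding signed_perms.inv_comp[OF assms(1)] ext_sign_id[OF assms(2)] by simp
qed

lemma signed_perms_subset_transitive: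
  assumes "A \<subseteq> {1..int n}" "B \<subseteq> {1..int n}" "card A = card B"
  obtains u where "u \<in> signed_perms n" "unsigned u ` A = B"
proof -
  let ?N = "{1..int n}"
  have fin: "finite A" "finite B" using assms finite_subset by blast+
  then have "card (?N - A) = card (?N - B)" using assms by (simp add: card_Diff_subset)
  then obtain f g where f_bij: "bij_betw f A B" and g_bij: "bij_betw g (?N - A) (?N - B)"
    using finite_same_card_bij[OF fin assms(3)] finite_same_card_bij[of "?N - A" "?N - B"] by auto
  define p where "p i = (if i \<in> A then f i else g i)" for i
  have p_bij: "bij_betw p ?N ?N"
    using bij_betw_disjoint_Un[OF f_bij g_bij] assms(1,2) by (simp add: p_def[abs_def] Un_absorb1)
  have p_mem: "p i \<in> ?N" if "i \<in> ?N" for i using p_bij that by (auto simp: bij_betw_def)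
  then have abs_p: "\<bar>p i\<bar> = p i" if "i \<in> ?N" for i using that by force
  have u_mem: "odd_extension n p \<in> signed_perms n"
  proof (rule odd_extension_signed_perm)
    show "\<bar>p i\<bar> \<in> ?N" if "i \<in> ?N" for i using p_mem[OF that] abs_p[OF that] by (simp only:)
    show "inj_on (\<lambda>i. \<bar>p i\<bar>) ?N"
      using bij_betw_imp_inj_on[OF p_bij] inj_on_cong[of ?N "\<lambda>i. \<bar>p i\<bar>" p] abs_p by blast
  qed
  have "unsigned (odd_extension n p) i = p i" if "i \<in> ?N" for i
    using that abs_p[OF that] by (simp add: unsigned_eq_abs odd_extension_eq)
  then have "unsigned (odd_extension n p) ` A = p ` A" using assms(1) by (intro image_cong) auto
  also have "\<dots> = B" using f_bij by (simp add: p_def bij_betw_def)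
  finally show ?thesis using that u_mem by blast
qed

text \<open>The action on the exterior power in the basis \<open>ext_basis (e p)\<close>, \<open>p < d\<close>.\<close>

definition ext_power_matrix :: "nat \<Rightarrow> (nat \<Rightarrow> int set) \<Rightarrow> (int \<Rightarrow> int) \<Rightarrow> complex mat" where
  "ext_power_matrix d e w
    = mat d d (\<lambda>(p, q). if unsigned w ` e q = e p then of_int (ext_sign w (e q)) else 0)"

context
  fixes n j d :: nat and e :: "nat \<Rightarrow> int set"
  assumes e: "bij_betw e {..<d} {I. I \<subseteq> {1..int n} \<and> card I = j}"
begin

lemma basis_subset: "p < d \<Longrightarrow> e p \<subseteq> {1..int n}" and card_basis: "p < d \<Longrightarrow> card (e p) = j"
  using e by (auto simp: bij_betw_def)

lemma basis_eq_iff: "p < d \<Longrightarrow> q < d \<Longrightarrow> e p = e q \<longleftrightarrow> p = q"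
  using e by (auto simp: bij_betw_def inj_on_def)

lemma basis_image:
  assumes "w \<in> signed_perms n" "q < d"
  obtains p where "p < d" "e p = unsigned w ` e q"
proof -
  have "unsigned w ` e q \<subseteq> {1..int n}"
    using basis_subset[OF assms(2)] unsigned_mem[OF assms(1)] by blast
  moreover have "card (unsigned w ` e q) = j"
    using card_basis[OF assms(2)] inj_on_subset[OF inj_unsigned[OF assms(1)]] by (simp add: card_image)
  ultimately have "unsigned w ` e q \<in> e ` {..<d}" using e by (simp add: bij_betw_def)
  then show ?thesis using that by auto
qed

lemma ext_power_matrix_carrier: "ext_power_matrix d e w \<in> carrier_mat d d"
  by (simp add: ext_power_matrix_def)

lemma col_ext_power_matrix:
  assumes "q < d" "p < d" "e p = unsigned w ` e q"
  shows "col (ext_power_matrix d e w) q = of_int (ext_sign w (e q)) \<cdot>\<^sub>v unit_vec d p"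
proof (rule eq_vecI)
  fix r assume "r < dim_vec (of_int (ext_sign w (e q)) \<cdot>\<^sub>v unit_vec d p :: complex vec)"
  then have "r < d" by simp
  then show "col (ext_power_matrix d e w) q $ r = (of_int (ext_sign w (e q)) \<cdot>\<^sub>v unit_vec d p) $ r"
    using assms basis_eq_iff[of p r] by (auto simp: ext_power_matrix_def)
qed (simp add: ext_power_matrix_def)

lemma representation_ext_power_matrix: "representation (signed_perms n) d (ext_power_matrix d e)"
  unfolding representation_def
proof (intro conjI ballI)
  note carrier = ext_power_matrix_carrier
  show "ext_power_matrix d e id = 1\<^sub>m d"
  proof (rule mat_col_eqI)
    fix q assume "q < dim_col (1\<^sub>m d :: complex mat)"
    then have q_less: "q < d" by simp
    then show "col (ext_power_matrix d e id) q = col (1\<^sub>m d) q"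
      using col_ext_power_matrix[OF q_less q_less, of id] by (simp add: unsigned_id ext_sign_id[OF basis_subset[OF q_less]])
  qed (use carrier in auto)
  fix u v assume u: "u \<in> signed_perms n" and v: "v \<in> signed_perms n"
  show "ext_power_matrix d e (u \<circ> v) = ext_power_matrix d e u * ext_power_matrix d e v"
  proof (rule mat_col_eqI)
    fix q assume "q < dim_col (ext_power_matrix d e u * ext_power_matrix d e v)"
    then have q_less: "q < d" by (simp add: ext_power_matrix_def)
    obtain p where p: "p < d" "e p = unsigned v ` e q" by (rule basis_image[OF v q_less])
    obtain r where r: "r < d" "e r = unsigned u ` e p" by (rule basis_image[OF u p(1)])
    have "col (ext_power_matrix d e u * ext_power_matrix d e v) q
        = of_int (ext_sign v (e q)) \<cdot>\<^sub>v (ext_power_matrix d e u *\<^sub>v unit_vec d p)"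
      using col_mult2[OF carrier carrier q_less] col_ext_power_matrix[OF q_less p] mult_mat_vec[OF carrier unit_vec_carrier] by simp
    also have "\<dots> = of_int (ext_sign u (e p) * ext_sign v (e q)) \<cdot>\<^sub>v unit_vec d r"
      using mult_mat_vec_unit_vec[OF carrier p(1)] col_ext_power_matrix[OF p(1) r] by (simp add: smult_smult_assoc mult.commute)
    also have "\<dots> = col (ext_power_matrix d e (u \<circ> v)) q"
      using col_ext_power_matrix[OF q_less r(1), of "u \<circ> v"] r(2)
      by (simp add: ext_sign_comp[OF u v basis_subset[OF q_less]] unsigned_comp[OF u v] image_image p(2))
    finally show "col (ext_power_matrix d e (u \<circ> v)) q = col (ext_power_matrix d e u * ext_power_matrix d e v) q" ..
  qed (simp_all add: ext_power_matrix_def)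
qed (rule ext_power_matrix_carrier)

lemma ext_power_matrix_sign_flip:
  "ext_power_matrix d e (sign_flip n k) = mat_diag d (\<lambda>q. if k \<in> e q then - 1 else 1)"
proof (rule mat_col_eqI)
  fix q assume "q < dim_col (mat_diag d (\<lambda>q. if k \<in> e q then - 1 else 1) :: complex mat)"
  then have q_less: "q < d" by (simp add: mat_diag_def)
  then show "col (ext_power_matrix d e (sign_flip n k)) q = col (mat_diag d (\<lambda>q. if k \<in> e q then - 1 else 1)) q"
    using col_ext_power_matrix[OF q_less q_less, of "sign_flip n k"]
    by (auto simp: unsigned_sign_flip ext_sign_sign_flip[OF basis_subset[OF q_less]] mat_diag_def intro!: eq_vecI)
qed (simp_all add: mat_diag_def ext_power_matrix_def)

lemma irreducible_ext_power_matrix: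
  assumes "d > 0" shows "irreducible_representation (signed_perms n) d (ext_power_matrix d e)"
proof (rule irreducible_representation_monomial[OF representation_ext_power_matrix assms])
  fix p q assume p_less: "p < d" and q_less: "q < d"
  show "\<exists>u\<in>signed_perms n. \<exists>c. ext_power_matrix d e u = mat_diag d c \<and> c p \<noteq> c q" if "p \<noteq> q"
  proof -
    have "e p \<noteq> e q" using basis_eq_iff[OF p_less q_less] that by simp
    then obtain k where "k \<in> e p \<longleftrightarrow> k \<notin> e q" by blast
    then show ?thesis
      using sign_flip_mem[of n k] ext_power_matrix_sign_flip[of k]
      by (intro bexI[of _ "sign_flip n k"] exI[of _ "\<lambda>r. if k \<in> e r then - 1 else 1"]) auto
  qed
  obtain u where u: "u \<in> signed_perms n" "unsigned u ` e p = e q"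
    using signed_perms_subset_transitive[OF basis_subset[OF p_less] basis_subset[OF q_less]] card_basis[OF p_less] card_basis[OF q_less] by auto
  have "ext_power_matrix d e u *\<^sub>v unit_vec d p = of_int (ext_sign u (e p)) \<cdot>\<^sub>v unit_vec d q"
    using mult_mat_vec_unit_vec[OF ext_power_matrix_carrier p_less] col_ext_power_matrix[OF p_less q_less, of u] u(2) by simp
  then show "\<exists>u\<in>signed_perms n. \<exists>a. a \<noteq> 0 \<and> ext_power_matrix d e u *\<^sub>v unit_vec d p = a \<cdot>\<^sub>v unit_vec d q"
    using u(1) ext_sign_nonzero[OF u(1) basis_subset[OF p_less]] by (metis of_int_eq_0_iff)
qed

lemma trace_ext_power_matrix:
  assumes "w \<in> signed_perms n"
  shows "(\<Sum>q<d. ext_power_matrix d e w $$ (q, q)) = ext_power_char n j w"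
proof -
  have "(\<Sum>q<d. ext_power_matrix d e w $$ (q, q))
      = (\<Sum>q<d. if unsigned w ` e q = e q then of_int (ext_sign w (e q)) else 0)"
    by (simp add: ext_power_matrix_def)
  also have "\<dots> = (\<Sum>I | I \<subseteq> {1..int n} \<and> card I = j. if unsigned w ` I = I then of_int (ext_sign w I) else 0)"
    by (rule sum.reindex_bij_betw[OF e])
  also have "\<dots> = ext_power_char n j w"
    using assms bij_betw_finite[OF e] by (simp add: ext_power_char_def conj_assoc flip: sum.inter_filter)
  finally show ?thesis .
qed

end

lemma irreducible_character_ext_power:
  assumes "j \<le> n" shows "irreducible_character (signed_perms n) (ext_power_char n j)"
proof -
  let ?J = "{I. I \<subseteq> {1..int n} \<and> card I = j}"
  have fin: "finite ?J" by (rule finite_subset[of _ "Pow {1..int n}"]) auto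
  obtain e where e_bij: "bij_betw e {..<card ?J} ?J"
    using ex_bij_betw_nat_finite[OF fin] unfolding lessThan_atLeast0 by blast
  have "?J \<noteq> {}" using obtain_subset_with_card_n[of j "{1..int n}"] assms by auto
  then have "card ?J > 0" using fin by (simp add: card_gt_0_iff)
  moreover have "ext_power_char n j
      = (\<lambda>w. if w \<in> signed_perms n then \<Sum>q<card ?J. ext_power_matrix (card ?J) e w $$ (q, q) else 0)"
  proof
    fix w show "ext_power_char n j w
        = (if w \<in> signed_perms n then \<Sum>q<card ?J. ext_power_matrix (card ?J) e w $$ (q, q) else 0)"
    proof (cases "w \<in> signed_perms n")
      case True
      then show ?thesis using trace_ext_power_matrix[OF e_bij True] by simp
    qed (simp add: ext_power_char_def)
  qed
  ultimately show ?thesis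
    using irreducible_ext_power_matrix[OF e_bij] unfolding irreducible_character_def by blast
qed

lemma ch_diff: "ch n (\<lambda>w. f w - g w) = ch n f - ch n g"
  by (rule mseries_eqI) (simp add: mcoeff_ch mcoeff_diff left_diff_distrib sum_subtractf diff_divide_distrib)

lemma ch_sum: "ch n (\<lambda>w. \<Sum>k\<in>K. f k w) = (\<Sum>k\<in>K. ch n (f k))"
proof (rule mseries_eqI)
  fix M
  have "(\<Sum>w\<in>signed_perms n. (\<Sum>k\<in>K. f k w) * mcoeff (type_series (signed_cycle_type n w)) M)
      = (\<Sum>k\<in>K. \<Sum>w\<in>signed_perms n. f k w * mcoeff (type_series (signed_cycle_type n w)) M)"
    unfolding sum_distrib_right by (rule sum.swap)
  then show "mcoeff (ch n (\<lambda>w. \<Sum>k\<in>K. f k w)) M = mcoeff (\<Sum>k\<in>K. ch n (f k)) M"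
    unfolding mcoeff_ch mcoeff_sum by (simp add: sum_divide_distrib)
qed

lemma irreducible_character_eqI:
  assumes "irreducible_character (signed_perms n) \<chi>" "irreducible_character (signed_perms n) \<psi>" "ch n \<chi> = ch n \<psi>"
  shows "\<chi> = \<psi>"
proof
  fix w
  have "class_function (signed_perms n) (\<lambda>w. \<chi> w - \<psi> w)"
    using assms(1,2)[THEN signed_perms.irreducible_character_class_function] by (simp add: class_function_def)
  moreover have "ch n (\<lambda>w. \<chi> w - \<psi> w) = 0" using assms(3) by (simp add: ch_diff)
  ultimately have "w \<in> signed_perms n \<Longrightarrow> \<chi> w - \<psi> w = 0" using ch_eq_0_imp_eq_0 by blast
  then show "\<chi> w = \<psi> w"
    using assms(1,2) by (cases "w \<in> signed_perms n") (auto simp: irreducible_character_def)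
qed

lemma irr_char_hook:
  assumes "k + j = m"
  shows "irr_char m [k] (replicate j 1) = ext_power_char m j"
  unfolding irr_char_def
proof (rule the_equality)
  have "irreducible_character (signed_perms m) (ext_power_char m j)"
    using assms by (intro irreducible_character_ext_power) simp
  then show "irreducible_character (signed_perms m) (ext_power_char m j)
      \<and> ch m (ext_power_char m j) = schur X [k] * schur Y (replicate j 1)"
    using ch_ext_power_char[OF assms] by blast
  then show "\<chi> = ext_power_char m j"
    if "irreducible_character (signed_perms m) \<chi> \<and> ch m \<chi> = schur X [k] * schur Y (replicate j 1)" for \<chi>
    using that by (intro irreducible_character_eqI) auto
qed

theorem theorem8p3:
  fixes n :: nat
  assumes "n \<ge> 2"
  shows "fine_set n (signed_arc_perms n) (sDes n)
           (induced (signed_perms (n - 1)) (signed_perms n) (ext_char (n - 1))) \<and>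
         (\<Sum>w \<in> signed_arc_perms n. F_fun n (sDes n w)) =
           ch n (\<lambda>w. \<Sum>k = 0..n - 1.
             induced (signed_perms (n - 1)) (signed_perms n)
               (irr_char (n - 1) [k] (replicate (n - k - 1) 1)) w)"
proof
  show "fine_set n (signed_arc_perms n) (sDes n)
      (induced (signed_perms (n - 1)) (signed_perms n) (ext_char (n - 1)))"
    by (rule fine_set_signed_arc_perms[OF assms])
  have "ch n (induced (signed_perms (n - 1)) (signed_perms n) (irr_char (n - 1) [k] (replicate (n - k - 1) 1)))
      = p_plus 1 * (schur X [k] * schur Y (replicate (n - 1 - k) 1))" if "k \<in> {0..n - 1}" for k
  proof -
    have hook: "k + (n - 1 - k) = n - 1" and "n - k - 1 = n - 1 - k" "n \<ge> 1" using that assms by auto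
    then show ?thesis by (simp only: ch_induced irr_char_hook[OF hook] ch_ext_power_char[OF hook])
  qed
  then have "(\<Sum>k = 0..n - 1. ch n (induced (signed_perms (n - 1)) (signed_perms n)
        (irr_char (n - 1) [k] (replicate (n - k - 1) 1))))
      = p_plus 1 * (\<Sum>k = 0..n - 1. schur X [k] * schur Y (replicate (n - 1 - k) 1))"
    unfolding sum_distrib_left by (rule sum.cong[OF refl])
  then show "(\<Sum>w \<in> signed_arc_perms n. F_fun n (sDes n w)) = ch n (\<lambda>w. \<Sum>k = 0..n - 1.
      induced (signed_perms (n - 1)) (signed_perms n) (irr_char (n - 1) [k] (replicate (n - k - 1) 1)) w)"
    unfolding ch_sum sum_F_signed_arc_perms[OF assms] by (rule sym)
qed

end
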